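(* Let $F\subset\mathbb{R}$ be a finite field extension of $\mathbb{Q}$. Then there is an integer $D=D(F)$ such that for every $d\ge D$ there is an infinite family of projectively unique $d$-dimensional polytopes $P_n\subset S^d_+$, $n\ge1$, where $P_n$ has $12(n+1)+d+D(F)-9$ vertices, all vertices have (homogeneous) coordinates in $F$, and $P_n$ is not realizable in $S^d_+$ with coordinates in $G$ for any strict subfield $G$ of $F$.
   Context: $S^d_+$ is the open upper hemisphere of the unit sphere $S^d\subset\mathbb{R}^{d+1}$ centered at $e_{d+1}$; points of $S^d_+$ are described by homogeneous coordinates with last coordinate normalized to $1$. A polytope is realizable with coordinates in a field $G$ if some polytope combinatorially equivalent to it has all vertex coordinates in $G$. A $d$-polytope $P$ is projectively unique if the projective group $\mathrm{PGL}(\mathbb{R}^{d+1})$ acts transitively on its realization space, i.e. for every polytope $P'$ and every combinatorial (face-lattice) isomorphism from $P$ to $P'$ there is a projective transformation mapping $P$ onto $P'$ inducing that isomorphism on vertices. *)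

theory Defs
  imports
    "HOL-Analysis.Analysis"
    "HOL-Analysis.Finite_Function_Topology"
    "HOL-Algebra.Embedded_Algebras"
begin

text \<open>
  The dimension \<open>d\<close> is quantified inside the theorem, so it cannot be a type. All points live in
  \<open>nat \<Rightarrow>\<^sub>0 real\<close>, which is a \<open>real_vector\<close>, and \<open>\<real>\<^sup>m\<close> is the subspace of vectors supported on the
  coordinates \<open>0, \<dots>, m - 1\<close>. In \<open>\<real>\<^bsup>d+1\<^esup>\<close> the coordinate written \<open>x\<^bsub>d+1\<^esub>\<close> in mathematical texts
  therefore has index \<open>d\<close>.
\<close>

type_synonym rvec = "nat \<Rightarrow>\<^sub>0 real"

definition coord_space :: "nat \<Rightarrow> rvec set"
  where "coord_space m = {x. Poly_Mapping.keys x \<subseteq> {..<m}}"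

text \<open>The library norm on \<open>nat \<Rightarrow>\<^sub>0 real\<close> is the 1-norm, hence the explicit sum of squares.\<close>

definition unit_sphere :: "nat \<Rightarrow> rvec set"
  where "unit_sphere d =
    {x \<in> coord_space (Suc d). (\<Sum>i\<le>d. (Poly_Mapping.lookup x i)\<^sup>2) = 1}"

definition upper_hemisphere :: "nat \<Rightarrow> rvec set"
  where "upper_hemisphere d = {x \<in> unit_sphere d. 0 < Poly_Mapping.lookup x d}"

definition homog :: "nat \<Rightarrow> rvec \<Rightarrow> rvec"
  where "homog d x = inverse (Poly_Mapping.lookup x d) *\<^sub>R x"

text \<open>
  On the open hemisphere, \<open>homog d\<close> is the central projection onto the affine hyperplane of
  vectors with last coordinate \<open>1\<close>. It is a bijection that takes great circle arcs to segments, so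
  convexity, polytopes and faces in the hemisphere are those of the image under \<open>homog d\<close>.
\<close>

definition sph_polytope :: "nat \<Rightarrow> rvec set \<Rightarrow> bool"
  where "sph_polytope d P \<longleftrightarrow> P \<subseteq> upper_hemisphere d \<and> polytope (homog d ` P)"

text \<open>The dimension of a subset of the sphere is one less than that of its linear span.\<close>

definition sph_d_polytope :: "nat \<Rightarrow> rvec set \<Rightarrow> bool"
  where "sph_d_polytope d P \<longleftrightarrow> sph_polytope d P \<and> dim P = Suc d"

definition sph_faces :: "nat \<Rightarrow> rvec set \<Rightarrow> rvec set set"
  where "sph_faces d P = {T. T \<subseteq> P \<and> (homog d ` T) face_of (homog d ` P)}"

definition sph_vertices :: "nat \<Rightarrow> rvec set \<Rightarrow> rvec set"
  where "sph_vertices d P = {v \<in> P. homog d v extreme_point_of (homog d ` P)}"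

definition face_lattice_iso ::
  "nat \<Rightarrow> rvec set \<Rightarrow> rvec set \<Rightarrow> (rvec set \<Rightarrow> rvec set) \<Rightarrow> bool"
  where "face_lattice_iso d P Q \<phi> \<longleftrightarrow>
    bij_betw \<phi> (sph_faces d P) (sph_faces d Q) \<and>
    (\<forall>S\<in>sph_faces d P. \<forall>T\<in>sph_faces d P. S \<subseteq> T \<longleftrightarrow> \<phi> S \<subseteq> \<phi> T)"

definition combinatorially_equivalent :: "nat \<Rightarrow> rvec set \<Rightarrow> rvec set \<Rightarrow> bool"
  where "combinatorially_equivalent d P Q \<longleftrightarrow> (\<exists>\<phi>. face_lattice_iso d P Q \<phi>)"

text \<open>
  A projective transformation is the class, up to nonzero scalars, of a linear automorphism \<open>A\<close> of
  \<open>\<real>\<^bsup>d+1\<^esup>\<close>; \<open>proj_maps A x y\<close> says that it takes the projective point of \<open>x\<close> to that of \<open>y\<close>.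
\<close>

definition linear_automorphism :: "nat \<Rightarrow> (rvec \<Rightarrow> rvec) \<Rightarrow> bool"
  where "linear_automorphism m A \<longleftrightarrow> linear A \<and> bij_betw A (coord_space m) (coord_space m)"

definition proj_maps :: "(rvec \<Rightarrow> rvec) \<Rightarrow> rvec \<Rightarrow> rvec \<Rightarrow> bool"
  where "proj_maps A x y \<longleftrightarrow> (\<exists>c. c \<noteq> 0 \<and> A x = c *\<^sub>R y)"

definition proj_maps_onto :: "(rvec \<Rightarrow> rvec) \<Rightarrow> rvec set \<Rightarrow> rvec set \<Rightarrow> bool"
  where "proj_maps_onto A P Q \<longleftrightarrow>
    (\<forall>x\<in>P. \<exists>y\<in>Q. proj_maps A x y) \<and> (\<forall>y\<in>Q. \<exists>x\<in>P. proj_maps A x y)"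

definition projectively_unique :: "nat \<Rightarrow> rvec set \<Rightarrow> bool"
  where "projectively_unique d P \<longleftrightarrow>
    (\<forall>Q \<phi>. sph_polytope d Q \<and> face_lattice_iso d P Q \<phi> \<longrightarrow>
      (\<exists>A. linear_automorphism (Suc d) A \<and> proj_maps_onto A P Q \<and>
           (\<forall>v\<in>sph_vertices d P. \<exists>w. \<phi> {v} = {w} \<and> proj_maps A v w)))"

definition vertex_coords_in :: "nat \<Rightarrow> rvec set \<Rightarrow> real set \<Rightarrow> bool"
  where "vertex_coords_in d P G \<longleftrightarrow>
    (\<forall>v\<in>sph_vertices d P. \<forall>i\<le>d. Poly_Mapping.lookup (homog d v) i \<in> G)"

definition realizable_over :: "nat \<Rightarrow> rvec set \<Rightarrow> real set \<Rightarrow> bool"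
  where "realizable_over d P G \<longleftrightarrow>
    (\<exists>Q. sph_polytope d Q \<and> combinatorially_equivalent d P Q \<and> vertex_coords_in d Q G)"

definition real_ring :: "real ring"
  where "real_ring =
    \<lparr>carrier = UNIV, monoid.mult = (*), one = 1, ring.zero = 0, add = (+)\<rparr>"

lemma field_real_ring: "field real_ring"
proof -
  have "cring real_ring"
  proof (rule cringI)
    show "abelian_group real_ring"
    proof (rule abelian_groupI)
      fix x :: real
      assume "x \<in> carrier real_ring"
      show "\<exists>y\<in>carrier real_ring. y \<oplus>\<^bsub>real_ring\<^esub> x = \<zero>\<^bsub>real_ring\<^esub>"
        by (rule bexI[of _ "- x"]) (simp_all add: real_ring_def)
    qed (simp_all add: real_ring_def)
    show "Group.comm_monoid real_ring"
      by (rule comm_monoidI) (simp_all add: real_ring_def)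
  qed (simp add: real_ring_def distrib_right)
  then show ?thesis
  proof (rule cring.cring_fieldI2)
    fix a :: real
    assume "a \<in> carrier real_ring" "a \<noteq> \<zero>\<^bsub>real_ring\<^esub>"
    then show "\<exists>b\<in>carrier real_ring. a \<otimes>\<^bsub>real_ring\<^esub> b = \<one>\<^bsub>real_ring\<^esub>"
      by (intro bexI[of _ "inverse a"]) (simp_all add: real_ring_def)
  qed (simp add: real_ring_def)
qed

end

theory Submission
  imports Defs "HOL-Algebra.Finite_Extensions"
begin

text \<open>
  Let \<open>A\<close> be a polytope and \<open>R\<close> finitely many points outside \<open>A\<close>. The polytope with vertices
  \<open>(a, 0)\<close> for the vertices \<open>a\<close> of \<open>A\<close> and \<open>(\<plusminus>r, e\<^sub>r)\<close> for \<open>r \<in> R\<close> has dimension \<open>dim A + card R\<close>, and its face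
  lattice records the signs on \<open>R\<close> of every linear form that is nonnegative on \<open>A\<close>. It is therefore
  enough to find configurations with \<open>card R\<close> bounded, \<open>A\<close> with arbitrarily many vertices, and all points
  determined by these signs up to a projective transformation.

  Take for \<open>A\<close> the join of two copies of the polygon of quadratic polynomials that are nonnegative at
  \<open>0, \<dots>, K - 1\<close> and convex; its edges are the evaluations \<open>ev\<^sub>k\<close> at \<open>k\<close>. In a join any pair of forms
  that are nonnegative on the two factors is nonnegative on \<open>A\<close>. Three points of \<open>R\<close> express that a pair of
  forms is related by the identity, three others that it is related by the shift \<open>t \<mapsto> t + 1\<close>. They lie
  on all the forms \<open>(ev\<^sub>k, ev\<^sub>k)\<close>, respectively \<open>(ev\<^bsub>k+1\<^esub>, ev\<^sub>k)\<close>, so every edge determines the next one, however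
  large \<open>K\<close> is. The remaining points of \<open>R\<close> are a piece of the projective plane over a finite set
  \<open>T \<subseteq> F\<close>. The signs on it turn a realization into an order preserving partial ring homomorphism
  \<open>T \<rightarrow> \<real>\<close>, and \<open>T\<close> is chosen such that only the identity is one. Pyramids adjust the dimension.
\<close>

section \<open>The base configuration\<close>

text \<open>Every doubled point costs one dimension and \<open>D\<close> has to serve all
  \<open>n\<close>, so the points outside the polygons must not multiply with the vertices.
  Quadratic polynomials are chosen because \<open>t \<mapsto> t + 1\<close> acts on them linearly
  and carries each evaluation to the next, so that one fixed matrix relates all consecutive edges.
  Its entry 2 has to be pinned in the plane, whence \<open>2 \<in> T\<close>. There are two polygons
  because the shift compares two different edge forms and only forms nonnegative on \<open>A\<close>
  are visible. The set \<open>T\<close> can be finite since a real algebraic number is singled out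
  by a rational polynomial and two rational bounds, which addition, multiplication and order
  express. For the field of definition, a relation \<open>u = v + \<theta> w\<close> between points
  with coordinates in \<open>G\<close> yields only \<theta> times a quotient of unknown scale
  factors. The relation with \<theta> = 1 has the same quotient, so division shows \<theta> \<in>
  \<open>G\<close>. Hence \<open>G\<close> contains \<open>T\<close>, and \<open>T\<close> contains
  generators of \<open>F\<close>.\<close>

definition dotp :: "nat \<Rightarrow> (nat \<Rightarrow> real) \<Rightarrow> (nat \<Rightarrow> real) \<Rightarrow> real"
  where "dotp m f v = (\<Sum>j<m. f j * v j)"

text \<open>On \<open>A\<close> the form must be nonnegative because it has to cut out a face. On
  \<open>R\<close> every sign is allowed: doubling a point turns the sign of the form there into a
  pattern of zeros.\<close>

definition sign_realization ::
  "nat \<Rightarrow> ('l \<Rightarrow> nat \<Rightarrow> real) \<Rightarrow> 'l set \<Rightarrow> 'l set \<Rightarrow> ('l \<Rightarrow> nat \<Rightarrow> real) \<Rightarrow> bool"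
  where "sign_realization m p A R Z \<longleftrightarrow>
    (\<forall>f. (\<forall>l\<in>A. 0 \<le> dotp m f (p l)) \<longrightarrow>
      (\<exists>g. \<forall>l\<in>A \<union> R. sgn (dotp m g (Z l)) = sgn (dotp m f (p l))))"

text \<open>The condition on the signs of the coordinates reflects how \<open>Z\<close> arises: the
  coordinate forms are nonnegative on \<open>A\<close>, so their images in a realization serve as
  its coordinates. Each image is known only up to a positive factor, which accounts for
  \<open>D\<close>; the factors \<open>c\<close> account for the homogeneous
  representatives.\<close>

definition diag_rigid :: "nat \<Rightarrow> ('l \<Rightarrow> nat \<Rightarrow> real) \<Rightarrow> 'l set \<Rightarrow> 'l set \<Rightarrow> bool"
  where "diag_rigid m p A R \<longleftrightarrow>
    (\<forall>Z. sign_realization m p A R Z \<and> (\<forall>l\<in>A \<union> R. \<forall>j<m. sgn (Z l j) = sgn (p l j)) \<longrightarrow>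
      (\<exists>D c. (\<forall>j<m. 0 < D j) \<and> (\<forall>l\<in>A \<union> R. 0 < c l \<and> (\<forall>j<m. Z l j = c l * D j * p l j))))"

text \<open>A finite piece of the plane sees only the sums and products that stay inside
  \<open>T\<close>, hence the membership conditions.\<close>

definition partial_hom :: "real set \<Rightarrow> (real \<Rightarrow> real) \<Rightarrow> bool"
  where "partial_hom T \<sigma> \<longleftrightarrow> \<sigma> 0 = 0 \<and> \<sigma> 1 = 1 \<and>
      (\<forall>a\<in>T. \<forall>b\<in>T. a + b \<in> T \<longrightarrow> \<sigma> (a + b) = \<sigma> a + \<sigma> b) \<and>
      (\<forall>a\<in>T. \<forall>b\<in>T. a * b \<in> T \<longrightarrow> \<sigma> (a * b) = \<sigma> a * \<sigma> b) \<and>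
      (\<forall>a\<in>T. \<forall>b\<in>T. a < b \<longrightarrow> \<sigma> a < \<sigma> b)"

definition hom_rigid :: "real set \<Rightarrow> bool"
  where "hom_rigid T \<longleftrightarrow> 0 \<in> T \<and> 1 \<in> T \<and> (\<forall>\<sigma>. partial_hom T \<sigma> \<longrightarrow> (\<forall>a\<in>T. \<sigma> a = a))"

lemma hom_rigid_01: "hom_rigid {0, 1}"
  by (auto simp: hom_rigid_def partial_hom_def)

text \<open>
  The vectors live in \<open>\<real>\<^sup>9 = W \<oplus> U \<oplus> U'\<close>. Elements of \<open>U\<close> and \<open>U'\<close> are quadratic polynomials \<open>p\<close> in the
  coordinates \<open>p(1)\<close>, \<open>p(0)\<close>, \<open>p''\<close>, so \<open>evl k\<close> is evaluation at \<open>k\<close>, and \<open>pvert\<close> lists the polynomials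
  \<open>(t - k)(t - k - 1)/2\<close>, \<open>K - 1 - t\<close> and \<open>t\<close>. The labels \<open>LA\<close>, \<open>LB\<close> belong to the vertices of the two
  polygons; \<open>LW\<close>, \<open>LE\<close> to the points of the projective plane in \<open>W\<close>. A form vanishes on all \<open>LR\<close> iff its
  restrictions to \<open>U\<close> and \<open>W\<close> agree, likewise for \<open>LQ\<close> with \<open>U'\<close> and \<open>W\<close>, and on all \<open>LS\<close> iff its
  restriction to \<open>U'\<close> is the composition of that to \<open>W\<close> with \<open>p(t) \<mapsto> p(t - 1)\<close>.
\<close>

datatype lab = LA nat | LB nat | LW real real | LE nat | LR nat | LQ nat | LS nat

definition pvert :: "nat \<Rightarrow> nat \<Rightarrow> real list"
  where "pvert K k =
    (if k + 2 \<le> K then [real k * (real k - 1) / 2, real k * (real k + 1) / 2, 1]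
     else if k + 1 = K then [real K - 2, real K - 1, 0] else [1, 0, 0])"

definition evl :: "nat \<Rightarrow> real list"
  where "evl k = [real k, 1 - real k, real k * (real k - 1) / 2]"

fun bvec :: "nat \<Rightarrow> lab \<Rightarrow> real list" where
  "bvec K (LA k) = [0,0,0] @ pvert K k @ [0,0,0]"
| "bvec K (LB k) = [0,0,0,0,0,0] @ pvert K k"
| "bvec K (LW a b) = [1,a,b,0,0,0,0,0,0]"
| "bvec K (LE i) = (if i = 0 then [0,1,0,0,0,0,0,0,0] else
                    if i = 1 then [0,0,1,0,0,0,0,0,0] else [0,1,1,0,0,0,0,0,0])"
| "bvec K (LR j) = (if j = 0 then [-1,0,0,1,0,0,0,0,0] else
                    if j = 1 then [0,-1,0,0,1,0,0,0,0] else [0,0,-1,0,0,1,0,0,0])"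
| "bvec K (LQ j) = (if j = 0 then [-1,0,0,0,0,0,1,0,0] else
                    if j = 1 then [0,-1,0,0,0,0,0,1,0] else [0,0,-1,0,0,0,0,0,1])"
| "bvec K (LS j) = (if j = 0 then [0,1,0,0,0,0,1,0,0] else
                    if j = 1 then [-1,-2,0,0,0,0,0,1,0] else [0,-1,-1,0,0,0,0,0,1])"

definition polyL :: "nat \<Rightarrow> lab set"
  where "polyL K = LA ` {..K} \<union> LB ` {..K}"

definition doubL :: "real set \<Rightarrow> lab set"
  where "doubL T = (\<lambda>(a, b). LW a b) ` (T \<times> T) \<union> LE ` {..<3} \<union> LR ` {..<3} \<union> LQ ` {..<3} \<union> LS ` {..<3}"

lemma doubL_cases:
  assumes "l \<in> doubL T"
  obtains a b where "a \<in> T" "b \<in> T" "l = LW a b" | i where "i = 0 \<or> i = 1 \<or> i = 2" "l = LE i"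
    | i where "i = 0 \<or> i = 1 \<or> i = 2" "l = LR i" | i where "i = 0 \<or> i = 1 \<or> i = 2" "l = LQ i"
    | i where "i = 0 \<or> i = 1 \<or> i = 2" "l = LS i"
proof -
  have j3: "j = 0 \<or> j = 1 \<or> j = 2" if "j < 3" for j :: nat using that by linarith
  show thesis
  proof (cases l)
    case (LA k)
    then show thesis using assms by (auto simp: doubL_def)
  next
    case (LB k)
    then show thesis using assms by (auto simp: doubL_def)
  next
    case (LW a b)
    then have "a \<in> T" "b \<in> T" using assms by (auto simp: doubL_def)
    then show thesis using that(1)[OF _ _ LW] by blast
  next
    case (LE i)
    then have "i < 3" using assms by (auto simp: doubL_def)
    then show thesis using that(2)[OF j3 LE] by blast
  next
    case (LR i)
    then have "i < 3" using assms by (auto simp: doubL_def)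
    then show thesis using that(3)[OF j3 LR] by blast
  next
    case (LQ i)
    then have "i < 3" using assms by (auto simp: doubL_def)
    then show thesis using that(4)[OF j3 LQ] by blast
  next
    case (LS i)
    then have "i < 3" using assms by (auto simp: doubL_def)
    then show thesis using that(5)[OF j3 LS] by blast
  qed
qed

lemma dotp9: "dotp 9 f v = f 0 * v 0 + f 1 * v 1 + f 2 * v 2 + f 3 * v 3 + f 4 * v 4
    + f 5 * v 5 + f 6 * v 6 + f 7 * v 7 + f 8 * v 8"
  by (simp add: dotp_def eval_nat_numeral)

lemma forall_less_9: "(\<forall>j<9. Q j) \<longleftrightarrow> Q 0 \<and> Q 1 \<and> Q 2 \<and> Q 3 \<and> Q 4 \<and> Q 5 \<and> Q 6 \<and> Q 7 \<and> Q (8::nat)"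
  by (simp add: numeral_eq_Suc All_less_Suc conj_ac)

lemma nth9:
  "[a,b,c,d,e,f,g,h,i] ! 0 = a" "[a,b,c,d,e,f,g,h,i] ! 1 = b" "[a,b,c,d,e,f,g,h,i] ! 2 = c"
  "[a,b,c,d,e,f,g,h,i] ! 3 = d" "[a,b,c,d,e,f,g,h,i] ! 4 = e" "[a,b,c,d,e,f,g,h,i] ! 5 = f"
  "[a,b,c,d,e,f,g,h,i] ! 6 = g" "[a,b,c,d,e,f,g,h,i] ! 7 = h" "[a,b,c,d,e,f,g,h,i] ! 8 = i"
  by (simp_all add: eval_nat_numeral)

lemma pvert_eq3: "pvert K k = [pvert K k ! 0, pvert K k ! 1, pvert K k ! 2]"
  by (simp add: pvert_def eval_nat_numeral)

lemma nth_LA: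
  "bvec K (LA k) = [0,0,0,pvert K k ! 0, pvert K k ! 1, pvert K k ! 2,0,0,0]"
  "bvec K (LB k) = [0,0,0,0,0,0,pvert K k ! 0, pvert K k ! 1, pvert K k ! 2]"
  by (subst bvec.simps, subst pvert_eq3, simp)+

section \<open>Evaluations at integers as edges of the polygon\<close>

lemma pvert_nonneg: "0 \<le> pvert K k ! 0" "0 \<le> pvert K k ! 1" "0 \<le> pvert K k ! 2" if "2 \<le> K"
proof -
  have "0 \<le> real k * (real k - 1)" by (cases k) auto
  then show "0 \<le> pvert K k ! 0" using that by (auto simp: pvert_def)
qed (use that in \<open>auto simp: pvert_def eval_nat_numeral\<close>)

definition evp :: "nat \<Rightarrow> nat \<Rightarrow> nat \<Rightarrow> real"
  where "evp K i k = evl i ! 0 * pvert K k ! 0 + evl i ! 1 * pvert K k ! 1 + evl i ! 2 * pvert K k ! 2"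

lemma evp_eq:
  "evp K i k = (if k + 2 \<le> K then (real k - real i) * (real k - real i + 1) / 2
     else if k + 1 = K then real K - 1 - real i else real i)"
  by (simp add: evp_def evl_def pvert_def eval_nat_numeral diff_divide_distrib[symmetric]
      add_divide_distrib[symmetric]) (simp add: algebra_simps)

text \<open>Evaluation at \<open>i\<close> is the edge that joins the vertices \<open>i\<close> and
  \<open>lo K i\<close>. The value \<open>K\<close> at \<open>i = 0\<close> wraps around; the one
  remaining edge, between \<open>K - 1\<close> and \<open>K\<close>, is the form
  \<open>p''\<close>.\<close>

definition lo :: "nat \<Rightarrow> nat \<Rightarrow> nat" where "lo K i = (if i = 0 then K else i - 1)"

text \<open>The polynomial with roots \<open>k\<close> and \<open>k + 1\<close> is negative only
  between them, and a product of two consecutive integers is never negative.\<close>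

lemma evp_nonneg: assumes "i < K" "k \<le> K" shows "0 \<le> evp K i k"
proof -
  have "0 \<le> (real k - real i) * (real k - real i + 1)"
  proof (cases "k \<ge> i")
    case False
    then have "real k - real i + 1 \<le> 0" by linarith
    then show ?thesis by (intro mult_nonpos_nonpos) auto
  qed (simp)
  then show ?thesis using assms by (auto simp: evp_eq)
qed

lemma evp_zero: assumes "i < K" "k \<le> K" "2 \<le> K" shows "evp K i k = 0 \<longleftrightarrow> k = i \<or> k = lo K i"
proof -
  have "(real k - real i) * (real k - real i + 1) = 0 \<longleftrightarrow> k = i \<or> k + 1 = i"
    by (auto simp: mult_eq_0_iff)
  moreover have "real K - 1 - real i = 0 \<longleftrightarrow> i + 1 = K" by linarith
  ultimately show ?thesis
    using assms unfolding evp_eq lo_def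
    by (cases "k + 2 \<le> K"; cases "k + 1 = K"; cases "i = 0") (auto simp del: mult_eq_0_iff)
qed

text \<open>All forms vanishing at two independent vectors of three-space are multiples of their
  cross product \<open>n\<close>. Independence of \<open>x\<close> and \<open>x'\<close> is
  witnessed by \<open>u\<close>, which vanishes only at the second; \<open>v\<close> fixes the sign
  of the multiple.\<close>

lemma form_unique3:
  fixes x0 x1 x2 x0' x1' x2' :: real
  assumes y: "y0 * x0 + y1 * x1 + y2 * x2 = 0" "y0 * x0' + y1 * x1' + y2 * x2' = 0"
    and z: "z0 * x0 + z1 * x1 + z2 * x2 = 0" "z0 * x0' + z1 * x1' + z2 * x2' = 0"
    and u: "u0 * x0' + u1 * x1' + u2 * x2' = 0" "u0 * x0 + u1 * x1 + u2 * x2 > 0"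
    and x': "x0' \<noteq> 0 \<or> x1' \<noteq> 0 \<or> x2' \<noteq> 0"
    and v: "y0 * v0 + y1 * v1 + y2 * v2 > 0" "z0 * v0 + z1 * v1 + z2 * v2 > 0"
  shows "\<exists>c>0. z0 = c * y0 \<and> z1 = c * y1 \<and> z2 = c * y2"
proof -
  define n0 n1 n2 where n: "n0 = x1 * x2' - x2 * x1'" "n1 = x2 * x0' - x0 * x2'" "n2 = x0 * x1' - x1 * x0'"
  have par: "n0 * w1 = n1 * w0 \<and> n1 * w2 = n2 * w1 \<and> n0 * w2 = n2 * w0"
    if "w0 * x0 + w1 * x1 + w2 * x2 = 0" "w0 * x0' + w1 * x1' + w2 * x2' = 0" for w0 w1 w2
  proof -
    have "n0 * w1 - n1 * w0 = x2' * (w0 * x0 + w1 * x1 + w2 * x2) - x2 * (w0 * x0' + w1 * x1' + w2 * x2')"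
      "n1 * w2 - n2 * w1 = x0' * (w0 * x0 + w1 * x1 + w2 * x2) - x0 * (w0 * x0' + w1 * x1' + w2 * x2')"
      "n2 * w0 - n0 * w2 = x1' * (w0 * x0 + w1 * x1 + w2 * x2) - x1 * (w0 * x0' + w1 * x1' + w2 * x2')"
      by (simp_all add: n algebra_simps)
    then show ?thesis using that by simp
  qed
  have n_nz: "n0 \<noteq> 0 \<or> n1 \<noteq> 0 \<or> n2 \<noteq> 0"
  proof (rule ccontr)
    assume "\<not> ?thesis"
    then have nz: "x1 * x2' = x2 * x1'" "x2 * x0' = x0 * x2'" "x0 * x1' = x1 * x0'" by (auto simp: n)
    define U where "U = u0 * x0 + u1 * x1 + u2 * x2"
    have "x0' * U = u0 * (x0 * x0') + u1 * (x1 * x0') + u2 * (x2 * x0')"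
      "x1' * U = u0 * (x0 * x1') + u1 * (x1 * x1') + u2 * (x2 * x1')"
      "x2' * U = u0 * (x0 * x2') + u1 * (x1 * x2') + u2 * (x2 * x2')"
      by (simp_all add: U_def algebra_simps)
    moreover have "u0 * (x0 * x0') + u1 * (x0 * x1') + u2 * (x0 * x2') = x0 * (u0 * x0' + u1 * x1' + u2 * x2')"
      "u0 * (x1 * x0') + u1 * (x1 * x1') + u2 * (x1 * x2') = x1 * (u0 * x0' + u1 * x1' + u2 * x2')"
      "u0 * (x2 * x0') + u1 * (x2 * x1') + u2 * (x2 * x2') = x2 * (u0 * x0' + u1 * x1' + u2 * x2')"
      by (simp_all add: algebra_simps)
    ultimately have "x0' * U = 0" "x1' * U = 0" "x2' * U = 0" using nz u(1) by (metis mult_zero_right)+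
    then show False using x' u(2) by (auto simp: U_def)
  qed
  have colin: "\<exists>c. w0 = c * n0 \<and> w1 = c * n1 \<and> w2 = c * n2"
    if w: "w0 * x0 + w1 * x1 + w2 * x2 = 0" "w0 * x0' + w1 * x1' + w2 * x2' = 0" for w0 w1 w2
  proof -
    consider "n0 \<noteq> 0" | "n1 \<noteq> 0" | "n2 \<noteq> 0" using n_nz by blast
    then show ?thesis
    proof cases
      case 1 then show ?thesis using par[OF w] by (intro exI[of _ "w0 / n0"]) (auto simp: field_simps)
    next
      case 2 then show ?thesis using par[OF w] by (intro exI[of _ "w1 / n1"]) (auto simp: field_simps)
    next
      case 3 then show ?thesis using par[OF w] by (intro exI[of _ "w2 / n2"]) (auto simp: field_simps)
    qed
  qed
  obtain a where a: "y0 = a * n0" "y1 = a * n1" "y2 = a * n2" using colin[OF y] by blast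
  obtain b where b: "z0 = b * n0" "z1 = b * n1" "z2 = b * n2" using colin[OF z] by blast
  define N where "N = n0 * v0 + n1 * v1 + n2 * v2"
  have "a * N > 0" "b * N > 0" using v unfolding a b N_def by (simp_all add: algebra_simps)
  then have "b / a > 0" "a \<noteq> 0" by (auto simp: zero_less_mult_iff zero_less_divide_iff)
  then show ?thesis by (intro exI[of _ "b / a"]) (auto simp: a b)
qed

section \<open>Rigidity of the base configuration\<close>

lemma sgn_eqD:
  fixes x y :: real
  assumes "sgn x = sgn y"
  shows "x = 0 \<longleftrightarrow> y = 0" "0 < x \<longleftrightarrow> 0 < y" "x < 0 \<longleftrightarrow> y < 0"
  using assms by (auto simp: sgn_if split: if_splits)

text \<open>Von Staudt's constructions in an affine chart. Lines are forms, and a transferred form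
  keeps all its incidences. The three points at infinity stand for the two axis directions and for
  slope one, whose realized direction is \<open>(E1, E2)\<close>; the points \<open>LW 0 0\<close>
  and \<open>LW 1 1\<close> calibrate the scales.\<close>

lemma plane_rigid:
  fixes A B :: "real \<Rightarrow> real \<Rightarrow> real"
  assumes T: "hom_rigid T"
    and real: "\<And>f0 f1 f2. \<exists>g0 g1 g2. (\<forall>a\<in>T. \<forall>b\<in>T. sgn (g0 + g1 * A a b + g2 * B a b) = sgn (f0 + f1 * a + f2 * b))
      \<and> sgn g1 = sgn f1 \<and> sgn g2 = sgn f2 \<and> sgn (g1 * E1 + g2 * E2) = sgn (f1 + f2)"
    and sA: "\<And>a b. a \<in> T \<Longrightarrow> b \<in> T \<Longrightarrow> sgn (A a b) = sgn a"
    and sB: "\<And>a b. a \<in> T \<Longrightarrow> b \<in> T \<Longrightarrow> sgn (B a b) = sgn b"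
    and one: "A 1 1 = 1" "B 1 1 = 1"
    and E: "0 < E1" "0 < E2"
  shows "(\<forall>a\<in>T. \<forall>b\<in>T. A a b = a \<and> B a b = b) \<and> E1 = E2"
proof -
  have T01: "0 \<in> T" "1 \<in> T" using T by (auto simp: hom_rigid_def)
  have A0: "A 0 b = 0" if "b \<in> T" for b using sA[of 0 b] that T01 by (simp add: sgn_0_0)
  have B0: "B a 0 = 0" if "a \<in> T" for a using sB[of a 0] that T01 by (simp add: sgn_0_0)
  have A_eq: "A a b = A a 0" if "a \<in> T" "b \<in> T" for a b
  proof -
    \<comment> \<open>The vertical line through \<open>(a, 0)\<close> and \<open>(a, b)\<close>: the
      first coordinate does not depend on \<open>b\<close>.\<close>
    obtain g0 g1 g2 where g: "\<forall>a'\<in>T. \<forall>b'\<in>T. sgn (g0 + g1 * A a' b' + g2 * B a' b') = sgn (a + - 1 * a' + 0 * b')"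
      "sgn g1 = sgn (- 1)" "sgn g2 = sgn 0" using real[of a "- 1" 0] by blast
    have "g2 = 0" "g1 < 0" using g(2,3) sgn_eqD[OF g(2)] by (auto simp: sgn_0_0)
    moreover have "g0 + g1 * A a b' + g2 * B a b' = 0" if "b' \<in> T" for b'
      using g(1) that \<open>a \<in> T\<close> sgn_eqD(1)[of "g0 + g1 * A a b' + g2 * B a b'" "a + - 1 * a + 0 * b'"] by auto
    from this[OF \<open>b \<in> T\<close>] this[OF T01(1)] have "g1 * A a b = g1 * A a 0" using \<open>g2 = 0\<close> by (simp only: mult_zero_left)
    ultimately show ?thesis by simp
  qed
  have B_eq: "B a b = B 0 b" if "a \<in> T" "b \<in> T" for a b
  proof -
    obtain g0 g1 g2 where g: "\<forall>a'\<in>T. \<forall>b'\<in>T. sgn (g0 + g1 * A a' b' + g2 * B a' b') = sgn (b + 0 * a' + - 1 * b')"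
      "sgn g1 = sgn 0" "sgn g2 = sgn (- 1)" using real[of b 0 "- 1"] by blast
    have "g1 = 0" "g2 < 0" using g(2,3) sgn_eqD[OF g(3)] by (auto simp: sgn_0_0)
    moreover have "g0 + g1 * A a' b + g2 * B a' b = 0" if "a' \<in> T" for a'
      using g(1) that \<open>b \<in> T\<close> sgn_eqD(1)[of "g0 + g1 * A a' b + g2 * B a' b" "b + 0 * a' + - 1 * b"] by auto
    from this[OF \<open>a \<in> T\<close>] this[OF T01(1)] have "g2 * B a b = g2 * B 0 b" using \<open>g1 = 0\<close> by (simp only: mult_zero_left)
    ultimately show ?thesis by simp
  qed
  define s where "s a = A a 0" for a
  have s01: "s 0 = 0" "s 1 = 1" using A0 T01 A_eq[of 1 1] one by (auto simp: s_def)
  have "(\<forall>a\<in>T. s a = B 0 a) \<and> E1 = E2"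
  proof -
    \<comment> \<open>The diagonal through the origin and \<open>(1, 1)\<close> identifies the
      scales of the two axes and forces the direction of slope one to be the true one.\<close>
    obtain g0 g1 g2 where g: "\<forall>a'\<in>T. \<forall>b'\<in>T. sgn (g0 + g1 * A a' b' + g2 * B a' b') = sgn (0 + 1 * a' + - 1 * b')"
      "sgn g1 = sgn 1" "sgn (g1 * E1 + g2 * E2) = sgn (1 + - 1)" using real[of 0 1 "- 1"] by blast
    have "g1 > 0" using sgn_eqD[OF g(2)] by simp
    have *: "g0 + g1 * A a a + g2 * B a a = 0" if "a \<in> T" for a
      using g(1) that sgn_eqD(1)[of "g0 + g1 * A a a + g2 * B a a" "0 + 1 * a + - 1 * a"] by auto
    have "g0 = 0" using *[OF T01(1)] A0 B0 T01 by simp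
    moreover have "g2 = - g1" using *[OF T01(2)] one \<open>g0 = 0\<close> by simp
    ultimately have "g1 * A a a = g1 * B a a" if "a \<in> T" for a using *[OF that] by simp
    then have "s a = B 0 a" if "a \<in> T" for a using that \<open>g1 > 0\<close> A_eq[of a a] B_eq[of a a] by (simp add: s_def)
    moreover have "g1 * E1 + g2 * E2 = 0" using sgn_eqD(1)[OF g(3)] by simp
    then have "g1 * E1 = g1 * E2" using \<open>g2 = - g1\<close> by simp
    ultimately show ?thesis using \<open>g1 > 0\<close> by simp
  qed
  then have sB': "\<And>a. a \<in> T \<Longrightarrow> B 0 a = s a" and E12: "E1 = E2" by auto
  have Av: "A a b = s a" and Bv: "B a b = s b" if "a \<in> T" "b \<in> T" for a b
    using A_eq[OF that] B_eq[OF that] sB'[OF that(2)] by (auto simp: s_def)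
  have add: "s (a + b) = s a + s b" if "a \<in> T" "b \<in> T" "a + b \<in> T" for a b
  proof -
    \<comment> \<open>The line of slope one through \<open>(a, 0)\<close> also contains
      \<open>(a + b, b)\<close>; its slope survives because \<open>E1 = E2\<close>.\<close>
    obtain g0 g1 g2 where g: "\<forall>a'\<in>T. \<forall>b'\<in>T. sgn (g0 + g1 * A a' b' + g2 * B a' b') = sgn (a + - 1 * a' + 1 * b')"
      "sgn g1 = sgn (- 1)" "sgn (g1 * E1 + g2 * E2) = sgn (- 1 + 1)" using real[of a "- 1" 1] by blast
    have "g1 < 0" using sgn_eqD[OF g(2)] by simp
    have "g1 * E1 + g2 * E2 = 0" using sgn_eqD(1)[OF g(3)] by simp
    then have "E2 * (g1 + g2) = 0" using E12 by (simp add: algebra_simps)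
    then have "g2 = - g1" using E(2) by simp
    have 1: "g0 + g1 * s a + g2 * s 0 = 0"
      using g(1) that T01 sgn_eqD(1)[of "g0 + g1 * A a 0 + g2 * B a 0" "a + - 1 * a + 1 * 0"] by (auto simp: Av Bv)
    have 2: "g0 + g1 * s (a + b) + g2 * s b = 0"
      using g(1) that T01 sgn_eqD(1)[of "g0 + g1 * A (a + b) b + g2 * B (a + b) b" "a + - 1 * (a + b) + 1 * b"] by (auto simp: Av Bv)
    have "g1 * s (a + b) = g1 * (s a + s b)" using 1 2 \<open>g2 = - g1\<close> s01 by (simp add: algebra_simps)
    then show ?thesis using \<open>g1 < 0\<close> by simp
  qed
  have mul: "s (a * b) = s a * s b" if "a \<in> T" "b \<in> T" "a * b \<in> T" for a b
  proof -
    \<comment> \<open>The line through the origin and \<open>(a, 1)\<close> also contains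
      \<open>(a * b, b)\<close>.\<close>
    obtain g0 g1 g2 where g: "\<forall>a'\<in>T. \<forall>b'\<in>T. sgn (g0 + g1 * A a' b' + g2 * B a' b') = sgn (0 + 1 * a' + (- a) * b')"
      "sgn g1 = sgn 1" using real[of 0 1 "- a"] by blast
    have "g1 > 0" using sgn_eqD[OF g(2)] by simp
    have 0: "g0 = 0"
      using sgn_eqD(1)[OF g(1)[rule_format, OF T01(1) T01(1)]] T01 by (simp add: Av Bv s01)
    have 1: "g0 + g1 * s a + g2 * s 1 = 0"
      using g(1) that T01 sgn_eqD(1)[of "g0 + g1 * A a 1 + g2 * B a 1" "0 + 1 * a + (- a) * 1"] by (auto simp: Av Bv)
    have 2: "g0 + g1 * s (a * b) + g2 * s b = 0"
      using g(1) that T01 sgn_eqD(1)[of "g0 + g1 * A (a * b) b + g2 * B (a * b) b" "0 + 1 * (a * b) + (- a) * b"] by (auto simp: Av Bv)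
    have "g2 = - g1 * s a" using 1 0 s01 by simp
    then have "g1 * s (a * b) = g1 * (s a * s b)" using 0 2 by (simp add: algebra_simps)
    then show ?thesis using \<open>g1 > 0\<close> by simp
  qed
  have ord: "s a < s b" if "a \<in> T" "b \<in> T" "a < b" for a b
  proof -
    obtain g0 g1 g2 where g: "\<forall>a'\<in>T. \<forall>b'\<in>T. sgn (g0 + g1 * A a' b' + g2 * B a' b') = sgn (b + - 1 * a' + 0 * b')"
      "sgn g1 = sgn (- 1)" using real[of b "- 1" 0] by blast
    have "g1 < 0" using sgn_eqD[OF g(2)] by simp
    have 1: "g0 + g1 * s b = 0"
      using sgn_eqD(1)[OF g(1)[rule_format, OF that(2) T01(1)]] that T01 by (simp add: Av Bv s01)
    have 2: "0 < g0 + g1 * s a"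
      using sgn_eqD(2)[OF g(1)[rule_format, OF that(1) T01(1)]] that T01 by (simp add: Av Bv s01)
    have "g1 * s b < g1 * s a" using 1 2 by simp
    then show ?thesis using \<open>g1 < 0\<close> by simp
  qed
  have "\<forall>a\<in>T. s a = a" using T s01 add mul ord unfolding hom_rigid_def partial_hom_def by blast
  then show ?thesis using Av Bv E12 by auto
qed

text \<open>Rescaling the nine coordinates by positive factors leaves nine degrees of freedom, and
  the nine equations use them up: three fix the unit point of \<open>W\<close>, three align
  \<open>U\<close> with \<open>W\<close> and three align \<open>U'\<close> with
  \<open>W\<close>.\<close>

locale normalized_realization =
  fixes K :: nat and T :: "real set" and Z :: "lab \<Rightarrow> nat \<Rightarrow> real"
  assumes K: "3 \<le> K" and T: "hom_rigid T" and T2: "2 \<in> T"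
    and real: "sign_realization 9 (\<lambda>l. (!) (bvec K l)) (polyL K) (doubL T) Z"
    and sg: "\<And>l j. l \<in> polyL K \<union> doubL T \<Longrightarrow> j < 9 \<Longrightarrow> sgn (Z l j) = sgn (bvec K l ! j)"
    and norm_W: "Z (LW 1 1) 0 = 1" "Z (LW 1 1) 1 = 1" "Z (LW 1 1) 2 = 1"
    and norm_R: "Z (LR 0) 3 = - Z (LR 0) 0" "Z (LR 1) 4 = - Z (LR 1) 1" "Z (LR 2) 5 = - Z (LR 2) 2"
    and norm_Q: "Z (LQ 0) 6 = - Z (LQ 0) 0" "Z (LQ 1) 7 = - Z (LQ 1) 1" "Z (LQ 2) 8 = - Z (LQ 2) 2"
begin

abbreviation L :: "lab set"
  where "L \<equiv> polyL K \<union> doubL T"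

abbreviation zform :: "(nat \<Rightarrow> real) \<Rightarrow> lab \<Rightarrow> real"
  where "zform g l \<equiv> g 0 * Z l 0 + g 1 * Z l 1 + g 2 * Z l 2 + g 3 * Z l 3 + g 4 * Z l 4
    + g 5 * Z l 5 + g 6 * Z l 6 + g 7 * Z l 7 + g 8 * Z l 8"

abbreviation bform :: "real \<Rightarrow> real \<Rightarrow> real \<Rightarrow> real \<Rightarrow> real \<Rightarrow> real \<Rightarrow> real \<Rightarrow> real \<Rightarrow> real \<Rightarrow> lab \<Rightarrow> real"
  where "bform f0 f1 f2 f3 f4 f5 f6 f7 f8 l \<equiv> f0 * bvec K l ! 0 + f1 * bvec K l ! 1 + f2 * bvec K l ! 2
    + f3 * bvec K l ! 3 + f4 * bvec K l ! 4 + f5 * bvec K l ! 5 + f6 * bvec K l ! 6 + f7 * bvec K l ! 7 + f8 * bvec K l ! 8"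

lemma T01: "0 \<in> T" "1 \<in> T" using T by (auto simp: hom_rigid_def)

lemma labels:
  "a \<in> T \<Longrightarrow> b \<in> T \<Longrightarrow> LW a b \<in> L"
  "i < 3 \<Longrightarrow> LE i \<in> L" "i < 3 \<Longrightarrow> LR i \<in> L"
  "i < 3 \<Longrightarrow> LQ i \<in> L" "i < 3 \<Longrightarrow> LS i \<in> L"
  "k \<le> K \<Longrightarrow> LA k \<in> L" "k \<le> K \<Longrightarrow> LB k \<in> L"
  by (auto simp: polyL_def doubL_def)

lemma sgs: assumes "l \<in> L"
  shows "sgn (Z l 0) = sgn (bvec K l ! 0)" "sgn (Z l 1) = sgn (bvec K l ! 1)" "sgn (Z l 2) = sgn (bvec K l ! 2)"
   "sgn (Z l 3) = sgn (bvec K l ! 3)" "sgn (Z l 4) = sgn (bvec K l ! 4)" "sgn (Z l 5) = sgn (bvec K l ! 5)"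
   "sgn (Z l 6) = sgn (bvec K l ! 6)" "sgn (Z l 7) = sgn (bvec K l ! 7)" "sgn (Z l 8) = sgn (bvec K l ! 8)"
  using sg[OF assms] by simp_all

lemma zW: assumes "a \<in> T" "b \<in> T"
  shows "0 < Z (LW a b) 0" "sgn (Z (LW a b) 1) = sgn a" "sgn (Z (LW a b) 2) = sgn b"
    "Z (LW a b) 3 = 0" "Z (LW a b) 4 = 0" "Z (LW a b) 5 = 0" "Z (LW a b) 6 = 0" "Z (LW a b) 7 = 0" "Z (LW a b) 8 = 0"
  using sgs[OF labels(1)[OF assms]] by (simp_all add: nth9 sgn_0_0 sgn_1_pos)

lemma zE0: "Z (LE 0) 0 = 0" "0 < Z (LE 0) 1" "Z (LE 0) 2 = 0" "Z (LE 0) 3 = 0" "Z (LE 0) 4 = 0" "Z (LE 0) 5 = 0"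
  "Z (LE 0) 6 = 0" "Z (LE 0) 7 = 0" "Z (LE 0) 8 = 0"
  using sgs[OF labels(2)[of 0]] by (simp_all add: nth9 sgn_0_0 sgn_1_pos)

lemma zE1: "Z (LE 1) 0 = 0" "Z (LE 1) 1 = 0" "0 < Z (LE 1) 2" "Z (LE 1) 3 = 0" "Z (LE 1) 4 = 0" "Z (LE 1) 5 = 0"
  "Z (LE 1) 6 = 0" "Z (LE 1) 7 = 0" "Z (LE 1) 8 = 0"
  using sgs[OF labels(2)[of 1]] by (simp_all add: nth9 sgn_0_0 sgn_1_pos)

lemma zE2: "Z (LE 2) 0 = 0" "0 < Z (LE 2) 1" "0 < Z (LE 2) 2" "Z (LE 2) 3 = 0" "Z (LE 2) 4 = 0" "Z (LE 2) 5 = 0"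
  "Z (LE 2) 6 = 0" "Z (LE 2) 7 = 0" "Z (LE 2) 8 = 0"
  using sgs[OF labels(2)[of 2]] by (simp_all add: nth9 sgn_0_0 sgn_1_pos)

lemma zR:
  "Z (LR 0) 0 < 0" "Z (LR 0) 1 = 0" "Z (LR 0) 2 = 0" "0 < Z (LR 0) 3" "Z (LR 0) 4 = 0" "Z (LR 0) 5 = 0"
  "Z (LR 0) 6 = 0" "Z (LR 0) 7 = 0" "Z (LR 0) 8 = 0"
  "Z (LR 1) 0 = 0" "Z (LR 1) 1 < 0" "Z (LR 1) 2 = 0" "Z (LR 1) 3 = 0" "0 < Z (LR 1) 4" "Z (LR 1) 5 = 0"
  "Z (LR 1) 6 = 0" "Z (LR 1) 7 = 0" "Z (LR 1) 8 = 0"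
  "Z (LR 2) 0 = 0" "Z (LR 2) 1 = 0" "Z (LR 2) 2 < 0" "Z (LR 2) 3 = 0" "Z (LR 2) 4 = 0" "0 < Z (LR 2) 5"
  "Z (LR 2) 6 = 0" "Z (LR 2) 7 = 0" "Z (LR 2) 8 = 0"
  using sgs[OF labels(3)[of 0]] sgs[OF labels(3)[of 1]] sgs[OF labels(3)[of 2]]
  by (simp_all add: nth9 sgn_0_0 sgn_1_pos sgn_1_neg)

lemma zQ:
  "Z (LQ 0) 0 < 0" "Z (LQ 0) 1 = 0" "Z (LQ 0) 2 = 0" "Z (LQ 0) 3 = 0" "Z (LQ 0) 4 = 0" "Z (LQ 0) 5 = 0"
  "0 < Z (LQ 0) 6" "Z (LQ 0) 7 = 0" "Z (LQ 0) 8 = 0"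
  "Z (LQ 1) 0 = 0" "Z (LQ 1) 1 < 0" "Z (LQ 1) 2 = 0" "Z (LQ 1) 3 = 0" "Z (LQ 1) 4 = 0" "Z (LQ 1) 5 = 0"
  "Z (LQ 1) 6 = 0" "0 < Z (LQ 1) 7" "Z (LQ 1) 8 = 0"
  "Z (LQ 2) 0 = 0" "Z (LQ 2) 1 = 0" "Z (LQ 2) 2 < 0" "Z (LQ 2) 3 = 0" "Z (LQ 2) 4 = 0" "Z (LQ 2) 5 = 0"
  "Z (LQ 2) 6 = 0" "Z (LQ 2) 7 = 0" "0 < Z (LQ 2) 8"
  using sgs[OF labels(4)[of 0]] sgs[OF labels(4)[of 1]] sgs[OF labels(4)[of 2]]
  by (simp_all add: nth9 sgn_0_0 sgn_1_pos sgn_1_neg)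

lemma zS:
  "Z (LS 0) 0 = 0" "0 < Z (LS 0) 1" "Z (LS 0) 2 = 0" "Z (LS 0) 3 = 0" "Z (LS 0) 4 = 0" "Z (LS 0) 5 = 0"
  "0 < Z (LS 0) 6" "Z (LS 0) 7 = 0" "Z (LS 0) 8 = 0"
  "Z (LS 1) 0 < 0" "Z (LS 1) 1 < 0" "Z (LS 1) 2 = 0" "Z (LS 1) 3 = 0" "Z (LS 1) 4 = 0" "Z (LS 1) 5 = 0"
  "Z (LS 1) 6 = 0" "0 < Z (LS 1) 7" "Z (LS 1) 8 = 0"
  "Z (LS 2) 0 = 0" "Z (LS 2) 1 < 0" "Z (LS 2) 2 < 0" "Z (LS 2) 3 = 0" "Z (LS 2) 4 = 0" "Z (LS 2) 5 = 0"
  "Z (LS 2) 6 = 0" "Z (LS 2) 7 = 0" "0 < Z (LS 2) 8"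
  using sgs[OF labels(5)[of 0]] sgs[OF labels(5)[of 1]] sgs[OF labels(5)[of 2]]
  by (simp_all add: nth9 sgn_0_0 sgn_1_pos sgn_1_neg)

lemma zA: assumes "k \<le> K"
  shows "Z (LA k) 0 = 0" "Z (LA k) 1 = 0" "Z (LA k) 2 = 0"
    "sgn (Z (LA k) 3) = sgn (pvert K k ! 0)" "sgn (Z (LA k) 4) = sgn (pvert K k ! 1)" "sgn (Z (LA k) 5) = sgn (pvert K k ! 2)"
    "Z (LA k) 6 = 0" "Z (LA k) 7 = 0" "Z (LA k) 8 = 0"
  using sgs[OF labels(6)[OF assms]] by (simp_all add: nth_LA nth9 sgn_0_0 del: bvec.simps(1,2))

lemma zB: assumes "k \<le> K"
  shows "Z (LB k) 0 = 0" "Z (LB k) 1 = 0" "Z (LB k) 2 = 0" "Z (LB k) 3 = 0" "Z (LB k) 4 = 0" "Z (LB k) 5 = 0"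
    "sgn (Z (LB k) 6) = sgn (pvert K k ! 0)" "sgn (Z (LB k) 7) = sgn (pvert K k ! 1)" "sgn (Z (LB k) 8) = sgn (pvert K k ! 2)"
  using sgs[OF labels(7)[OF assms]] by (simp_all add: nth_LA nth9 sgn_0_0 del: bvec.simps(1,2))

text \<open>In the join the restrictions to \<open>U\<close> and \<open>U'\<close> are nonnegative
  independently of each other, and the restriction to \<open>W\<close> is arbitrary because all
  polygon labels vanish there.\<close>

lemma transfer:
  assumes "\<And>k. k \<le> K \<Longrightarrow> 0 \<le> f3 * pvert K k ! 0 + f4 * pvert K k ! 1 + f5 * pvert K k ! 2"
    and "\<And>k. k \<le> K \<Longrightarrow> 0 \<le> f6 * pvert K k ! 0 + f7 * pvert K k ! 1 + f8 * pvert K k ! 2"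
  obtains g where "\<And>l. l \<in> L \<Longrightarrow>
    sgn (zform g l) =
    sgn (bform f0 f1 f2 f3 f4 f5 f6 f7 f8 l)"
proof -
  have "\<forall>l\<in>polyL K. 0 \<le> dotp 9 ((!) [f0,f1,f2,f3,f4,f5,f6,f7,f8]) ((!) (bvec K l))"
    using assms by (auto simp: polyL_def dotp9 nth9 nth_LA simp del: bvec.simps(1,2))
  then obtain g where g: "\<forall>l\<in>L.
      sgn (dotp 9 g (Z l)) = sgn (dotp 9 ((!) [f0,f1,f2,f3,f4,f5,f6,f7,f8]) ((!) (bvec K l)))"
    using real unfolding sign_realization_def by blast
  show thesis
    by (rule that[of g]) (use g in \<open>simp only: dotp9 nth9\<close>)
qed

text \<open>Forms supported on \<open>W\<close> are zero on both polygons, so every line of the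
  plane is transferred.\<close>

lemma W_rigid:
  "(\<forall>a\<in>T. \<forall>b\<in>T. Z (LW a b) 1 = Z (LW a b) 0 * a \<and> Z (LW a b) 2 = Z (LW a b) 0 * b) \<and> Z (LE 2) 1 = Z (LE 2) 2"
proof -
  define A B where AB: "A a b = Z (LW a b) 1 / Z (LW a b) 0" "B a b = Z (LW a b) 2 / Z (LW a b) 0" for a b
  have "(\<forall>a\<in>T. \<forall>b\<in>T. A a b = a \<and> B a b = b) \<and> Z (LE 2) 1 = Z (LE 2) 2"
  proof (rule plane_rigid[OF T])
    fix f0 f1 f2 :: real
    obtain g where g: "\<And>l. l \<in> L \<Longrightarrow>
      sgn (zform g l) =
      sgn (bform f0 f1 f2 0 0 0 0 0 0 l)"
      by (rule transfer[of 0 0 0 0 0 0 f0 f1 f2]) auto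
    have "sgn (g 0 + g 1 * A a b + g 2 * B a b) = sgn (f0 + f1 * a + f2 * b)" if "a \<in> T" "b \<in> T" for a b
    proof -
      have "sgn (g 0 * Z (LW a b) 0 + g 1 * Z (LW a b) 1 + g 2 * Z (LW a b) 2) = sgn (f0 + f1 * a + f2 * b)"
        using g[OF labels(1)[OF that]] zW[OF that] by (simp add: nth9)
      moreover have "g 0 * Z (LW a b) 0 + g 1 * Z (LW a b) 1 + g 2 * Z (LW a b) 2 = Z (LW a b) 0 * (g 0 + g 1 * A a b + g 2 * B a b)"
        using zW(1)[OF that] by (simp add: AB field_simps)
      ultimately show ?thesis using zW(1)[OF that] by (simp add: sgn_mult)
    qed
    moreover have "sgn (g 1) = sgn f1"
      using g[OF labels(2)[of 0]] zE0 by (simp add: nth9 sgn_mult)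
    moreover have "sgn (g 2) = sgn f2"
      using g[OF labels(2)[of 1]] zE1 by (simp add: nth9 sgn_mult)
    moreover have "sgn (g 1 * Z (LE 2) 1 + g 2 * Z (LE 2) 2) = sgn (f1 + f2)"
      using g[OF labels(2)[of 2]] zE2 by (simp add: nth9 sgn_mult)
    ultimately show "\<exists>g0 g1 g2. (\<forall>a\<in>T. \<forall>b\<in>T. sgn (g0 + g1 * A a b + g2 * B a b) = sgn (f0 + f1 * a + f2 * b))
      \<and> sgn g1 = sgn f1 \<and> sgn g2 = sgn f2 \<and> sgn (g1 * Z (LE 2) 1 + g2 * Z (LE 2) 2) = sgn (f1 + f2)"
      by blast
  qed (use zW norm_W zE2 in \<open>auto simp: AB divide_inverse sgn_mult\<close>)
  moreover have "Z (LW a b) 1 = Z (LW a b) 0 * A a b" "Z (LW a b) 2 = Z (LW a b) 0 * B a b"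
    if "a \<in> T" "b \<in> T" for a b
    using zW(1)[OF that] by (simp_all add: AB)
  ultimately show ?thesis by metis
qed

end

section \<open>Rigidity of the two polygons\<close>

lemma nth3: "[a,b,c] ! 0 = a" "[a,b,c] ! 1 = b" "[a,b,c] ! 2 = c"
  by (simp_all add: eval_nat_numeral)

lemma evp_pos: assumes "i < K" "k \<le> K" "2 \<le> K" "k \<noteq> i" "k \<noteq> lo K i" shows "0 < evp K i k"
  using evp_nonneg[OF assms(1,2)] evp_zero[OF assms(1-3)] assms(4,5) by linarith

text \<open>A form with the signs of edge \<open>i\<close> vanishes at the realized vertices
  \<open>i\<close> and \<open>lo K i\<close>. It is determined up to a positive factor as soon as
  these two vectors are independent, and independence is extracted from the existence of the other
  edges.\<close>

lemma edge_unique: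
  fixes X0 X1 X2 :: "nat \<Rightarrow> real"
  assumes K: "3 \<le> K" "i < K"
    and ex: "\<And>j. j < K \<Longrightarrow> \<exists>y0 y1 y2. \<forall>k\<le>K. sgn (y0 * X0 k + y1 * X1 k + y2 * X2 k) = sgn (evp K j k)"
    and s2: "\<And>k. k \<le> K \<Longrightarrow> sgn (X2 k) = sgn (pvert K k ! 2)"
    and u: "\<And>k. k \<le> K \<Longrightarrow> sgn (u0 * X0 k + u1 * X1 k + u2 * X2 k) = sgn (evp K i k)"
    and v: "\<And>k. k \<le> K \<Longrightarrow> sgn (v0 * X0 k + v1 * X1 k + v2 * X2 k) = sgn (evp K i k)"
  shows "\<exists>c>0. v0 = c * u0 \<and> v1 = c * u1 \<and> v2 = c * u2"
proof -
  define l where "l = lo K i"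
  have l: "l \<le> K" "l \<noteq> i" "i \<le> K" using K by (auto simp: l_def lo_def)
  have z: "evp K i l = 0" "evp K i i = 0" using evp_zero[of i K] K l by (auto simp: l_def)
  \<comment> \<open>The other edge through vertex \<open>i\<close> separates it from vertex
    \<open>l\<close>. This is the next evaluation or, after the last one, the coordinate
    \<open>p''\<close>.\<close>
  obtain w0 w1 w2 where w: "w0 * X0 i + w1 * X1 i + w2 * X2 i = 0" "0 < w0 * X0 l + w1 * X1 l + w2 * X2 l"
  proof (cases "Suc i < K")
    case True
    obtain y0 y1 y2 where y: "\<forall>k\<le>K. sgn (y0 * X0 k + y1 * X1 k + y2 * X2 k) = sgn (evp K (Suc i) k)"
      using ex[OF True] by blast
    have "evp K (Suc i) i = 0" using evp_zero[OF True, of i] K by (simp add: lo_def)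
    moreover have "0 < evp K (Suc i) l"
      by (rule evp_pos) (use True K l in \<open>auto simp: l_def lo_def\<close>)
    ultimately show thesis
      using that[of y0 y1 y2] sgn_eqD(1)[OF y[rule_format, OF l(3)]] sgn_eqD(2)[OF y[rule_format, OF l(1)]] by auto
  next
    case False
    then have i: "i = K - 1" "l = K - 2" using K by (auto simp: l_def lo_def)
    have "pvert K i ! 2 = 0" "pvert K l ! 2 = 1" using K i by (auto simp: pvert_def eval_nat_numeral)
    then show thesis using that[of 0 0 1] s2[OF l(3)] s2[OF l(1)] by (simp add: sgn_0_0 sgn_1_pos)
  qed
  \<comment> \<open>An edge that avoids vertex \<open>i\<close>, so that the realized vertex is
    nonzero.\<close>
  define j where "j = (if i = 0 then 2 else 0::nat)"
  have j: "j < K" using K by (simp add: j_def)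
  obtain y0 y1 y2 where y: "\<forall>k\<le>K. sgn (y0 * X0 k + y1 * X1 k + y2 * X2 k) = sgn (evp K j k)"
    using ex[OF j] by blast
  have "0 < evp K j i" by (rule evp_pos) (use K j in \<open>auto simp: j_def lo_def\<close>)
  then have nz: "X0 i \<noteq> 0 \<or> X1 i \<noteq> 0 \<or> X2 i \<noteq> 0"
    using sgn_eqD(2)[OF y[rule_format, OF l(3)]] by auto
  \<comment> \<open>A vertex off edge \<open>i\<close>, where both forms are positive.\<close>
  define m where "m = (if i = 0 then 1 else if i = 1 then 2 else 0::nat)"
  have m: "m \<le> K" using K by (simp add: m_def)
  have mp: "0 < evp K i m" by (rule evp_pos) (use K m in \<open>auto simp: m_def lo_def\<close>)
  show ?thesis
    by (rule form_unique3[of _ "X0 l" _ "X1 l" _ "X2 l" "X0 i" "X1 i" "X2 i" _ _ _ w0 w1 w2 "X0 m" "X1 m" "X2 m"])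
      (use w nz mp z sgn_eqD(1)[OF u[OF l(1)]] sgn_eqD(1)[OF u[OF l(3)]] sgn_eqD(1)[OF v[OF l(1)]]
        sgn_eqD(1)[OF v[OF l(3)]] sgn_eqD(2)[OF u[OF m]] sgn_eqD(2)[OF v[OF m]] in auto)
qed

context normalized_realization
begin

text \<open>Each equation comes from a form that vanishes on the \<open>LS\<close> vector in
  question and whose image has known ratios of coefficients: points of the plane fix the ratios
  inside \<open>W\<close>, \<open>LQ\<close> carries a coefficient from \<open>W\<close> to
  \<open>U'\<close>, and \<open>LB 0\<close>, \<open>LB 1\<close> show that other coefficients on
  \<open>U'\<close> vanish. On \<open>U'\<close> the forms are coordinates or zero, hence
  nonnegative on the polygon.\<close>

lemma S_rigid:
  "Z (LS 0) 6 = Z (LS 0) 1"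
  "Z (LS 1) 1 = 2 * Z (LS 1) 0" "Z (LS 1) 7 = - Z (LS 1) 0"
  "Z (LS 2) 2 = Z (LS 2) 1" "Z (LS 2) 8 = - Z (LS 2) 1"
proof -
  have W: "Z (LW a b) 1 = Z (LW a b) 0 * a" "Z (LW a b) 2 = Z (LW a b) 0 * b" if "a \<in> T" "b \<in> T" for a b
    using W_rigid that by auto
  have K2: "2 \<le> K" using K by simp
  note P = pvert_nonneg[OF K2]
  have B0: "Z (LB 0) 0 = 0" "Z (LB 0) 1 = 0" "Z (LB 0) 2 = 0" "Z (LB 0) 3 = 0" "Z (LB 0) 4 = 0" "Z (LB 0) 5 = 0"
      "Z (LB 0) 6 = 0" "Z (LB 0) 7 = 0" "0 < Z (LB 0) 8"
    using zB[of 0] K by (simp_all add: pvert_def sgn_0_0 sgn_1_pos eval_nat_numeral)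
  have B1: "Z (LB 1) 0 = 0" "Z (LB 1) 1 = 0" "Z (LB 1) 2 = 0" "Z (LB 1) 3 = 0" "Z (LB 1) 4 = 0" "Z (LB 1) 5 = 0"
      "Z (LB 1) 6 = 0" "0 < Z (LB 1) 7" "0 < Z (LB 1) 8"
    using zB[of 1] K by (simp_all add: pvert_def sgn_0_0 sgn_1_pos eval_nat_numeral)
  show 0: "Z (LS 0) 6 = Z (LS 0) 1"
  proof -
    obtain g where g: "\<And>l. l \<in> L \<Longrightarrow>
      sgn (zform g l) =
      sgn (bform 1 (-1) 0 0 0 0 1 0 0 l)"
      by (rule transfer[of 0 0 0 1 0 0 1 "-1" 0]) (use P in auto)
    have "g 0 + g 1 = 0" using g[OF labels(1)[OF T01(2,1)]] zW[OF T01(2,1)] W[OF T01(2,1)]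
      by (simp add: nth9 sgn_0_0 distrib_left[symmetric] mult.commute[of "g _"])
    moreover have "g 0 * Z (LQ 0) 0 + g 6 * Z (LQ 0) 6 = 0" using g[OF labels(4)[of 0]] zQ
      by (simp add: nth9 sgn_0_0)
    then have "(g 0 - g 6) * Z (LQ 0) 0 = 0" using norm_Q by (simp add: algebra_simps)
    then have "g 0 = g 6" using zQ by auto
    moreover have "0 < g 0" using g[OF labels(1)[OF T01(1,1)]] zW[OF T01(1,1)]
      by (auto simp add: nth9 sgn_0_0 sgn_1_pos W T01 zero_less_mult_iff)
    moreover have "g 1 * Z (LS 0) 1 + g 6 * Z (LS 0) 6 = 0" using g[OF labels(5)[of 0]] zS
      by (simp add: nth9 sgn_0_0)
    ultimately have "g 0 * (Z (LS 0) 6 - Z (LS 0) 1) = 0" by (simp add: algebra_simps add_eq_0_iff)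
    then show ?thesis using \<open>0 < g 0\<close> by simp
  qed
  show 1: "Z (LS 1) 1 = 2 * Z (LS 1) 0"
  proof -
    \<comment> \<open>A line through the point \<open>LW 2 0\<close>, which exists because
      \<open>2 \<in> T\<close>; it pins the ratio 2 of the two entries in \<open>W\<close>.\<close>
    obtain g where g: "\<And>l. l \<in> L \<Longrightarrow>
      sgn (zform g l) =
      sgn (bform 2 (-1) 0 0 0 0 0 0 0 l)"
      by (rule transfer[of 0 0 0 0 0 0 2 "-1" 0]) (use P in auto)
    have "g 0 * Z (LW 2 0) 0 + g 1 * (Z (LW 2 0) 0 * 2) = 0" using g[OF labels(1)[OF T2 T01(1)]] zW[OF T2 T01(1)] W[OF T2 T01(1)]
      by (simp add: nth9 sgn_0_0)
    then have "Z (LW 2 0) 0 * (g 0 + 2 * g 1) = 0" by (simp add: algebra_simps)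
    then have "g 0 = - 2 * g 1" using zW(1)[OF T2 T01(1)] by simp
    moreover have "0 < g 0" using g[OF labels(1)[OF T01(1,1)]] zW[OF T01(1,1)]
      by (auto simp add: nth9 sgn_0_0 sgn_1_pos W T01 zero_less_mult_iff)
    moreover have "g 8 = 0" using g[OF labels(7)[of 0]] B0 by (auto simp: nth_LA nth9 sgn_0_0 simp del: bvec.simps(1,2))
    moreover have "g 7 = 0" using g[OF labels(7)[of 1]] B1 K \<open>g 8 = 0\<close>
      by (auto simp: nth_LA nth9 sgn_0_0 simp del: bvec.simps(1,2))
    ultimately have "g 0 = - 2 * g 1" "0 < g 0" and "g 0 * Z (LS 1) 0 + g 1 * Z (LS 1) 1 = 0"
      using g[OF labels(5)[of 1]] zS by (simp_all add: nth9 sgn_0_0)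
    then have "g 1 * (Z (LS 1) 1 - 2 * Z (LS 1) 0) = 0" by (simp add: algebra_simps)
    then show ?thesis using \<open>0 < g 0\<close> \<open>g 0 = - 2 * g 1\<close> by simp
  qed
  show "Z (LS 1) 7 = - Z (LS 1) 0"
  proof -
    obtain g where g: "\<And>l. l \<in> L \<Longrightarrow>
      sgn (zform g l) =
      sgn (bform (-1) 1 0 0 0 0 0 1 0 l)"
      by (rule transfer[of 0 0 0 0 1 0 "-1" 1 0]) (use P in auto)
    have "g 0 + g 1 = 0" using g[OF labels(1)[OF T01(2,1)]] zW[OF T01(2,1)] W[OF T01(2,1)]
      by (simp add: nth9 sgn_0_0 distrib_left[symmetric] mult.commute[of "g _"])
    moreover have "g 1 * Z (LQ 1) 1 + g 7 * Z (LQ 1) 7 = 0" using g[OF labels(4)[of 1]] zQ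
      by (simp add: nth9 sgn_0_0)
    then have "(g 1 - g 7) * Z (LQ 1) 1 = 0" using norm_Q by (simp add: algebra_simps)
    then have "g 1 = g 7" using zQ by auto
    moreover have "g 0 < 0" using g[OF labels(1)[OF T01(1,1)]] zW[OF T01(1,1)]
      by (auto simp add: nth9 sgn_0_0 sgn_1_neg W T01 mult_less_0_iff)
    moreover have "g 0 * Z (LS 1) 0 + g 1 * Z (LS 1) 1 + g 7 * Z (LS 1) 7 = 0" using g[OF labels(5)[of 1]] zS
      by (simp add: nth9 sgn_0_0)
    ultimately have g: "g 0 = - g 7" "g 1 = g 7" "g 0 < 0"
      "g 0 * Z (LS 1) 0 + g 1 * Z (LS 1) 1 + g 7 * Z (LS 1) 7 = 0" by linarith+
    have "g 7 * (Z (LS 1) 7 + Z (LS 1) 0) = 0" using g(4) unfolding g(1,2) 1 by (simp add: algebra_simps)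
    then show ?thesis using g(1,3) by auto
  qed
  show 2: "Z (LS 2) 2 = Z (LS 2) 1"
  proof -
    obtain g where g: "\<And>l. l \<in> L \<Longrightarrow>
      sgn (zform g l) =
      sgn (bform 0 1 (-1) 0 0 0 0 0 0 l)"
      by (rule transfer[of 0 0 0 0 0 0 0 1 "-1"]) (use P in auto)
    have g0: "g 0 = 0" using g[OF labels(1)[OF T01(1,1)]] zW[OF T01(1,1)]
      by (auto simp add: nth9 sgn_0_0 W T01)
    have "g 1 + g 2 = 0" using g[OF labels(1)[OF T01(2,2)]] zW[OF T01(2,2)] norm_W g0
      by (simp add: nth9 sgn_0_0)
    moreover have "0 < g 1" using g[OF labels(2)[of 0]] zE0
      by (auto simp add: nth9 sgn_1_pos zero_less_mult_iff)
    moreover have "g 8 = 0" using g[OF labels(7)[of 0]] B0 by (auto simp: nth_LA nth9 sgn_0_0 simp del: bvec.simps(1,2))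
    then have "g 1 * Z (LS 2) 1 + g 2 * Z (LS 2) 2 = 0" using g[OF labels(5)[of 2]] zS
      by (simp add: nth9 sgn_0_0)
    ultimately have "g 1 * (Z (LS 2) 2 - Z (LS 2) 1) = 0" by (simp add: algebra_simps add_eq_0_iff)
    then show ?thesis using \<open>0 < g 1\<close> by simp
  qed
  show "Z (LS 2) 8 = - Z (LS 2) 1"
  proof -
    obtain g where g: "\<And>l. l \<in> L \<Longrightarrow>
      sgn (zform g l) =
      sgn (bform 0 0 1 0 0 0 0 0 1 l)"
      by (rule transfer[of 0 0 0 0 0 1 0 0 1]) (use P in auto)
    have "g 1 = 0" using g[OF labels(2)[of 0]] zE0
      by (auto simp add: nth9 sgn_0_0)
    moreover have "g 2 * Z (LQ 2) 2 + g 8 * Z (LQ 2) 8 = 0" using g[OF labels(4)[of 2]] zQ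
      by (simp add: nth9 sgn_0_0)
    then have "(g 2 - g 8) * Z (LQ 2) 2 = 0" using norm_Q by (simp add: algebra_simps)
    then have "g 2 = g 8" using zQ by auto
    moreover have "0 < g 2" using g[OF labels(2)[of 1]] zE1
      by (auto simp add: nth9 sgn_1_pos zero_less_mult_iff)
    moreover have "g 1 * Z (LS 2) 1 + g 2 * Z (LS 2) 2 + g 8 * Z (LS 2) 8 = 0" using g[OF labels(5)[of 2]] zS
      by (simp add: nth9 sgn_0_0)
    ultimately have "g 2 * (Z (LS 2) 2 + Z (LS 2) 8) = 0" by (simp add: algebra_simps add_eq_0_iff)
    then show ?thesis using \<open>0 < g 2\<close> 2 by auto
  qed
qed

definition formA :: "real list \<Rightarrow> nat \<Rightarrow> real"
  where "formA y k = y ! 0 * Z (LA k) 3 + y ! 1 * Z (LA k) 4 + y ! 2 * Z (LA k) 5"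

definition formB :: "real list \<Rightarrow> nat \<Rightarrow> real"
  where "formB y k = y ! 0 * Z (LB k) 6 + y ! 1 * Z (LB k) 7 + y ! 2 * Z (LB k) 8"

text \<open>The form equal to \<open>evl i\<close> on \<open>W\<close> and \<open>U\<close> and to
  \<open>evl j\<close> on \<open>U'\<close> vanishes on all \<open>LR\<close>; it vanishes on all
  \<open>LQ\<close> if \<open>i = j\<close> and on all \<open>LS\<close> if
  \<open>i = Suc j\<close>. By normalization and \<open>S_rigid\<close> the image satisfies the same
  linear equations. The last conclusion is the action of \<open>p(t) \<mapsto> p(t - 1)\<close> on
  forms in the coordinates \<open>p(1)\<close>, \<open>p(0)\<close>, \<open>p''\<close>.\<close>

lemma edge_pair:
  assumes "i < K" "j < K"
  obtains z w where "length z = 3" "length w = 3"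
    "\<And>k. k \<le> K \<Longrightarrow> sgn (formA z k) = sgn (evp K i k)"
    "\<And>k. k \<le> K \<Longrightarrow> sgn (formB w k) = sgn (evp K j k)"
    "i = j \<Longrightarrow> z = w"
    "i = Suc j \<Longrightarrow> w = [- (z ! 1), z ! 0 + 2 * z ! 1, z ! 1 + z ! 2]"
proof -
  have le0: "0 \<le> K" by simp
  have nn: "0 \<le> evl i ! 0 * pvert K k ! 0 + evl i ! 1 * pvert K k ! 1 + evl i ! 2 * pvert K k ! 2"
    "0 \<le> evl j ! 0 * pvert K k' ! 0 + evl j ! 1 * pvert K k' ! 1 + evl j ! 2 * pvert K k' ! 2"
    if "k \<le> K" "k' \<le> K" for k k'
    using evp_nonneg[of i K k] evp_nonneg[of j K k'] assms that unfolding evp_def by auto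
  obtain g where g: "\<And>l. l \<in> L \<Longrightarrow>
      sgn (zform g l) =
      sgn (bform (evl i ! 0) (evl i ! 1) (evl i ! 2) (evl i ! 0) (evl i ! 1) (evl i ! 2) (evl j ! 0) (evl j ! 1) (evl j ! 2) l)"
    by (rule transfer[OF nn(1)[OF _ le0] nn(2)[OF le0], where ?f0.0 = "evl i ! 0" and ?f1.0 = "evl i ! 1" and ?f2.0 = "evl i ! 2"]) blast+
  have R: "g 3 = g 0" "g 4 = g 1" "g 5 = g 2"
  proof -
    have "(g 0 - g 3) * Z (LR 0) 0 = 0" "(g 1 - g 4) * Z (LR 1) 1 = 0" "(g 2 - g 5) * Z (LR 2) 2 = 0"
      using g[OF labels(3)[of 0]] g[OF labels(3)[of 1]] g[OF labels(3)[of 2]] zR norm_R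
      by (simp_all add: nth9 sgn_0_0 left_diff_distrib)
    then show "g 3 = g 0" "g 4 = g 1" "g 5 = g 2" using zR by auto
  qed
  have Q: "g 6 = g 0" "g 7 = g 1" "g 8 = g 2" if "i = j"
  proof -
    have "(g 0 - g 6) * Z (LQ 0) 0 = 0" "(g 1 - g 7) * Z (LQ 1) 1 = 0" "(g 2 - g 8) * Z (LQ 2) 2 = 0"
      using g[OF labels(4)[of 0]] g[OF labels(4)[of 1]] g[OF labels(4)[of 2]] zQ norm_Q that
      by (simp_all add: nth9 sgn_0_0 left_diff_distrib)
    then show "g 6 = g 0" "g 7 = g 1" "g 8 = g 2" using zQ by auto
  qed
  have S: "g 6 = - g 1" "g 7 = g 0 + 2 * g 1" "g 8 = g 1 + g 2" if "i = Suc j"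
  proof -
    have e: "evl i ! 1 + evl j ! 0 = 0" "- (evl i ! 0) - evl i ! 1 * 2 + evl j ! 1 = 0"
      "- (evl i ! 1) - evl i ! 2 + evl j ! 2 = 0"
      unfolding that evl_def by (simp_all add: eval_nat_numeral field_simps)
    have "g 1 * Z (LS 0) 1 + g 6 * Z (LS 0) 6 = 0"
      using g[OF labels(5)[of 0]] zS e by (simp add: nth9 sgn_0_0)
    then have "(g 1 + g 6) * Z (LS 0) 1 = 0" using S_rigid by (simp add: algebra_simps)
    moreover have "g 0 * Z (LS 1) 0 + g 1 * Z (LS 1) 1 + g 7 * Z (LS 1) 7 = 0"
      using g[OF labels(5)[of 1]] zS e by (simp add: nth9 sgn_0_0)
    then have "(g 0 + 2 * g 1 - g 7) * Z (LS 1) 0 = 0" using S_rigid by (simp add: algebra_simps)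
    moreover have "g 1 * Z (LS 2) 1 + g 2 * Z (LS 2) 2 + g 8 * Z (LS 2) 8 = 0"
      using g[OF labels(5)[of 2]] zS e by (simp add: nth9 sgn_0_0)
    then have "(g 1 + g 2 - g 8) * Z (LS 2) 1 = 0" using S_rigid by (simp add: algebra_simps)
    ultimately show "g 6 = - g 1" "g 7 = g 0 + 2 * g 1" "g 8 = g 1 + g 2" using zS by auto
  qed
  have "sgn (formA [g 0, g 1, g 2] k) = sgn (evp K i k)" if "k \<le> K" for k
    using g[OF labels(6)[OF that]] zA(1-3,7-9)[OF that]
    by (simp add: formA_def R nth_LA nth9 nth3 evp_def del: bvec.simps(1,2))
  moreover have "sgn (formB [g 6, g 7, g 8] k) = sgn (evp K j k)" if "k \<le> K" for k
    using g[OF labels(7)[OF that]] zB(1-6)[OF that]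
    by (simp add: formB_def nth_LA nth9 nth3 evp_def del: bvec.simps(1,2))
  ultimately show thesis
    by (rule that[of "[g 0, g 1, g 2]" "[g 6, g 7, g 8]", rotated 2])
      (auto simp: Q S nth3)
qed

lemma edge_unique_A:
  assumes "i < K" "length u = 3" "length v = 3"
    and "\<And>k. k \<le> K \<Longrightarrow> sgn (formA u k) = sgn (evp K i k)"
    and "\<And>k. k \<le> K \<Longrightarrow> sgn (formA v k) = sgn (evp K i k)"
  shows "\<exists>c>0. v = [c * u ! 0, c * u ! 1, c * u ! 2]"
proof -
  have ex: "\<exists>y0 y1 y2. \<forall>k\<le>K. sgn (y0 * Z (LA k) 3 + y1 * Z (LA k) 4 + y2 * Z (LA k) 5) = sgn (evp K j k)"
    if "j < K" for j
    using edge_pair[OF that that] unfolding formA_def by metis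
  have "v = [v ! 0, v ! 1, v ! 2]" using assms(3) by (auto simp: length_Suc_conv eval_nat_numeral)
  moreover have "\<exists>c>0. v ! 0 = c * u ! 0 \<and> v ! 1 = c * u ! 1 \<and> v ! 2 = c * u ! 2"
    by (rule edge_unique[OF K assms(1) ex, of "u ! 0" "u ! 1" "u ! 2" "v ! 0" "v ! 1" "v ! 2"])
      (use zA(6) assms(4,5) in \<open>auto simp: formA_def\<close>)
  ultimately show ?thesis by metis
qed

lemma edge_unique_B:
  assumes "i < K" "length u = 3" "length v = 3"
    and "\<And>k. k \<le> K \<Longrightarrow> sgn (formB u k) = sgn (evp K i k)"
    and "\<And>k. k \<le> K \<Longrightarrow> sgn (formB v k) = sgn (evp K i k)"
  shows "\<exists>c>0. v = [c * u ! 0, c * u ! 1, c * u ! 2]"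
proof -
  have ex: "\<exists>y0 y1 y2. \<forall>k\<le>K. sgn (y0 * Z (LB k) 6 + y1 * Z (LB k) 7 + y2 * Z (LB k) 8) = sgn (evp K j k)"
    if "j < K" for j
    using edge_pair[OF that that] unfolding formB_def by metis
  have "v = [v ! 0, v ! 1, v ! 2]" using assms(3) by (auto simp: length_Suc_conv eval_nat_numeral)
  moreover have "\<exists>c>0. v ! 0 = c * u ! 0 \<and> v ! 1 = c * u ! 1 \<and> v ! 2 = c * u ! 2"
    by (rule edge_unique[OF K assms(1) ex, of "u ! 0" "u ! 1" "u ! 2" "v ! 0" "v ! 1" "v ! 2"])
      (use zB(9) assms(4,5) in \<open>auto simp: formB_def\<close>)
  ultimately show ?thesis by metis
qed

lemma form_scale:
  "formA [c * u ! 0, c * u ! 1, c * u ! 2] k = c * formA u k"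
  "formB [c * u ! 0, c * u ! 1, c * u ! 2] k = c * formB u k"
  by (simp_all add: formA_def formB_def eval_nat_numeral algebra_simps)

text \<open>Evaluation at 0 is the coordinate \<open>p(0)\<close>, whose signs are given. A shift
  pair carries the known edge \<open>i\<close> of the second polygon to edge \<open>i + 1\<close> of
  the first, and an identity pair copies that edge to the second polygon. Uniqueness of edge forms
  is what identifies the members of a pair, of which only existence is known.\<close>

lemma edges_rigid:
  "i < K \<Longrightarrow> (\<forall>k\<le>K. sgn (formA (evl i) k) = sgn (evp K i k) \<and> sgn (formB (evl i) k) = sgn (evp K i k))"
proof (induction i)
  case 0
  then show ?case using zA(5) zB(8) by (simp add: formA_def formB_def evl_def evp_def eval_nat_numeral)
next
  case (Suc i)
  have i: "i < K" using Suc.prems by simp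
  have IH: "\<And>k. k \<le> K \<Longrightarrow> sgn (formB (evl i) k) = sgn (evp K i k)" using Suc.IH[OF i] by blast
  obtain z w where zw: "length z = 3" "length w = 3"
    "\<And>k. k \<le> K \<Longrightarrow> sgn (formA z k) = sgn (evp K (Suc i) k)"
    "\<And>k. k \<le> K \<Longrightarrow> sgn (formB w k) = sgn (evp K i k)"
    "w = [- (z ! 1), z ! 0 + 2 * z ! 1, z ! 1 + z ! 2]"
    using edge_pair[OF Suc.prems i] by metis
  have len: "length (evl j) = 3" for j by (simp add: evl_def)
  obtain c where c: "0 < c" "w = [c * evl i ! 0, c * evl i ! 1, c * evl i ! 2]"
    using edge_unique_B[OF i len zw(2) IH zw(4)] by blast
  have "z = [z ! 0, z ! 1, z ! 2]" using zw(1) by (auto simp: length_Suc_conv eval_nat_numeral)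
  moreover have "z ! 0 = c * evl (Suc i) ! 0" "z ! 1 = c * evl (Suc i) ! 1" "z ! 2 = c * evl (Suc i) ! 2"
  proof -
    have e: "- (z ! 1) = c * real i" "z ! 0 + 2 * z ! 1 = c * (1 - real i)" "z ! 1 + z ! 2 = c * (real i * (real i - 1) / 2)"
      using zw(5) c(2) by (simp_all add: evl_def eval_nat_numeral)
    then have z1: "z ! 1 = - (c * real i)" by simp
    show "z ! 1 = c * evl (Suc i) ! 1" using z1 by (simp add: evl_def algebra_simps)
    show "z ! 0 = c * evl (Suc i) ! 0" using e(2) z1 by (simp add: evl_def algebra_simps)
    show "z ! 2 = c * evl (Suc i) ! 2" using e(3) z1 by (simp add: evl_def eval_nat_numeral field_simps)
  qed
  ultimately have z: "z = [c * evl (Suc i) ! 0, c * evl (Suc i) ! 1, c * evl (Suc i) ! 2]" by metis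
  have A: "sgn (formA (evl (Suc i)) k) = sgn (evp K (Suc i) k)" if "k \<le> K" for k
    using zw(3)[OF that] c(1) unfolding z form_scale by (simp add: sgn_mult)
  obtain y where y: "length y = 3"
    "\<And>k. k \<le> K \<Longrightarrow> sgn (formA y k) = sgn (evp K (Suc i) k)"
    "\<And>k. k \<le> K \<Longrightarrow> sgn (formB y k) = sgn (evp K (Suc i) k)"
    using edge_pair[OF Suc.prems Suc.prems] by metis
  obtain e where e: "0 < e" "y = [e * evl (Suc i) ! 0, e * evl (Suc i) ! 1, e * evl (Suc i) ! 2]"
    using edge_unique_A[OF Suc.prems len y(1) A y(2)] by blast
  have "sgn (formB (evl (Suc i)) k) = sgn (evp K (Suc i) k)" if "k \<le> K" for k
    using y(3)[OF that] e(1) unfolding e(2) form_scale by (simp add: sgn_mult)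
  then show ?case using A by blast
qed

text \<open>Vertex \<open>k\<close> is the intersection of the edges \<open>k\<close> and
  \<open>Suc k\<close>. Where an evaluation is missing, a vanishing coordinate replaces it:
  \<open>p''\<close> for \<open>k = K - 1\<close>, and both \<open>p(0)\<close> and
  \<open>p''\<close> for \<open>k = K\<close>. The sign conditions supply these.\<close>

lemma vertex_from_edges:
  fixes x0 x1 x2 :: real
  assumes "k \<le> K"
    and s: "sgn x0 = sgn (pvert K k ! 0)" "sgn x1 = sgn (pvert K k ! 1)" "sgn x2 = sgn (pvert K k ! 2)"
    and e: "\<And>i. i < K \<Longrightarrow> i = k \<or> i = Suc k \<Longrightarrow> evl i ! 0 * x0 + evl i ! 1 * x1 + evl i ! 2 * x2 = 0"
  shows "\<exists>c>0. x0 = c * pvert K k ! 0 \<and> x1 = c * pvert K k ! 1 \<and> x2 = c * pvert K k ! 2"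
proof -
  consider "k + 2 \<le> K" | "k + 1 = K" | "k = K" using assms(1) by linarith
  then show ?thesis
  proof cases
    case 1
    have "real k * x0 + (1 - real k) * x1 + real k * (real k - 1) / 2 * x2 = 0"
      "real (Suc k) * x0 + (1 - real (Suc k)) * x1 + real (Suc k) * (real (Suc k) - 1) / 2 * x2 = 0"
      using e[of k] e[of "Suc k"] 1 by (simp_all add: evl_def eval_nat_numeral)
    then have a: "x1 = x0 + real k * x2" and b: "real k * x0 + (1 - real k) * x1 + real k * (real k - 1) / 2 * x2 = 0"
      by (simp_all add: field_simps)
    have "x0 = x2 * (real k * (real k - 1) / 2)" using b unfolding a by (simp add: field_simps)
    moreover have "x1 = x2 * (real k * (real k + 1) / 2)" unfolding a calculation by (simp add: field_simps)
    moreover have "0 < x2" using s(3) 1 by (simp add: pvert_def eval_nat_numeral sgn_1_pos)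
    ultimately show ?thesis using 1 by (intro exI[of _ x2]) (simp add: pvert_def eval_nat_numeral)
  next
    case 2
    then have rk: "real k = real K - 1" by linarith
    have x2: "x2 = 0" using s(3) 2 by (simp add: pvert_def eval_nat_numeral sgn_0_0)
    have "(real K - 1) * x0 + (2 - real K) * x1 = 0" using e[of k] 2 x2 by (simp add: evl_def eval_nat_numeral rk)
    then have "x0 = x1 / (real K - 1) * (real K - 2)" using K by (simp add: field_simps)
    moreover have "0 < x1" using sgn_eqD(2)[OF s(2)] 2 K by (simp add: pvert_def)
    ultimately show ?thesis using 2 x2 K by (intro exI[of _ "x1 / (real K - 1)"]) (simp add: pvert_def eval_nat_numeral)
  next
    case 3
    have "x1 = 0" "x2 = 0" "0 < x0" using s 3 by (simp_all add: pvert_def eval_nat_numeral sgn_0_0 sgn_1_pos)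
    then show ?thesis using 3 by (intro exI[of _ x0]) (simp add: pvert_def eval_nat_numeral)
  qed
qed

lemma vertices_rigid:
  assumes "k \<le> K"
  shows "\<exists>c>0. Z (LA k) 3 = c * pvert K k ! 0 \<and> Z (LA k) 4 = c * pvert K k ! 1 \<and> Z (LA k) 5 = c * pvert K k ! 2"
    and "\<exists>c>0. Z (LB k) 6 = c * pvert K k ! 0 \<and> Z (LB k) 7 = c * pvert K k ! 1 \<and> Z (LB k) 8 = c * pvert K k ! 2"
proof -
  have "formA (evl i) k = 0 \<and> formB (evl i) k = 0" if "i < K" "i = k \<or> i = Suc k" for i
  proof -
    have "evp K i k = 0" using evp_zero[OF that(1) assms] that K by (auto simp: lo_def)
    moreover have "sgn (formA (evl i) k) = sgn (evp K i k)" "sgn (formB (evl i) k) = sgn (evp K i k)"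
      using edges_rigid[OF that(1)] assms by blast+
    ultimately show ?thesis by (simp add: sgn_0_0)
  qed
  then show "\<exists>c>0. Z (LA k) 3 = c * pvert K k ! 0 \<and> Z (LA k) 4 = c * pvert K k ! 1 \<and> Z (LA k) 5 = c * pvert K k ! 2"
    and "\<exists>c>0. Z (LB k) 6 = c * pvert K k ! 0 \<and> Z (LB k) 7 = c * pvert K k ! 1 \<and> Z (LB k) 8 = c * pvert K k ! 2"
    using vertex_from_edges[OF assms] zA(4-6)[OF assms] zB(7-9)[OF assms] by (simp_all add: formA_def formB_def)
qed

end

context normalized_realization
begin

lemma all_rigid:
  assumes "l \<in> L"
  shows "\<exists>c>0. \<forall>j<9. Z l j = c * bvec K l ! j"
proof -
  consider (A) k where "k \<le> K" "l = LA k" | (B) k where "k \<le> K" "l = LB k" | (D) "l \<in> doubL T"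
    using assms by (auto simp: polyL_def)
  then show ?thesis
  proof cases
    case A
    then show ?thesis using vertices_rigid(1)[of k] zA(1-3,7-9)[of k]
      by (auto simp: forall_less_9 nth_LA nth9 simp del: bvec.simps(1,2))
  next
    case B
    then show ?thesis using vertices_rigid(2)[of k] zB(1-6)[of k]
      by (auto simp: forall_less_9 nth_LA nth9 simp del: bvec.simps(1,2))
  next
    case D
    then show ?thesis
    proof (cases rule: doubL_cases)
      case (1 a b)
      then show ?thesis using W_rigid zW[of a b]
        by (intro exI[of _ "Z l 0"]) (auto simp: forall_less_9 nth9)
    next
      case (2 i)
      then show ?thesis using W_rigid zE0 zE1 zE2
        by (intro exI[of _ "Z l (if i = 1 then 2 else 1)"]) (auto simp: forall_less_9 nth9)
    next
      case (3 i)
      then show ?thesis using zR norm_R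
        by (intro exI[of _ "- Z l i"]) (auto simp: forall_less_9 nth9)
    next
      case (4 i)
      then show ?thesis using zQ norm_Q
        by (intro exI[of _ "- Z l i"]) (auto simp: forall_less_9 nth9)
    next
      case (5 i)
      then show ?thesis using zS S_rigid
        by (intro exI[of _ "Z l (6 + i)"]) (auto simp: forall_less_9 nth9)
    qed
  qed
qed

end

theorem diag_rigid_bvec:
  assumes K: "3 \<le> K" and T: "hom_rigid T" "2 \<in> T"
  shows "diag_rigid 9 (\<lambda>l. (!) (bvec K l)) (polyL K) (doubL T)"
  unfolding diag_rigid_def
proof (intro allI impI, elim conjE)
  fix Z :: "lab \<Rightarrow> nat \<Rightarrow> real"
  assume real: "sign_realization 9 (\<lambda>l. (!) (bvec K l)) (polyL K) (doubL T) Z"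
    and sg: "\<forall>l\<in>polyL K \<union> doubL T. \<forall>j<9. sgn (Z l j) = sgn (bvec K l ! j)"
  \<comment> \<open>The solution of the nine normalization equations: the unit point gives the
    entries on \<open>W\<close>, and the ratio of the two entries of \<open>LR\<close> or
    \<open>LQ\<close> carries them over to \<open>U\<close> and \<open>U'\<close>.\<close>
  define D where "D j = (if j < 3 then Z (LW 1 1) j
      else if j < 6 then Z (LW 1 1) (j - 3) * (Z (LR (j - 3)) j / - Z (LR (j - 3)) (j - 3))
      else Z (LW 1 1) (j - 6) * (Z (LQ (j - 6)) j / - Z (LQ (j - 6)) (j - 6)))" for j
  have T01: "1 \<in> T" "0 \<in> T" using T by (auto simp: hom_rigid_def)
  have mem: "LW 1 1 \<in> polyL K \<union> doubL T" "\<And>j. j < 3 \<Longrightarrow> LR j \<in> polyL K \<union> doubL T"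
    "\<And>j. j < 3 \<Longrightarrow> LQ j \<in> polyL K \<union> doubL T"
    using T01 by (auto simp: doubL_def)
  have j3: "j = 0 \<or> j = 1 \<or> j = 2" if "j < 3" for j :: nat using that by linarith
  have W: "0 < Z (LW 1 1) j" if "j < 3" for j
    using sg[rule_format, OF mem(1), of j] j3[OF that] by (auto simp: sgn_1_pos)
  have R: "0 < Z (LR j) (j + 3)" "Z (LR j) j < 0" if "j < 3" for j
    using sg[rule_format, OF mem(2)[OF that], of j] sg[rule_format, OF mem(2)[OF that], of "j + 3"] j3[OF that]
    by (auto simp: nth9 sgn_1_pos sgn_1_neg eval_nat_numeral)
  have Q: "0 < Z (LQ j) (j + 6)" "Z (LQ j) j < 0" if "j < 3" for j
    using sg[rule_format, OF mem(3)[OF that], of j] sg[rule_format, OF mem(3)[OF that], of "j + 6"] j3[OF that]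
    by (auto simp: nth9 sgn_1_pos sgn_1_neg eval_nat_numeral)
  have D: "0 < D j" if "j < 9" for j
  proof -
    consider "j < 3" | "3 \<le> j" "j < 6" | "6 \<le> j" using that by linarith
    then show ?thesis
    proof cases
      case 2
      then show ?thesis using W[of "j - 3"] R[of "j - 3"] by (auto simp: D_def intro!: mult_pos_neg divide_pos_neg)
    next
      case 3
      then show ?thesis using that W[of "j - 6"] Q[of "j - 6"] by (auto simp: D_def intro!: mult_pos_neg divide_pos_neg)
    qed (auto simp: D_def W)
  qed
  define \<xi> where "\<xi> l j = Z l j / D j" for l j
  interpret normalized_realization K T \<xi>
  proof
    show "sign_realization 9 (\<lambda>l. (!) (bvec K l)) (polyL K) (doubL T) \<xi>"
      unfolding sign_realization_def
    proof (intro allI impI)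
      fix f assume "\<forall>l\<in>polyL K. 0 \<le> dotp 9 f ((!) (bvec K l))"
      then obtain g where g: "\<forall>l\<in>polyL K \<union> doubL T. sgn (dotp 9 g (Z l)) = sgn (dotp 9 f ((!) (bvec K l)))"
        using real unfolding sign_realization_def by blast
      have "dotp 9 (\<lambda>j. g j * D j) (\<xi> l) = dotp 9 g (Z l)" for l
        unfolding dotp_def \<xi>_def by (rule sum.cong) (use D in \<open>force+\<close>)
      then show "\<exists>g. \<forall>l\<in>polyL K \<union> doubL T. sgn (dotp 9 g (\<xi> l)) = sgn (dotp 9 f ((!) (bvec K l)))"
        using g by metis
    qed
    show "sgn (\<xi> l j) = sgn (bvec K l ! j)" if "l \<in> polyL K \<union> doubL T" "j < 9" for l j
      using sg that D[OF that(2)] by (simp add: \<xi>_def divide_inverse sgn_mult)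
    show "\<xi> (LW 1 1) 0 = 1" "\<xi> (LW 1 1) 1 = 1" "\<xi> (LW 1 1) 2 = 1"
      using W[of 0] W[of 1] W[of 2] by (simp_all add: \<xi>_def D_def)
    show "\<xi> (LR 0) 3 = - \<xi> (LR 0) 0" "\<xi> (LR 1) 4 = - \<xi> (LR 1) 1" "\<xi> (LR 2) 5 = - \<xi> (LR 2) 2"
      using W[of 0] W[of 1] W[of 2] R[of 0] R[of 1] R[of 2] by (simp_all add: \<xi>_def D_def)
    show "\<xi> (LQ 0) 6 = - \<xi> (LQ 0) 0" "\<xi> (LQ 1) 7 = - \<xi> (LQ 1) 1" "\<xi> (LQ 2) 8 = - \<xi> (LQ 2) 2"
      using W[of 0] W[of 1] W[of 2] Q[of 0] Q[of 1] Q[of 2] by (simp_all add: \<xi>_def D_def)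
  qed (use K T in auto)
  obtain c where c: "\<And>l. l \<in> polyL K \<union> doubL T \<Longrightarrow> 0 < c l \<and> (\<forall>j<9. \<xi> l j = c l * bvec K l ! j)"
    using all_rigid by metis
  have "Z l j = c l * D j * bvec K l ! j" if "l \<in> polyL K \<union> doubL T" "j < 9" for l j
    using c[OF that(1)] that(2) D[OF that(2)] by (auto simp: \<xi>_def field_simps)
  then show "\<exists>D c. (\<forall>j<9. 0 < D j) \<and> (\<forall>l\<in>polyL K \<union> doubL T. 0 < c l \<and> (\<forall>j<9. Z l j = c l * D j * bvec K l ! j))"
    using c D by blast
qed

section \<open>Number fields\<close>

lemma partial_hom_subset: "partial_hom T \<sigma> \<Longrightarrow> S \<subseteq> T \<Longrightarrow> partial_hom S \<sigma>"
  unfolding partial_hom_def by (meson subsetD)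

lemma partial_homD:
  assumes "partial_hom T \<sigma>"
  shows "a \<in> T \<Longrightarrow> b \<in> T \<Longrightarrow> a + b \<in> T \<Longrightarrow> \<sigma> (a + b) = \<sigma> a + \<sigma> b"
    "a \<in> T \<Longrightarrow> b \<in> T \<Longrightarrow> a * b \<in> T \<Longrightarrow> \<sigma> (a * b) = \<sigma> a * \<sigma> b"
    "a \<in> T \<Longrightarrow> b \<in> T \<Longrightarrow> a < b \<Longrightarrow> \<sigma> a < \<sigma> b" "\<sigma> 0 = 0" "\<sigma> 1 = 1"
  using assms unfolding partial_hom_def by blast+

lemma hom_rigid_Un: "hom_rigid S \<Longrightarrow> hom_rigid T \<Longrightarrow> hom_rigid (S \<union> T)"
  unfolding hom_rigid_def by (meson UnE UnI1 partial_hom_subset sup_ge1 sup_ge2)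

lemma hom_rigid_extend:
  assumes "hom_rigid T" "\<And>\<sigma> a. partial_hom (T \<union> S) \<sigma> \<Longrightarrow> (\<And>b. b \<in> T \<Longrightarrow> \<sigma> b = b) \<Longrightarrow> a \<in> S \<Longrightarrow> \<sigma> a = a"
  shows "hom_rigid (T \<union> S)"
  using assms unfolding hom_rigid_def by (meson UnE UnI1 partial_hom_subset sup_ge1)

text \<open>Pinning \<open>x\<close> may take auxiliary elements, which \<open>T\<close> absorbs.
  Since rigid sets are closed under union, elements can be treated one at a time.\<close>

definition rigid_in :: "real set \<Rightarrow> real \<Rightarrow> bool"
  where "rigid_in F x \<longleftrightarrow> (\<exists>T. finite T \<and> T \<subseteq> F \<and> hom_rigid T \<and> x \<in> T)"

lemma rigid_inI: "finite T \<Longrightarrow> T \<subseteq> F \<Longrightarrow> hom_rigid T \<Longrightarrow> x \<in> T \<Longrightarrow> rigid_in F x"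
  unfolding rigid_in_def by blast

lemma rigid_in_finite:
  assumes "finite Y" "\<And>x. x \<in> Y \<Longrightarrow> rigid_in F x" "{0, 1} \<subseteq> F"
  shows "\<exists>T. finite T \<and> T \<subseteq> F \<and> hom_rigid T \<and> Y \<subseteq> T"
  using assms
proof (induction Y rule: finite_induct)
  case empty
  show ?case using empty hom_rigid_01 by (intro exI[of _ "{0,1}"]) auto
next
  case (insert x Y)
  obtain S where S: "finite S" "S \<subseteq> F" "hom_rigid S" "Y \<subseteq> S" using insert by auto
  obtain T where T: "finite T" "T \<subseteq> F" "hom_rigid T" "x \<in> T"
    using insert.prems(1)[of x] unfolding rigid_in_def by blast
  show ?case using S T hom_rigid_Un[OF S(3) T(3)] by (intro exI[of _ "S \<union> T"]) auto
qed

locale real_subfield =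
  fixes F :: "real set"
  assumes zero: "0 \<in> F" and one: "1 \<in> F"
    and add: "x \<in> F \<Longrightarrow> y \<in> F \<Longrightarrow> x + y \<in> F"
    and mult: "x \<in> F \<Longrightarrow> y \<in> F \<Longrightarrow> x * y \<in> F"
    and minus: "x \<in> F \<Longrightarrow> - x \<in> F"
    and inv: "x \<in> F \<Longrightarrow> inverse x \<in> F"
begin

lemma diff: "x \<in> F \<Longrightarrow> y \<in> F \<Longrightarrow> x - y \<in> F"
  using add[of x "- y"] minus by simp

lemma div: "x \<in> F \<Longrightarrow> y \<in> F \<Longrightarrow> x / y \<in> F"
  using mult[of x "inverse y"] inv by (simp add: divide_inverse)

lemma power: "x \<in> F \<Longrightarrow> x ^ n \<in> F"
  by (induction n) (auto simp: one mult)

lemma sum: "(\<And>i. i \<in> I \<Longrightarrow> f i \<in> F) \<Longrightarrow> sum f I \<in> F"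
  by (induction I rule: infinite_finite_induct) (auto simp: zero add)

lemma of_nat: "real n \<in> F"
  by (induction n) (auto simp: zero one add)

lemma of_int: "real_of_int n \<in> F"
proof (cases n)
  case (neg k)
  then show ?thesis using minus[OF of_nat[of "Suc k"]] by simp
qed (use of_nat in auto)

lemma Rats: "\<rat> \<subseteq> F"
  by (auto elim!: Rats_cases' intro!: div of_int)

lemma rigid_01: "rigid_in F 0" "rigid_in F 1"
  using zero one hom_rigid_01 by (auto intro!: rigid_inI[of "{0,1}"])

lemma rigid_two:
  assumes "rigid_in F x" "rigid_in F y" "z \<in> F"
    and "\<And>T \<sigma>. partial_hom T \<sigma> \<Longrightarrow> 0 \<in> T \<Longrightarrow> 1 \<in> T \<Longrightarrow> x \<in> T \<Longrightarrow> y \<in> T \<Longrightarrow> z \<in> T \<Longrightarrow> \<sigma> x = x \<Longrightarrow> \<sigma> y = y \<Longrightarrow> \<sigma> z = z"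
  shows "rigid_in F z"
proof -
  obtain T where T: "finite T" "T \<subseteq> F" "hom_rigid T" "{x, y} \<subseteq> T"
    using rigid_in_finite[of "{x, y}" F] assms(1,2) zero one by auto
  have T01: "0 \<in> T" "1 \<in> T" using T(3) by (auto simp: hom_rigid_def)
  have "hom_rigid (T \<union> {z})"
  proof (rule hom_rigid_extend[OF T(3)])
    fix \<sigma> a assume "partial_hom (T \<union> {z}) \<sigma>" "\<And>b. b \<in> T \<Longrightarrow> \<sigma> b = b" "a \<in> {z}"
    then show "\<sigma> a = a" using assms(4)[of "T \<union> {z}" \<sigma>] T(4) T01 by auto
  qed
  then show ?thesis using T assms(3) by (intro rigid_inI[of "T \<union> {z}"]) auto
qed

lemma rigid_add: "rigid_in F x \<Longrightarrow> rigid_in F y \<Longrightarrow> rigid_in F (x + y)"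
proof (rule rigid_two[of x y])
  assume "rigid_in F x" "rigid_in F y"
  then show "x + y \<in> F" by (auto simp: rigid_in_def intro: add)
qed (auto simp: partial_homD(1))

lemma rigid_minus: "rigid_in F x \<Longrightarrow> rigid_in F (- x)"
proof (rule rigid_two[of x x])
  assume "rigid_in F x"
  then show "- x \<in> F" by (auto simp: rigid_in_def intro: minus)
next
  fix T \<sigma> assume "partial_hom T \<sigma>" "0 \<in> T" "x \<in> T" "- x \<in> T" "\<sigma> x = x"
  then show "\<sigma> (- x) = - x" using partial_homD(1)[of T \<sigma> x "- x"] partial_homD(4)[of T \<sigma>] by auto
qed

lemma rigid_div: "rigid_in F x \<Longrightarrow> rigid_in F y \<Longrightarrow> rigid_in F (x / y)"
proof (cases "y = 0")
  case False
  assume xy: "rigid_in F x" "rigid_in F y"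
  then have "x / y \<in> F" by (auto simp: rigid_in_def intro: div)
  then show ?thesis
  proof (rule rigid_two[OF xy])
    fix T \<sigma> assume "partial_hom T \<sigma>" "x \<in> T" "y \<in> T" "x / y \<in> T" "\<sigma> x = x" "\<sigma> y = y"
    then show "\<sigma> (x / y) = x / y" using partial_homD(2)[of T \<sigma> "x / y" y] False by (auto simp: field_simps)
  qed
qed (use rigid_01 in auto)

lemma rigid_of_int: "rigid_in F (real_of_int n)"
proof -
  have nat: "rigid_in F (real n)" for n
    by (induction n) (use rigid_01 rigid_add in \<open>auto simp: add.commute\<close>)
  show ?thesis
  proof (cases n)
    case (neg k)
    then show ?thesis using rigid_minus[OF nat[of "Suc k"]] by simp
  qed (use nat in auto)
qed

lemma rigid_Rats: "x \<in> \<rat> \<Longrightarrow> rigid_in F x"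
  by (auto elim!: Rats_cases' intro!: rigid_div rigid_of_int)

text \<open>The set \<open>S\<close> holds every intermediate result in the evaluation of
  \<open>p\<close> at \<theta>, so a partial homomorphism that fixes the coefficients maps \<theta>
  to a root of \<open>p\<close>. The rationals \<open>q\<close> and \<open>r\<close> separate
  \<theta> from all other roots, and monotonicity keeps the image between them.\<close>

lemma rigid_algebraic:
  assumes \<theta>: "\<theta> \<in> F" and p: "p \<noteq> 0" "\<And>i. Polynomial.coeff p i \<in> \<rat>" "poly p \<theta> = 0"
  shows "rigid_in F \<theta>"
proof -
  define n where "n = Polynomial.degree p"
  define Z where "Z = {x. poly p x = 0} - {\<theta>}"
  have "finite Z" using poly_roots_finite[OF p(1)] by (simp add: Z_def)
  then obtain e where e: "0 < e" "\<And>x. x \<in> Z \<Longrightarrow> e \<le> dist \<theta> x"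
    using finite_set_avoid[of Z \<theta>] unfolding Z_def by (metis DiffD2 insertI1)
  obtain q r where qr: "q \<in> \<rat>" "\<theta> - e < q" "q < \<theta>" "r \<in> \<rat>" "\<theta> < r" "r < \<theta> + e"
    using Rats_dense_in_real[of "\<theta> - e" \<theta>] Rats_dense_in_real[of \<theta> "\<theta> + e"] e(1) by auto
  have fin: "finite ({q, r} \<union> Polynomial.coeff p ` {..n})" by simp
  have rat: "rigid_in F x" if "x \<in> {q, r} \<union> Polynomial.coeff p ` {..n}" for x
    using that qr p(2) rigid_Rats by auto
  have F01: "{0, 1} \<subseteq> F" using zero one by simp
  obtain T where T: "finite T" "T \<subseteq> F" "hom_rigid T" "{q, r} \<union> Polynomial.coeff p ` {..n} \<subseteq> T"
    using rigid_in_finite[OF fin rat F01] by auto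
  define s where "s k = (\<Sum>i<k. Polynomial.coeff p i * \<theta> ^ i)" for k
  define S where "S = (\<lambda>i. \<theta> ^ i) ` {..Suc n} \<union> (\<lambda>i. Polynomial.coeff p i * \<theta> ^ i) ` {..n} \<union> s ` {..Suc n}"
  have coeffF: "Polynomial.coeff p i \<in> F" for i using p(2) Rats by blast
  have S: "finite S" "S \<subseteq> F" "\<theta> \<in> S"
    unfolding S_def s_def using \<theta> coeffF by (auto intro!: power sum mult image_eqI[of \<theta> _ 1])
  have mem: "i \<le> Suc n \<Longrightarrow> \<theta> ^ i \<in> S" "i \<le> n \<Longrightarrow> Polynomial.coeff p i * \<theta> ^ i \<in> S" "i \<le> Suc n \<Longrightarrow> s i \<in> S" for i
    by (auto simp: S_def)
  have s_end: "s (Suc n) = 0" using p(3) by (simp add: s_def poly_altdef n_def lessThan_Suc_atMost)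
  have "hom_rigid (T \<union> S)"
  proof (rule hom_rigid_extend[OF T(3)])
    fix \<sigma> a assume \<sigma>: "partial_hom (T \<union> S) \<sigma>" and id: "\<And>b. b \<in> T \<Longrightarrow> \<sigma> b = b" and a: "a \<in> S"
    have pow: "\<sigma> (\<theta> ^ i) = \<sigma> \<theta> ^ i" if "i \<le> Suc n" for i
      using that
    proof (induction i)
      case (Suc i)
      then show ?case using partial_homD(2)[OF \<sigma>, of \<theta> "\<theta> ^ i"] S(3) mem(1)[of i] mem(1)[of "Suc i"] by simp
    qed (use partial_homD(5)[OF \<sigma>] in simp)
    have mon: "\<sigma> (Polynomial.coeff p i * \<theta> ^ i) = Polynomial.coeff p i * \<sigma> \<theta> ^ i" if "i \<le> n" for i
    proof -
      have "Polynomial.coeff p i \<in> T" using T(4) that by auto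
      then show ?thesis
        using partial_homD(2)[OF \<sigma>, of "Polynomial.coeff p i" "\<theta> ^ i"] id pow[of i] that mem(1)[of i] mem(2)[of i] by simp
    qed
    have sums: "\<sigma> (s k) = (\<Sum>i<k. Polynomial.coeff p i * \<sigma> \<theta> ^ i)" if "k \<le> Suc n" for k
      using that
    proof (induction k)
      case (Suc k)
      have "s (Suc k) = s k + Polynomial.coeff p k * \<theta> ^ k" by (simp add: s_def)
      moreover have "s k \<in> S" "Polynomial.coeff p k * \<theta> ^ k \<in> S" "s (Suc k) \<in> S" using Suc.prems mem by simp_all
      ultimately show ?case using partial_homD(1)[OF \<sigma>, of "s k" "Polynomial.coeff p k * \<theta> ^ k"] Suc mon[of k] by simp
    qed (use partial_homD(4)[OF \<sigma>] in \<open>simp add: s_def\<close>)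
    have "poly p (\<sigma> \<theta>) = 0"
      using sums[of "Suc n"] s_end partial_homD(4)[OF \<sigma>]
      by (simp add: poly_altdef n_def lessThan_Suc_atMost)
    moreover have "q < \<sigma> \<theta>" "\<sigma> \<theta> < r"
      using partial_homD(3)[OF \<sigma>, of q \<theta>] partial_homD(3)[OF \<sigma>, of \<theta> r] id T(4) S(3) qr by auto
    then have "dist \<theta> (\<sigma> \<theta>) < e" using qr by (auto simp: dist_real_def)
    ultimately have \<sigma>\<theta>: "\<sigma> \<theta> = \<theta>" using e(2)[of "\<sigma> \<theta>"] by (auto simp: Z_def)
    show "\<sigma> a = a"
      using a pow mon sums \<sigma>\<theta> unfolding S_def by (auto simp: s_def)
  qed
  then show ?thesis using T S by (intro rigid_inI[of "T \<union> S"]) auto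
qed

end

section \<open>Real number fields: annihilating polynomials and generators\<close>

lemma real_ring_ops:
  "carrier real_ring = UNIV" "\<zero>\<^bsub>real_ring\<^esub> = 0" "\<one>\<^bsub>real_ring\<^esub> = 1"
  "x \<oplus>\<^bsub>real_ring\<^esub> y = x + y" "x \<otimes>\<^bsub>real_ring\<^esub> y = x * y"
  by (simp_all add: real_ring_def)

lemma subfield_real_subfield:
  assumes "subfield G real_ring"
  shows "real_subfield G"
proof
  interpret field real_ring by (rule field_real_ring)
  note sub = subringE[OF subfieldE(1)[OF assms]]
  show "0 \<in> G" "1 \<in> G" using sub(2,3) by (simp_all add: real_ring_def)
  fix x y assume x: "x \<in> G"
  show "x + y \<in> G" if "y \<in> G" using sub(7)[OF x that] by (simp add: real_ring_def)
  show "x * y \<in> G" if "y \<in> G" using sub(6)[OF x that] by (simp add: real_ring_def)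
  have "\<ominus>\<^bsub>real_ring\<^esub> x \<oplus>\<^bsub>real_ring\<^esub> x = \<zero>\<^bsub>real_ring\<^esub>" by (rule l_neg) (simp add: real_ring_def)
  then have "\<ominus>\<^bsub>real_ring\<^esub> x = - x" by (simp add: real_ring_def)
  then show "- x \<in> G" using sub(5)[OF x] by simp
  show "inverse x \<in> G"
  proof (cases "x = 0")
    case False
    then have "x \<in> G - {\<zero>\<^bsub>real_ring\<^esub>}" using x by (simp add: real_ring_def)
    from subfield_m_inv(1,2)[OF assms this]
    have "inv\<^bsub>real_ring\<^esub> x \<in> G" "x * inv\<^bsub>real_ring\<^esub> x = 1" by (simp_all add: real_ring_def)
    then show ?thesis using inverse_unique by metis
  qed (use x in simp)
qed

lemma Rats_subfield: "subfield \<rat> real_ring"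
proof -
  interpret field real_ring by (rule field_real_ring)
  show ?thesis
  proof (rule subfieldI')
    have neg: "\<ominus>\<^bsub>real_ring\<^esub> x = - x" for x
    proof -
      have "\<ominus>\<^bsub>real_ring\<^esub> x \<oplus>\<^bsub>real_ring\<^esub> x = \<zero>\<^bsub>real_ring\<^esub>" by (rule l_neg) (simp add: real_ring_def)
      then show ?thesis by (simp add: real_ring_def)
    qed
    show "subring \<rat> real_ring"
      by (rule subringI) (auto simp: neg, auto simp: real_ring_def)
    fix k assume k: "k \<in> \<rat> - {\<zero>\<^bsub>real_ring\<^esub>}"
    then have "k \<in> Units real_ring" using field_Units by (simp add: real_ring_def)
    then have "k \<otimes>\<^bsub>real_ring\<^esub> inv\<^bsub>real_ring\<^esub> k = \<one>\<^bsub>real_ring\<^esub>" by (rule Units_r_inv)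
    then have "inv\<^bsub>real_ring\<^esub> k = inverse k" using inverse_unique by (metis monoid.select_convs(1,2) real_ring_def)
    then show "inv\<^bsub>real_ring\<^esub> k \<in> \<rat>" using k by simp
  qed
qed

lemma algebraic_poly:
  assumes "subfield F real_ring" "ring.finite_dimension real_ring \<rat> F" "\<theta> \<in> F"
  obtains p where "p \<noteq> 0" "\<And>i. Polynomial.coeff p i \<in> \<rat>" "poly p \<theta> = 0"
proof -
  interpret field real_ring by (rule field_real_ring)
  have "(algebraic over \<rat>) \<theta>"
    using finite_dimension_imp_algebraic[OF Rats_subfield subfieldE(1)[OF assms(1)] assms(2,3)] .
  then obtain q where q: "q \<in> carrier (\<rat>[X]\<^bsub>real_ring\<^esub>)" "q \<noteq> []" "eval q \<theta> = \<zero>\<^bsub>real_ring\<^esub>"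
    using algebraicE[OF subfieldE(1)[OF Rats_subfield], of \<theta>] by (auto simp: real_ring_ops)
  have q': "set q \<subseteq> \<rat>" "hd q \<noteq> 0" using q(1,2) by (auto simp: univ_poly_def polynomial_def real_ring_ops)
  have pow: "x [^]\<^bsub>real_ring\<^esub> n = x ^ n" for x :: real and n :: nat
    by (induction n) (auto simp: real_ring_ops mult.commute)
  \<comment> \<open>In \<open>eval\<close> the leading coefficient comes first, in
    \<open>Poly\<close> the constant term; hence the reversal.\<close>
  have ev: "eval l x = poly (Poly (rev l)) x" for l x
  proof (induction l)
    case (Cons a l)
    have "eval (a # l) x = a * x ^ length l + eval l x"
      unfolding eval.simps pow by (simp add: real_ring_ops)
    then show ?case using Cons by (simp add: Poly_append poly_monom)
  qed (simp add: real_ring_ops)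
  show thesis
  proof (rule that[of "Poly (rev q)"])
    show "poly (Poly (rev q)) \<theta> = 0" using q(3) ev by (simp add: real_ring_ops)
    show "Polynomial.coeff (Poly (rev q)) i \<in> \<rat>" for i
    proof -
      have "i < length (rev q) \<Longrightarrow> rev q ! i \<in> set q" by (metis nth_mem set_rev)
      then show ?thesis using q'(1) by (auto simp: coeff_Poly_eq nth_default_def)
    qed
    have "Polynomial.coeff (Poly (rev q)) (length q - 1) = hd q"
      using q(2) by (simp add: coeff_Poly_eq nth_default_def rev_nth hd_conv_nth)
    then show "Poly (rev q) \<noteq> 0" using q'(2) by (metis Polynomial.coeff_0)
  qed
qed

text \<open>\<open>B\<close> is a spanning list over \<rat>; every real subfield contains \<rat> and
  therefore all combinations.\<close>

lemma finitely_generated: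
  assumes "ring.finite_dimension real_ring \<rat> F"
  obtains B where "finite B" "B \<subseteq> F" "\<And>G. real_subfield G \<Longrightarrow> B \<subseteq> G \<Longrightarrow> F \<subseteq> G"
proof -
  interpret field real_ring by (rule field_real_ring)
  obtain n where "dimension n \<rat> F" using assms by (rule finite_dimensionE')
  then obtain Us where Us: "set Us \<subseteq> carrier real_ring" "Span \<rat> Us = F"
    using exists_base[OF Rats_subfield] by blast
  have "Span \<rat> Vs \<subseteq> G" if "real_subfield G" "set Vs \<subseteq> G" for G Vs
    using that(2)
  proof (induction Vs)
    case (Cons v Vs)
    interpret real_subfield G by fact
    have "x \<in> G" if "x \<in> line_extension \<rat> v (Span \<rat> Vs)" for x
    proof -
      have "\<exists>k\<in>\<rat>. \<exists>e\<in>Span \<rat> Vs. x = k \<otimes>\<^bsub>real_ring\<^esub> v \<oplus>\<^bsub>real_ring\<^esub> e"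
        using that by (simp only: line_extension_mem_iff)
      then obtain k e where ke: "k \<in> \<rat>" "e \<in> Span \<rat> Vs" "x = k * v + e"
        by (elim bexE) (simp only: real_ring_ops)
      have "k * v + e \<in> G"
      proof (rule add[OF mult])
        show "k \<in> G" using ke(1) Rats by (rule rev_subsetD)
        show "v \<in> G" using Cons.prems by simp
        show "e \<in> G" using Cons.IH Cons.prems ke(2) by (metis set_subset_Cons subset_trans subsetD)
      qed
      then show ?thesis using ke(3) by simp
    qed
    then show ?case by (metis Span.simps comp_apply foldr.simps(2) subsetI)
  qed (use real_subfield.zero[OF that(1)] in \<open>simp add: real_ring_ops\<close>)
  moreover have "set Us \<subseteq> F"
    using Span_base_incl[OF Rats_subfield Us(1)] Us(2) by simp
  ultimately show thesis using that[of "set Us"] Us by auto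
qed

lemma exists_hom_rigid:
  assumes "subfield F real_ring" "ring.finite_dimension real_ring \<rat> F"
  obtains T where "finite T" "T \<subseteq> F" "hom_rigid T" "2 \<in> T" "\<And>G. real_subfield G \<Longrightarrow> T \<subseteq> G \<Longrightarrow> F \<subseteq> G"
proof -
  interpret real_subfield F using subfield_real_subfield[OF assms(1)] .
  obtain B where B: "finite B" "B \<subseteq> F" "\<And>G. real_subfield G \<Longrightarrow> B \<subseteq> G \<Longrightarrow> F \<subseteq> G"
    using finitely_generated[OF assms(2)] by blast
  have "rigid_in F x" if "x \<in> B \<union> {2}" for x
  proof -
    have "x \<in> F" using that B(2) of_nat[of 2] by auto
    then show ?thesis using algebraic_poly[OF assms, of x] rigid_algebraic by metis
  qed
  then obtain T where T: "finite T" "T \<subseteq> F" "hom_rigid T" "B \<union> {2} \<subseteq> T"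
    using rigid_in_finite[of "B \<union> {2}" F] B(1) zero one by auto
  then show thesis using that[of T] B(3) by blast
qed

section \<open>Linear forms and faces\<close>

abbreviation lk :: "rvec \<Rightarrow> nat \<Rightarrow> real"
  where "lk \<equiv> Poly_Mapping.lookup"

lemma lookup_scaleR: "lk (c *\<^sub>R x) i = c * lk (x :: rvec) i"
proof -
  have "finite {i. c *\<^sub>R lk x i \<noteq> 0}"
    by (rule finite_subset[OF _ finite_lookup[of x]]) auto
  then show ?thesis by (simp add: scaleR_poly_mapping_def Abs_poly_mapping_inverse)
qed

lemma linear_lookup: "linear (\<lambda>x :: rvec. lk x i)"
  by (rule linearI) (simp_all add: lookup_add lookup_scaleR)

lemma coord_space_iff: "x \<in> coord_space m \<longleftrightarrow> (\<forall>i\<ge>m. lk x i = 0)"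
  by (auto simp: coord_space_def in_keys_iff subset_iff not_less[symmetric] dest: leD)

lemma subspace_coord_space: "subspace (coord_space m)"
  by (auto simp: subspace_def coord_space_iff lookup_add lookup_scaleR)

definition cvec :: "nat \<Rightarrow> (nat \<Rightarrow> real) \<Rightarrow> rvec"
  where "cvec m f = (\<Sum>i<m. f i *\<^sub>R Poly_Mapping.single i 1)"

lemma lookup_cvec: "lk (cvec m f) i = (if i < m then f i else 0)"
proof -
  have "lk (cvec m f) i = (\<Sum>j<m. if j = i then f i else 0)"
    unfolding cvec_def lookup_sum by (rule sum.cong) (auto simp: lookup_scaleR lookup_single when_def)
  then show ?thesis by (simp add: sum.delta)
qed

lemma cvec_in: "cvec m f \<in> coord_space m"
  by (simp add: coord_space_iff lookup_cvec)

lemma cvec_lookup: "x \<in> coord_space m \<Longrightarrow> cvec m (lk x) = x"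
  by (rule poly_mapping_eqI) (auto simp: lookup_cvec coord_space_iff not_less)

section \<open>Dual bases in the coordinate subspaces\<close>

lemma dual_independent:
  fixes b :: "nat \<Rightarrow> 'a::real_vector" and G :: "nat \<Rightarrow> 'a \<Rightarrow> real"
  assumes "\<And>i. i < M \<Longrightarrow> linear (G i)"
    and "\<And>i j. i < M \<Longrightarrow> j < M \<Longrightarrow> G i (b j) = (if i = j then 1 else 0)"
  shows "inj_on b {..<M}" "independent (b ` {..<M})"
proof -
  show inj: "inj_on b {..<M}"
    by (rule inj_onI) (metis assms(2) lessThan_iff zero_neq_one)
  show "independent (b ` {..<M})"
  proof
    assume "dependent (b ` {..<M})"
    then obtain u where u: "\<exists>v\<in>b ` {..<M}. u v \<noteq> 0" "(\<Sum>v\<in>b ` {..<M}. u v *\<^sub>R v) = 0"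
      by (auto simp: dependent_finite)
    then have s: "(\<Sum>j<M. u (b j) *\<^sub>R b j) = 0" by (simp add: sum.reindex[OF inj])
    have "u (b i) = 0" if "i < M" for i
    proof -
      have "G i (\<Sum>j<M. u (b j) *\<^sub>R b j) = (\<Sum>j<M. u (b j) * G i (b j))"
        by (simp add: linear_sum[OF assms(1)[OF that]] linear_cmul[OF assms(1)[OF that]])
      also have "\<dots> = (\<Sum>j<M. if j = i then u (b i) else 0)"
        using that by (intro sum.cong) (auto simp: assms(2))
      finally show ?thesis using that s linear_0[OF assms(1)[OF that]] by simp
    qed
    then show False using u(1) by auto
  qed
qed

lemma span_unit: "span ((\<lambda>i. Poly_Mapping.single i 1) ` {..<m}) = coord_space m"
proof
  show "span ((\<lambda>i. Poly_Mapping.single i 1) ` {..<m}) \<subseteq> coord_space m"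
    by (rule span_minimal[OF _ subspace_coord_space]) (auto simp: coord_space_iff lookup_single)
  show "coord_space m \<subseteq> span ((\<lambda>i. Poly_Mapping.single i 1) ` {..<m})"
  proof
    fix x assume "x \<in> coord_space m"
    then have "x = (\<Sum>i<m. lk x i *\<^sub>R Poly_Mapping.single i 1)"
      using cvec_lookup by (simp add: cvec_def)
    also have "\<dots> \<in> span ((\<lambda>i. Poly_Mapping.single i 1) ` {..<m})"
      by (intro span_sum span_scale span_base) auto
    finally show "x \<in> span ((\<lambda>i. Poly_Mapping.single i 1) ` {..<m})" .
  qed
qed

lemma dim_coord_space: "dim (coord_space m) = m"
proof -
  have *: "inj_on (\<lambda>i. Poly_Mapping.single i (1::real)) {..<m}" "independent ((\<lambda>i. Poly_Mapping.single i (1::real)) ` {..<m})"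
    by (rule dual_independent[of m "\<lambda>i x. lk x i"];
        simp add: linear_lookup lookup_single when_def eq_commute)+
  have "dim (coord_space m) = card ((\<lambda>i. Poly_Mapping.single i (1::real)) ` {..<m})"
    by (rule dim_eq_card[OF _ *(2)]) (metis span_unit span_eq_iff subspace_coord_space)
  then show ?thesis using card_image[OF *(1)] by simp
qed

lemma independent_spans_coord_space:
  assumes "independent B" "B \<subseteq> coord_space m" "card B = m" "finite B"
  shows "span B = coord_space m"
proof
  show "span B \<subseteq> coord_space m" by (rule span_minimal[OF assms(2) subspace_coord_space])
  show "coord_space m \<subseteq> span B"
  proof
    fix v assume v: "v \<in> coord_space m"
    show "v \<in> span B"
    proof (rule ccontr)
      assume nv: "v \<notin> span B"
      then have "independent (insert v B)" using assms(1) by (simp add: independent_insertI)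
      moreover have "insert v B \<subseteq> span ((\<lambda>i. Poly_Mapping.single i 1) ` {..<m})"
        using v assms(2) span_unit by auto
      ultimately have "card (insert v B) \<le> card ((\<lambda>i. Poly_Mapping.single i (1::real)) ` {..<m})"
        using independent_span_bound[of "(\<lambda>i. Poly_Mapping.single i (1::real)) ` {..<m}"] by blast
      moreover have "v \<notin> B" using nv span_base by blast
      ultimately show False using assms(3,4) card_image_le[of "{..<m}" "\<lambda>i. Poly_Mapping.single i (1::real)"] by simp
    qed
  qed
qed

lemma dual_expansion:
  assumes lin: "\<And>i. i < M \<Longrightarrow> linear (G i :: rvec \<Rightarrow> real)"
    and dual: "\<And>i j. i < M \<Longrightarrow> j < M \<Longrightarrow> G i (b j) = (if i = j then 1 else 0)"
    and b: "\<And>j. j < M \<Longrightarrow> b j \<in> coord_space M" and v: "v \<in> coord_space M"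
  shows "v = (\<Sum>j<M. G j v *\<^sub>R b j)"
proof -
  note di = dual_independent[OF lin dual]
  have "span (b ` {..<M}) = coord_space M"
    by (rule independent_spans_coord_space) (use di b in \<open>auto simp: card_image\<close>)
  then obtain u where "v = (\<Sum>w\<in>b ` {..<M}. u w *\<^sub>R w)"
    using v span_finite[of "b ` {..<M}"] by auto
  then have u: "v = (\<Sum>j<M. u (b j) *\<^sub>R b j)" by (simp add: sum.reindex[OF di(1)])
  have "G i v = u (b i)" if "i < M" for i
  proof -
    have "G i v = (\<Sum>j<M. u (b j) * G i (b j))"
      unfolding u by (simp add: linear_sum[OF lin[OF that]] linear_cmul[OF lin[OF that]])
    also have "\<dots> = (\<Sum>j<M. if j = i then u (b i) else 0)"
      using that by (intro sum.cong) (auto simp: dual)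
    finally show ?thesis using that by simp
  qed
  then show ?thesis using u by simp
qed

text \<open>Elimination, one vector at a time. The invariant concerns all forms \<open>G i\<close>
  with \<open>i < M\<close>, not only the first \<open>n\<close>: by \<open>up\<close>, the later
  forms already vanish on \<open>z n\<close>, and its values on the earlier ones are
  subtracted.\<close>

lemma triangular_dual_basis:
  fixes G :: "nat \<Rightarrow> 'a::real_vector \<Rightarrow> real"
  assumes lin: "\<And>i. i < M \<Longrightarrow> linear (G i)"
    and up: "\<And>i j. j < i \<Longrightarrow> i < M \<Longrightarrow> G i (z j) = 0"
    and diag: "\<And>i. i < M \<Longrightarrow> G i (z i) \<noteq> 0"
    and S: "subspace S" "\<And>j. j < M \<Longrightarrow> z j \<in> S"
  obtains b where "\<And>i j. i < M \<Longrightarrow> j < M \<Longrightarrow> G i (b j) = (if i = j then 1 else 0)" "\<And>j. j < M \<Longrightarrow> b j \<in> S"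
proof -
  have "\<exists>b. (\<forall>i<M. \<forall>j<n. G i (b j) = (if i = j then 1 else 0)) \<and> (\<forall>j<n. b j \<in> S)" if "n \<le> M" for n
    using that
  proof (induction n)
    case (Suc n)
    then obtain b where b: "\<And>i j. i < M \<Longrightarrow> j < n \<Longrightarrow> G i (b j) = (if i = j then 1 else 0)" "\<And>j. j < n \<Longrightarrow> b j \<in> S"
      by auto
    have n: "n < M" using Suc.prems by simp
    define w where "w = inverse (G n (z n)) *\<^sub>R (z n - (\<Sum>i<n. G i (z n) *\<^sub>R b i))"
    have "w \<in> S" unfolding w_def using S b(2) n
      by (intro subspace_scale[OF S(1)] subspace_diff[OF S(1)] subspace_sum[OF S(1)]) auto
    moreover have "G i w = (if i = n then 1 else 0)" if "i < M" for i
    proof -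
      have "(\<Sum>k<n. G k (z n) * G i (b k)) = (\<Sum>k<n. if k = i then G i (z n) else 0)"
        using that by (intro sum.cong) (auto simp: b(1))
      then have "G i w = inverse (G n (z n)) * (G i (z n) - (if i < n then G i (z n) else 0))"
        unfolding w_def by (simp add: linear_cmul[OF lin[OF that]] linear_diff[OF lin[OF that]] linear_sum[OF lin[OF that]])
      then show ?thesis using up[of n i] diag[OF n] that by (cases i n rule: linorder_cases) auto
    qed
    ultimately show ?case using b by (intro exI[of _ "b(n := w)"]) (auto simp: less_Suc_eq)
  qed auto
  from this[OF order_refl] show thesis using that by blast
qed

section \<open>Alternatives for linear inequalities and exposed faces\<close>

lemma exists_functional:
  fixes z :: "'a::real_vector"
  assumes "z \<noteq> 0"
  obtains h where "linear h" "h z = (1::real)"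
  using linear_independent_extend[of "{z}" "\<lambda>_. 1::real"] assms by auto

text \<open>Gordan's theorem, by projecting along one vector \<open>y n\<close>. A form that is
  positive on the projections is tilted slightly by \<open>h\<close> to become positive at
  \<open>y n\<close>. A dependency of the projections gives a combination equal to \<open>c\<close>
  times \<open>y n\<close>. For \<open>c \<le> 0\<close> it is completed by the weight
  \<open>- c\<close>; for \<open>c > 0\<close> any form positive on the other vectors is positive at
  \<open>y n\<close> too, so the alternative for those vectors decides.\<close>

lemma gordan:
  fixes y :: "'i \<Rightarrow> 'a::real_vector"
  assumes "finite I"
  shows "(\<exists>f :: 'a \<Rightarrow> real. linear f \<and> (\<forall>i\<in>I. 0 < f (y i))) \<or>
    (\<exists>w. (\<forall>i\<in>I. 0 \<le> w i) \<and> (\<exists>i\<in>I. 0 < w i) \<and> (\<Sum>i\<in>I. w i *\<^sub>R y i) = 0)"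
  using assms
proof (induction I arbitrary: y rule: finite_induct)
  case empty
  then show ?case by (auto intro: exI[of _ "\<lambda>_. 0"] linear_zero)
next
  case (insert n I)
  show ?case
  proof (cases "y n = 0")
    case True
    have "(\<Sum>i\<in>insert n I. (if i = n then 1 else 0) *\<^sub>R y i) = 0"
      using True by (intro sum.neutral) auto
    then show ?thesis by (intro disjI2 exI[of _ "\<lambda>i. if i = n then 1 else 0"]) auto
  next
    case False
    then obtain h where h: "linear h" "h (y n) = (1::real)" by (rule exists_functional)
    define pr where "pr x = x - h x *\<^sub>R y n" for x
    have pr: "linear pr" unfolding pr_def
      by (intro linearI) (simp_all add: linear_add[OF h(1)] linear_cmul[OF h(1)] algebra_simps)
    have prn: "pr (y n) = 0" by (simp add: pr_def h)
    from insert.IH[of "\<lambda>i. pr (y i)"] show ?thesis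
    proof (elim disjE exE conjE)
      fix f :: "'a \<Rightarrow> real" assume f: "linear f" "\<forall>i\<in>I. 0 < f (pr (y i))"
      \<comment> \<open>Small enough that \<open>e * h\<close> cannot outweigh any
        \<open>f (pr (y i))\<close>: \<open>1 +\<close> keeps the denominators nonzero, the inserted
        1 covers empty \<open>I\<close>, and the half makes the bound strict.\<close>
      define e where "e = Min (insert 1 ((\<lambda>i. f (pr (y i)) / (1 + \<bar>h (y i)\<bar>)) ` I)) / 2"
      have "0 < Min (insert 1 ((\<lambda>i. f (pr (y i)) / (1 + \<bar>h (y i)\<bar>)) ` I))"
        using f(2) insert.hyps(1) by (subst Min_gr_iff) auto
      then have e: "0 < e" by (simp add: e_def)
      have ei: "0 < f (pr (y i)) + e * h (y i)" if "i \<in> I" for i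
      proof -
        have "Min (insert 1 ((\<lambda>i. f (pr (y i)) / (1 + \<bar>h (y i)\<bar>)) ` I)) \<le> f (pr (y i)) / (1 + \<bar>h (y i)\<bar>)"
          using that insert.hyps(1) by (intro Min_le) auto
        then have "e < f (pr (y i)) / (1 + \<bar>h (y i)\<bar>)" using e unfolding e_def by linarith
        then have "e * (1 + \<bar>h (y i)\<bar>) < f (pr (y i))" by (simp add: field_simps)
        moreover have "- (e * h (y i)) \<le> e * \<bar>h (y i)\<bar>" using e by (metis abs_ge_minus_self abs_mult abs_of_pos)
        ultimately show ?thesis using e by (simp add: algebra_simps)
      qed
      define g where "g x = f (pr x) + e * h x" for x
      have "linear g" unfolding g_def
        by (intro linearI) (simp_all add: linear_add[OF h(1)] linear_cmul[OF h(1)] linear_add[OF pr] linear_cmul[OF pr]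
            linear_add[OF f(1)] linear_cmul[OF f(1)] algebra_simps)
      moreover have "\<forall>i\<in>insert n I. 0 < g (y i)"
        using ei e by (auto simp: g_def prn h linear_0[OF f(1)])
      ultimately show ?thesis by blast
    next
      fix w assume w: "\<forall>i\<in>I. 0 \<le> w i" "\<exists>i\<in>I. 0 < w i" "(\<Sum>i\<in>I. w i *\<^sub>R pr (y i)) = 0"
      define c where "c = h (\<Sum>i\<in>I. w i *\<^sub>R y i)"
      have "pr (\<Sum>i\<in>I. w i *\<^sub>R y i) = 0"
        using w(3) by (simp add: linear_sum[OF pr] linear_cmul[OF pr])
      then have c: "(\<Sum>i\<in>I. w i *\<^sub>R y i) = c *\<^sub>R y n" by (simp add: pr_def c_def)
      show ?thesis
      proof (cases "c \<le> 0")
        case True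
        let ?w = "w(n := - c)"
        have "(\<Sum>i\<in>I. ?w i *\<^sub>R y i) = (\<Sum>i\<in>I. w i *\<^sub>R y i)"
          using insert.hyps by (intro sum.cong) auto
        then have "(\<Sum>i\<in>insert n I. ?w i *\<^sub>R y i) = 0" using insert.hyps c by simp
        moreover have "\<forall>i\<in>insert n I. 0 \<le> ?w i" "\<exists>i\<in>insert n I. 0 < ?w i" using w True insert.hyps by auto
        ultimately show ?thesis by blast
      next
        case False
        from insert.IH[of y] show ?thesis
        proof (elim disjE exE conjE)
          fix f :: "'a \<Rightarrow> real" assume f: "linear f" "\<forall>i\<in>I. 0 < f (y i)"
          obtain k where k: "k \<in> I" "0 < w k" using w(2) by blast
          have "0 < (\<Sum>i\<in>I. w i * f (y i))"
            using f(2) w(1) k insert.hyps(1) by (intro sum_pos2[of I k]) (auto intro: less_imp_le)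
          also have "\<dots> = f (c *\<^sub>R y n)"
            unfolding c[symmetric] by (simp add: linear_sum[OF f(1)] linear_cmul[OF f(1)])
          finally have "0 < f (y n)" using False by (simp add: linear_cmul[OF f(1)] zero_less_mult_iff)
          then show ?thesis using f by blast
        next
          fix v assume v: "\<forall>i\<in>I. 0 \<le> v i" "\<exists>i\<in>I. 0 < v i" "(\<Sum>i\<in>I. v i *\<^sub>R y i) = 0"
          let ?w = "v(n := 0)"
          have "(\<Sum>i\<in>I. ?w i *\<^sub>R y i) = (\<Sum>i\<in>I. v i *\<^sub>R y i)"
            using insert.hyps by (intro sum.cong) auto
          then have "(\<Sum>i\<in>insert n I. ?w i *\<^sub>R y i) = 0" using insert.hyps v(3) by simp
          moreover have "\<forall>i\<in>insert n I. 0 \<le> ?w i" "\<exists>i\<in>insert n I. 0 < ?w i" using v insert.hyps by auto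
          ultimately show ?thesis by blast
        qed
      qed
    qed
  qed
qed

text \<open>Equality constraints are removed by projecting along their vectors. Such a vector may
  enter the dependency with either sign, so its weight \<open>- c\<close> closes the relation in
  every case.\<close>

lemma gordan_lineality:
  fixes y :: "'i \<Rightarrow> 'a::real_vector"
  assumes "finite Z" "finite I" "Z \<inter> I = {}"
  shows "(\<exists>f :: 'a \<Rightarrow> real. linear f \<and> (\<forall>i\<in>Z. f (y i) = 0) \<and> (\<forall>i\<in>I. 0 < f (y i))) \<or>
    (\<exists>w. (\<forall>i\<in>I. 0 \<le> w i) \<and> (\<exists>i\<in>I. 0 < w i) \<and> (\<Sum>i\<in>Z \<union> I. w i *\<^sub>R y i) = 0)"
  using assms(1,3)
proof (induction Z arbitrary: y rule: finite_induct)
  case empty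
  then show ?case using gordan[OF assms(2), of y] by auto
next
  case (insert n Z)
  obtain h where h: "linear h" "y n \<noteq> 0 \<Longrightarrow> h (y n) = (1::real)"
  proof (cases "y n = 0")
    case True
    then show thesis using that[of "\<lambda>_. 0"] linear_zero by auto
  qed (use exists_functional that in metis)
  define pr where "pr x = x - h x *\<^sub>R y n" for x
  have pr: "linear pr" unfolding pr_def
    by (intro linearI) (simp_all add: linear_add[OF h(1)] linear_cmul[OF h(1)] algebra_simps)
  have prn: "pr (y n) = 0" using h(2) by (cases "y n = 0") (auto simp: pr_def)
  have "Z \<inter> I = {}" using insert.prems by auto
  from insert.IH[of "\<lambda>i. pr (y i)", OF this] show ?case
  proof (elim disjE exE conjE)
    fix f :: "'a \<Rightarrow> real" assume f: "linear f" "\<forall>i\<in>Z. f (pr (y i)) = 0" "\<forall>i\<in>I. 0 < f (pr (y i))"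
    then have "linear (f \<circ> pr) \<and> (\<forall>i\<in>insert n Z. (f \<circ> pr) (y i) = 0) \<and> (\<forall>i\<in>I. 0 < (f \<circ> pr) (y i))"
      using prn linear_compose[OF pr f(1)] linear_0[OF f(1)] by simp
    then show ?thesis by blast
  next
    fix w assume w: "\<forall>i\<in>I. 0 \<le> w i" "\<exists>i\<in>I. 0 < w i" "(\<Sum>i\<in>Z \<union> I. w i *\<^sub>R pr (y i)) = 0"
    define c where "c = h (\<Sum>i\<in>Z \<union> I. w i *\<^sub>R y i)"
    have "pr (\<Sum>i\<in>Z \<union> I. w i *\<^sub>R y i) = 0"
      using w(3) by (simp add: linear_sum[OF pr] linear_cmul[OF pr])
    then have c: "(\<Sum>i\<in>Z \<union> I. w i *\<^sub>R y i) = c *\<^sub>R y n" by (simp add: pr_def c_def)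
    have n: "n \<notin> Z \<union> I" using insert by auto
    let ?w = "w(n := - c)"
    have "(\<Sum>i\<in>Z \<union> I. ?w i *\<^sub>R y i) = (\<Sum>i\<in>Z \<union> I. w i *\<^sub>R y i)"
      using n by (intro sum.cong) auto
    then have "(\<Sum>i\<in>insert n Z \<union> I. ?w i *\<^sub>R y i) = 0" using insert.hyps(1) assms(2) n c by simp
    moreover have "\<forall>i\<in>I. 0 \<le> ?w i" "\<exists>i\<in>I. 0 < ?w i" using w n by auto
    ultimately show ?thesis by blast
  qed
qed

text \<open>The point lies on the segment from \<open>y k\<close> to the normalized rest
  \<open>q\<close> of the combination, in its interior unless a degenerate case makes it equal to
  \<open>y k\<close>.\<close>

lemma face_of_convex_sum:
  fixes y :: "'i \<Rightarrow> 'a::real_vector"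
  assumes T: "T face_of S" and S: "convex S" and fin: "finite I" and y: "\<And>i. i \<in> I \<Longrightarrow> y i \<in> S"
    and w: "\<And>i. i \<in> I \<Longrightarrow> 0 \<le> w i" "sum w I = 1" and p: "(\<Sum>i\<in>I. w i *\<^sub>R y i) \<in> T"
    and k: "k \<in> I" "0 < w k"
  shows "y k \<in> T"
proof -
  have split: "sum w (I - {k}) = 1 - w k" "(\<Sum>i\<in>I. w i *\<^sub>R y i) = w k *\<^sub>R y k + (\<Sum>i\<in>I - {k}. w i *\<^sub>R y i)"
    using w(2) fin k(1) by (simp_all add: sum.remove)
  have le: "w k \<le> 1" using split(1) w(1) by (metis DiffD1 diff_ge_0_iff_ge sum_nonneg)
  show ?thesis
  proof (cases "w k = 1")
    case True
    then have "sum w (I - {k}) = 0" using split by simp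
    then have "\<forall>i\<in>I - {k}. w i = 0" using fin w(1) by (subst (asm) sum_nonneg_eq_0_iff) auto
    then have "(\<Sum>i\<in>I. w i *\<^sub>R y i) = y k" using split(2) True by simp
    then show ?thesis using p by simp
  next
    case False
    then have lt: "w k < 1" using le by simp
    define q where "q = (\<Sum>i\<in>I - {k}. (w i / (1 - w k)) *\<^sub>R y i)"
    have q: "q \<in> S" unfolding q_def
      by (rule convex_sum[OF _ S]) (use fin w lt y split(1) in \<open>auto simp: sum_divide_distrib[symmetric]\<close>)
    have pq: "(\<Sum>i\<in>I. w i *\<^sub>R y i) = w k *\<^sub>R y k + (1 - w k) *\<^sub>R q"
      unfolding split(2) q_def using lt by (simp add: scaleR_sum_right)
    show ?thesis
    proof (cases "y k = q")
      case True
      then have "(\<Sum>i\<in>I. w i *\<^sub>R y i) = y k" unfolding pq by (simp add: algebra_simps)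
      then show ?thesis using p by simp
    next
      case False
      then have "(\<Sum>i\<in>I. w i *\<^sub>R y i) \<in> open_segment q (y k)"
        using pq k(2) lt by (auto simp: in_segment intro!: exI[of _ "w k"])
      then show ?thesis using T p q y[OF k(1)] unfolding face_of_def by blast
    qed
  qed
qed

text \<open>A family may repeat points, so the weights are placed on an index set \<open>J\<close>
  on which \<open>y\<close> is injective.\<close>

lemma convex_hull_family:
  fixes y :: "'i \<Rightarrow> 'a::real_vector"
  assumes "finite I" "p \<in> convex hull (y ` I)"
  obtains w where "\<And>i. i \<in> I \<Longrightarrow> 0 \<le> w i" "sum w I = 1" "p = (\<Sum>i\<in>I. w i *\<^sub>R y i)"
proof -
  obtain J where J: "J \<subseteq> I" "inj_on y J" "y ` J = y ` I" by (metis subset_image_inj subset_refl)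
  have fJ: "finite J" using J(1) assms(1) finite_subset by blast
  obtain u where u: "\<forall>x\<in>y ` J. 0 \<le> u x" "sum u (y ` J) = 1" "(\<Sum>x\<in>y ` J. u x *\<^sub>R x) = p"
    using assms(2) unfolding J(3)[symmetric] convex_hull_finite[OF finite_imageI[OF fJ]] by blast
  define w where "w i = (if i \<in> J then u (y i) else 0)" for i
  have "sum w I = sum w J" "(\<Sum>i\<in>I. w i *\<^sub>R y i) = (\<Sum>i\<in>J. w i *\<^sub>R y i)"
    using assms(1) J(1) by (intro sum.mono_neutral_right; auto simp: w_def)+
  then show thesis
    using that[of w] u J(2) by (auto simp: w_def sum.reindex)
qed

text \<open>Faces of polytopes are exposed. Otherwise the alternative yields a dependency whose
  negative part lives on the generators in \<open>T\<close> while its positive part charges some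
  generator outside. The form \<open>om\<close> gives both parts the same total \<open>s\<close>, so
  after division they represent one point; it lies in \<open>T\<close> by the negative part, and the
  face property then forces the outside generator into \<open>T\<close>.\<close>

lemma face_functional:
  fixes y :: "'i \<Rightarrow> 'a::real_vector"
  assumes fin: "finite I" and om: "linear (om :: 'a \<Rightarrow> real)" "\<And>i. i \<in> I \<Longrightarrow> om (y i) = 1"
    and T: "T face_of convex hull (y ` I)"
  obtains f :: "'a \<Rightarrow> real" where "linear f" "\<And>i. i \<in> I \<Longrightarrow> 0 \<le> f (y i)" "\<And>i. i \<in> I \<Longrightarrow> f (y i) = 0 \<longleftrightarrow> y i \<in> T"
proof -
  define Z where "Z = {i \<in> I. y i \<in> T}"
  have Z: "finite Z" "finite (I - Z)" "Z \<inter> (I - Z) = {}" "Z \<union> (I - Z) = I" "Z \<subseteq> I" using fin by (auto simp: Z_def)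
  have "\<not> (\<exists>w. (\<forall>i\<in>I - Z. 0 \<le> w i) \<and> (\<exists>i\<in>I - Z. 0 < w i) \<and> (\<Sum>i\<in>Z \<union> (I - Z). w i *\<^sub>R y i) = 0)"
  proof
    assume "\<exists>w. (\<forall>i\<in>I - Z. 0 \<le> w i) \<and> (\<exists>i\<in>I - Z. 0 < w i) \<and> (\<Sum>i\<in>Z \<union> (I - Z). w i *\<^sub>R y i) = 0"
    then obtain w k where w: "\<forall>i\<in>I - Z. 0 \<le> w i" "k \<in> I - Z" "0 < w k" "(\<Sum>i\<in>I. w i *\<^sub>R y i) = 0"
      using Z(4) by auto
    define u v where "u i = max (w i) 0" and "v i = max (- w i) 0" for i
    have wuv: "w i = u i - v i" for i by (auto simp: u_def v_def)
    have nn: "0 \<le> u i" "0 \<le> v i" for i by (auto simp: u_def v_def)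
    have v0: "v i = 0" if "i \<in> I - Z" for i using w(1) that by (auto simp: v_def)
    have eq: "(\<Sum>i\<in>I. u i *\<^sub>R y i) = (\<Sum>i\<in>I. v i *\<^sub>R y i)"
      using w(4) by (simp add: wuv scaleR_diff_left sum_subtractf)
    have "om (\<Sum>i\<in>I. u i *\<^sub>R y i) = sum u I" "om (\<Sum>i\<in>I. v i *\<^sub>R y i) = sum v I"
      by (simp_all add: linear_sum[OF om(1)] linear_cmul[OF om(1)] om(2))
    then have s: "sum u I = sum v I" using eq by simp
    have "0 < sum u I" using fin w(2,3) nn by (intro sum_pos2[of I k]) (auto simp: u_def)
    define s where "s = sum u I"
    have s0: "0 < s" "sum v I = s" using s \<open>0 < sum u I\<close> by (auto simp: s_def)
    have vZ: "sum v Z = s" "(\<Sum>i\<in>I. v i *\<^sub>R y i) = (\<Sum>i\<in>Z. v i *\<^sub>R y i)"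
      using s0(2) v0 fin Z(5) by (auto intro!: sum.mono_neutral_right simp: sum.mono_neutral_right[of I Z v])
    have cT: "convex T" using T by (simp add: face_of_def)
    have "(\<Sum>i\<in>Z. (v i / s) *\<^sub>R y i) \<in> T"
      by (rule convex_sum[OF Z(1) cT]) (use vZ s0 nn in \<open>auto simp: Z_def sum_divide_distrib[symmetric]\<close>)
    moreover have "(\<Sum>i\<in>Z. (v i / s) *\<^sub>R y i) = (1 / s) *\<^sub>R (\<Sum>i\<in>Z. v i *\<^sub>R y i)"
      by (simp add: scaleR_sum_right)
    moreover have "(1 / s) *\<^sub>R (\<Sum>i\<in>I. u i *\<^sub>R y i) = (\<Sum>i\<in>I. (u i / s) *\<^sub>R y i)"
      by (simp add: scaleR_sum_right)
    ultimately have mem: "(\<Sum>i\<in>I. (u i / s) *\<^sub>R y i) \<in> T" using eq vZ(2) by simp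
    have "y k \<in> T"
    proof (rule face_of_convex_sum[OF T convex_convex_hull fin _ _ _ mem])
      show "y i \<in> convex hull (y ` I)" if "i \<in> I" for i using that by (simp add: hull_inc)
      show "0 \<le> u i / s" for i using nn s0 by simp
      show "(\<Sum>i\<in>I. u i / s) = 1" using s0 by (simp add: sum_divide_distrib[symmetric] s_def)
      show "k \<in> I" "0 < u k / s" using w s0 by (auto simp: u_def)
    qed
    then show False using w(2) by (auto simp: Z_def)
  qed
  then obtain f :: "'a \<Rightarrow> real" where f: "linear f" "\<forall>i\<in>Z. f (y i) = 0" "\<forall>i\<in>I - Z. 0 < f (y i)"
    using gordan_lineality[OF Z(1-3), of y] by blast
  show thesis
  proof (rule that[OF f(1)])
    fix i assume "i \<in> I"
    then have i: "i \<in> Z \<and> y i \<in> T \<or> i \<in> I - Z \<and> y i \<notin> T" by (auto simp: Z_def)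
    show "0 \<le> f (y i)"
      using i
    proof
      assume "i \<in> Z \<and> y i \<in> T"
      then show ?thesis using f(2) by simp
    next
      assume "i \<in> I - Z \<and> y i \<notin> T"
      then have "0 < f (y i)" using f(3) by blast
      then show ?thesis by simp
    qed
    show "f (y i) = 0 \<longleftrightarrow> y i \<in> T"
      using i
    proof
      assume "i \<in> Z \<and> y i \<in> T"
      then show ?thesis using f(2) by simp
    next
      assume a: "i \<in> I - Z \<and> y i \<notin> T"
      then have "0 < f (y i)" using f(3) by blast
      then show ?thesis using a by simp
    qed
  qed
qed

lemma exposed_face:
  fixes f :: "'a::real_vector \<Rightarrow> real"
  assumes "linear f" "convex S" "\<And>x. x \<in> S \<Longrightarrow> 0 \<le> f x"
  shows "{x \<in> S. f x = 0} face_of S"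
proof -
  have "convex {x \<in> S. f x = 0}"
    using assms(2) unfolding convex_def by (auto simp: linear_add[OF assms(1)] linear_cmul[OF assms(1)])
  moreover have "f a = 0 \<and> f b = 0" if ab: "a \<in> S" "b \<in> S" "x \<in> open_segment a b" "f x = 0" for a b x
  proof -
    obtain u where u: "0 < u" "u < 1" "x = (1 - u) *\<^sub>R a + u *\<^sub>R b" using ab(3) by (auto simp: in_segment)
    have "(1 - u) * f a + u * f b = 0" using ab(4) u(3) by (simp add: linear_add[OF assms(1)] linear_cmul[OF assms(1)])
    moreover have "0 \<le> (1 - u) * f a" "0 \<le> u * f b" using u assms(3) ab by auto
    ultimately have "(1 - u) * f a = 0" "u * f b = 0" by linarith+
    then show ?thesis using u by simp
  qed
  ultimately show ?thesis unfolding face_of_def by blast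
qed

text \<open>A generating set that is minimal under inclusion contains only extreme points.\<close>

lemma polytope_extreme_points:
  fixes D :: "'a::real_vector set"
  assumes "polytope D"
  obtains W where "finite W" "D = convex hull W" "\<And>w. w \<in> W \<Longrightarrow> w extreme_point_of D"
proof -
  obtain V where V: "finite V" "D = convex hull V" using assms by (auto simp: polytope_def)
  have "\<exists>W\<subseteq>V. D = convex hull W \<and> (\<forall>U. U \<subset> W \<longrightarrow> D \<noteq> convex hull U)"
    using V
  proof (induction "card V" arbitrary: V rule: less_induct)
    case less
    show ?case
    proof (cases "\<exists>U. U \<subset> V \<and> D = convex hull U")
      case True
      then obtain U where U: "U \<subset> V" "D = convex hull U" by blast
      then have "card U < card V" "finite U" using less.prems(1) by (auto simp: psubset_card_mono finite_subset)
      then show ?thesis using less.hyps[of U] U by blast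
    qed (use less.prems in blast)
  qed
  then obtain W where W: "W \<subseteq> V" "D = convex hull W" "\<And>U. U \<subset> W \<Longrightarrow> D \<noteq> convex hull U" by blast
  have fW: "finite W" using W(1) V(1) finite_subset by blast
  have "w extreme_point_of D" if "w \<in> W" for w
  proof -
    have ins: "insert w (W - {w}) = W" using that by auto
    have "w \<notin> convex hull (W - {w})"
    proof
      assume "w \<in> convex hull (W - {w})"
      then have "convex hull (insert w (W - {w})) = convex hull (W - {w})" by (rule hull_redundant)
      then show False using W(2) W(3)[of "W - {w}"] that ins by auto
    qed
    then show ?thesis using extreme_point_of_convex_hull_insert[of "W - {w}" w] fW ins W(2) by simp
  qed
  then show thesis using that fW W(2) by blast
qed

section \<open>Polytopes in the hemisphere\<close>

definition hplane :: "nat \<Rightarrow> rvec set"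
  where "hplane d = {x \<in> coord_space (Suc d). lk x d = 1}"

text \<open>The inverse of \<open>homog d\<close>: central projection of the hyperplane
  \<open>hplane d\<close> back to the sphere.\<close>

definition nrm :: "nat \<Rightarrow> rvec \<Rightarrow> rvec"
  where "nrm d x = inverse (sqrt (\<Sum>i\<le>d. (lk x i)\<^sup>2)) *\<^sub>R x"

lemma sumsq_pos:
  assumes "lk (x :: rvec) d \<noteq> 0"
  shows "0 < (\<Sum>i\<le>d. (lk x i)\<^sup>2)"
  by (rule sum_pos2[of "{..d}" d]) (use assms in auto)

lemma homog_in_hplane: "p \<in> upper_hemisphere d \<Longrightarrow> homog d p \<in> hplane d"
  by (auto simp: upper_hemisphere_def unit_sphere_def hplane_def homog_def lookup_scaleR
      intro: subspace_scale[OF subspace_coord_space])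

lemma nrm_in_hemisphere:
  assumes "x \<in> hplane d"
  shows "nrm d x \<in> upper_hemisphere d" "homog d (nrm d x) = x"
proof -
  define s where "s = sqrt (\<Sum>i\<le>d. (lk x i)\<^sup>2)"
  have x: "x \<in> coord_space (Suc d)" "lk x d = 1" using assms by (auto simp: hplane_def)
  have sum: "0 < (\<Sum>i\<le>d. (lk x i)\<^sup>2)" using sumsq_pos[of x d] x by simp
  then have s: "0 < s" "s\<^sup>2 = (\<Sum>i\<le>d. (lk x i)\<^sup>2)" by (simp_all add: s_def)
  have n: "nrm d x = inverse s *\<^sub>R x" by (simp add: nrm_def s_def)
  have "(\<Sum>i\<le>d. (lk (nrm d x) i)\<^sup>2) = (inverse s)\<^sup>2 * s\<^sup>2"
    unfolding n s(2) by (simp add: lookup_scaleR power_mult_distrib sum_distrib_left)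
  also have "\<dots> = 1" using s(1) by (simp add: power_inverse)
  finally show "nrm d x \<in> upper_hemisphere d"
    using x s(1) unfolding upper_hemisphere_def unit_sphere_def
    by (auto simp: n lookup_scaleR intro: subspace_scale[OF subspace_coord_space])
  show "homog d (nrm d x) = x" using s(1) x(2) by (simp add: n homog_def lookup_scaleR)
qed

lemma nrm_homog:
  assumes "p \<in> upper_hemisphere d"
  shows "nrm d (homog d p) = p"
proof -
  have p: "0 < lk p d" "(\<Sum>i\<le>d. (lk p i)\<^sup>2) = 1"
    using assms by (auto simp: upper_hemisphere_def unit_sphere_def)
  have "(\<Sum>i\<le>d. (lk (homog d p) i)\<^sup>2) = (inverse (lk p d))\<^sup>2 * 1"
    unfolding p(2)[symmetric] by (simp add: homog_def lookup_scaleR power_mult_distrib sum_distrib_left)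
  then show ?thesis using p(1) by (simp add: nrm_def homog_def real_sqrt_abs)
qed

lemma inj_on_homog: "inj_on (homog d) (upper_hemisphere d)"
  by (metis inj_on_inverseI nrm_homog)

definition sph_of :: "nat \<Rightarrow> rvec set \<Rightarrow> rvec set"
  where "sph_of d C = nrm d ` C"

lemma sph_of:
  assumes "C \<subseteq> hplane d"
  shows "sph_of d C \<subseteq> upper_hemisphere d" "homog d ` sph_of d C = C"
  using assms nrm_in_hemisphere by (force simp: sph_of_def image_iff)+

lemma sph_faces_iff:
  assumes "P \<subseteq> upper_hemisphere d"
  shows "T \<in> sph_faces d P \<longleftrightarrow> (\<exists>S. S face_of homog d ` P \<and> T = sph_of d S)"
proof
  assume T: "T \<in> sph_faces d P"
  then have "T = sph_of d (homog d ` T)"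
    using assms nrm_homog by (force simp: sph_faces_def sph_of_def image_image)
  then show "\<exists>S. S face_of homog d ` P \<and> T = sph_of d S" using T by (auto simp: sph_faces_def)
next
  assume "\<exists>S. S face_of homog d ` P \<and> T = sph_of d S"
  then obtain S where S: "S face_of homog d ` P" "T = sph_of d S" by blast
  have sub: "S \<subseteq> homog d ` P" using S(1) by (rule face_of_imp_subset)
  then have "S \<subseteq> hplane d" using assms homog_in_hplane by blast
  moreover have "T \<subseteq> P" using sub assms nrm_homog unfolding S(2) sph_of_def by (auto simp: subset_iff)
  ultimately show "T \<in> sph_faces d P" using S sph_of by (simp add: sph_faces_def)
qed

lemma sph_faces_singleton:
  assumes "P \<subseteq> upper_hemisphere d" "v \<in> sph_vertices d P"
  shows "{v} \<in> sph_faces d P"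
  using assms by (auto simp: sph_vertices_def sph_faces_def face_of_singleton)

lemma sph_face_has_vertex:
  assumes Q: "sph_polytope d Q" and T: "T \<in> sph_faces d Q" "T \<noteq> {}"
  obtains v where "v \<in> sph_vertices d Q" "v \<in> T"
proof -
  have pt: "polytope (homog d ` Q)" and hs: "Q \<subseteq> upper_hemisphere d" using Q by (auto simp: sph_polytope_def)
  obtain W where W: "finite W" "homog d ` Q = convex hull W" "\<And>w. w \<in> W \<Longrightarrow> w extreme_point_of homog d ` Q"
    using polytope_extreme_points[OF pt] by blast
  have face: "homog d ` T face_of convex hull W" and TQ: "T \<subseteq> Q" using T(1) W(2) by (auto simp: sph_faces_def)
  obtain t where t: "t \<in> T" using T(2) by blast
  then have "homog d t \<in> convex hull W" using TQ W(2) by blast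
  then obtain u where u: "\<And>i. i \<in> W \<Longrightarrow> 0 \<le> u i" "sum u W = 1" "homog d t = (\<Sum>i\<in>W. u i *\<^sub>R i)"
    using convex_hull_family[of W "homog d t" "\<lambda>w. w"] W(1) by auto
  obtain k where k: "k \<in> W" "0 < u k"
    using u(1,2) W(1) by (metis less_eq_real_def sum.neutral zero_neq_one)
  have mem: "(\<Sum>i\<in>W. u i *\<^sub>R i) \<in> homog d ` T" using u(3) t by (metis imageI)
  have "k \<in> homog d ` T"
    by (rule face_of_convex_sum[OF face convex_convex_hull W(1) _ u(1,2) mem k]) (auto simp: hull_inc)
  then obtain v where "v \<in> T" "k = homog d v" by blast
  then show thesis using that[of v] TQ W(3)[OF k(1)] by (auto simp: sph_vertices_def)
qed

lemma proj_mapsI: "A x = c *\<^sub>R y \<Longrightarrow> c \<noteq> 0 \<Longrightarrow> proj_maps A x y"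
  unfolding proj_maps_def by blast

text \<open>Vertices are the minimal nonempty faces: every nonempty face contains one, and an order
  isomorphism respects emptiness and minimality.\<close>

lemma face_lattice_iso_vertex:
  assumes P: "sph_polytope d P" and Q: "sph_polytope d Q" and iso: "face_lattice_iso d P Q \<phi>"
  shows "v \<in> sph_vertices d P \<Longrightarrow> \<exists>w\<in>sph_vertices d Q. \<phi> {v} = {w}"
    and "w \<in> sph_vertices d Q \<Longrightarrow> \<exists>v\<in>sph_vertices d P. \<phi> {v} = {w}"
proof -
  have hs: "P \<subseteq> upper_hemisphere d" "Q \<subseteq> upper_hemisphere d" using P Q by (auto simp: sph_polytope_def)
  have bij: "bij_betw \<phi> (sph_faces d P) (sph_faces d Q)"
    and ord: "\<And>S T. S \<in> sph_faces d P \<Longrightarrow> T \<in> sph_faces d P \<Longrightarrow> S \<subseteq> T \<longleftrightarrow> \<phi> S \<subseteq> \<phi> T"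
    using iso by (auto simp: face_lattice_iso_def)
  have emp: "{} \<in> sph_faces d P" "{} \<in> sph_faces d Q" by (auto simp: sph_faces_def)
  obtain S0 where S0: "S0 \<in> sph_faces d P" "\<phi> S0 = {}" using bij emp(2) by (metis bij_betw_iff_bijections)
  have pre: "\<exists>S\<in>sph_faces d P. S \<noteq> {} \<and> \<phi> S = {w}" if w: "w \<in> sph_vertices d Q" for w
  proof -
    obtain S where S: "S \<in> sph_faces d P" "\<phi> S = {w}"
      using bij sph_faces_singleton[OF hs(2) w] by (metis bij_betw_iff_bijections)
    have "S \<noteq> {}"
    proof
      assume "S = {}"
      then have "\<phi> S \<subseteq> \<phi> S0" using ord[OF S(1) S0(1)] by blast
      then show False using S(2) S0(2) by simp
    qed
    then show ?thesis using S by blast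
  qed
  show fwd: "\<exists>w\<in>sph_vertices d Q. \<phi> {v} = {w}" if v: "v \<in> sph_vertices d P" for v
  proof -
    have vP: "{v} \<in> sph_faces d P" using sph_faces_singleton[OF hs(1) v] .
    have \<phi>v: "\<phi> {v} \<in> sph_faces d Q" using bij vP bij_betwE by blast
    have "\<phi> {v} \<noteq> {}"
    proof
      assume "\<phi> {v} = {}"
      then have "\<phi> {v} \<subseteq> \<phi> {}" by simp
      then show False using ord[OF vP emp(1)] by blast
    qed
    then obtain w where w: "w \<in> sph_vertices d Q" "w \<in> \<phi> {v}" using sph_face_has_vertex[OF Q \<phi>v] by blast
    obtain S where S: "S \<in> sph_faces d P" "S \<noteq> {}" "\<phi> S = {w}" using pre[OF w(1)] by blast
    have "S \<subseteq> {v}" using ord[OF S(1) vP] S(3) w(2) by simp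
    then have "S = {v}" using S(2) by blast
    then show ?thesis using S w by auto
  qed
  show "\<exists>v\<in>sph_vertices d P. \<phi> {v} = {w}" if w: "w \<in> sph_vertices d Q"
  proof -
    obtain S where S: "S \<in> sph_faces d P" "S \<noteq> {}" "\<phi> S = {w}" using pre[OF w] by blast
    obtain v where v: "v \<in> sph_vertices d P" "v \<in> S" using sph_face_has_vertex[OF P S(1,2)] by blast
    then have "\<phi> {v} \<subseteq> {w}" using ord[OF sph_faces_singleton[OF hs(1) v(1)] S(1)] S(3) by simp
    moreover obtain w' where "\<phi> {v} = {w'}" using fwd[OF v(1)] by blast
    ultimately show ?thesis using v(1) by auto
  qed
qed

text \<open>
  Face lattices are only used through sign patterns of linear forms: a nonnegative form on the
  vertices of \<open>P\<close> cuts out a face, and every face of \<open>Q\<close> is cut out by such a form.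
\<close>

locale vertex_family =
  fixes d :: nat and I :: "'i set" and x :: "'i \<Rightarrow> rvec"
  assumes fin: "finite I"
    and x_in: "\<And>i. i \<in> I \<Longrightarrow> x i \<in> coord_space (Suc d)"
    and x_pos: "\<And>i. i \<in> I \<Longrightarrow> 0 < lk (x i) d"
    and exposed: "\<And>i. i \<in> I \<Longrightarrow> \<exists>f :: rvec \<Rightarrow> real. linear f \<and> f (x i) = 0 \<and> (\<forall>j\<in>I. j \<noteq> i \<longrightarrow> 0 < f (x j))"
begin

definition xh :: "'i \<Rightarrow> rvec" where "xh i = homog d (x i)"
definition Cv :: "rvec set" where "Cv = convex hull (xh ` I)"
definition Pol :: "rvec set" where "Pol = sph_of d Cv"

lemma convex_hplane: "convex (hplane d)"
  unfolding hplane_def convex_def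
  by (auto simp: lookup_add lookup_scaleR intro: subspace_add[OF subspace_coord_space] subspace_scale[OF subspace_coord_space])

lemma xh_in: "i \<in> I \<Longrightarrow> xh i \<in> hplane d"
  using x_in[of i] x_pos[of i]
  by (auto simp: xh_def hplane_def homog_def lookup_scaleR intro: subspace_scale[OF subspace_coord_space])

lemma Cv_sub: "Cv \<subseteq> hplane d"
  unfolding Cv_def by (rule hull_minimal) (use xh_in convex_hplane in auto)

lemma Pol_sub: "Pol \<subseteq> upper_hemisphere d" and homog_Pol: "homog d ` Pol = Cv"
  using sph_of[OF Cv_sub] by (auto simp: Pol_def)

lemma sph_polytope_Pol: "sph_polytope d Pol"
  using Pol_sub homog_Pol fin by (auto simp: sph_polytope_def polytope_def Cv_def)

lemma sgn_xh: assumes "linear (f :: rvec \<Rightarrow> real)" "i \<in> I" shows "sgn (f (xh i)) = sgn (f (x i))"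
  using x_pos[OF assms(2)] by (simp add: xh_def homog_def linear_cmul[OF assms(1)] sgn_mult)

lemma nonneg_Cv:
  assumes "linear (f :: rvec \<Rightarrow> real)" "\<And>i. i \<in> I \<Longrightarrow> 0 \<le> f (xh i)" "y \<in> Cv"
  shows "0 \<le> f y"
proof -
  obtain w where w: "\<And>i. i \<in> I \<Longrightarrow> 0 \<le> w i" "y = (\<Sum>i\<in>I. w i *\<^sub>R xh i)"
    using convex_hull_family[OF fin assms(3)[unfolded Cv_def]] by metis
  show ?thesis unfolding w(2) using w(1) assms(2)
    by (simp add: linear_sum[OF assms(1)] linear_cmul[OF assms(1)] sum_nonneg)
qed

lemma extreme_xh: assumes "i \<in> I" shows "xh i extreme_point_of Cv"
proof -
  obtain f :: "rvec \<Rightarrow> real" where f: "linear f" "f (x i) = 0" "\<And>j. j \<in> I \<Longrightarrow> j \<noteq> i \<Longrightarrow> 0 < f (x j)"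
    using exposed[OF assms] by blast
  have fX: "f (xh i) = 0" "\<And>j. j \<in> I \<Longrightarrow> j \<noteq> i \<Longrightarrow> 0 < f (xh j)"
    using sgn_eqD(1)[OF sgn_xh[OF f(1) assms]] sgn_eqD(2)[OF sgn_xh[OF f(1)]] f(2,3) by blast+
  have nn: "0 \<le> f (xh j)" if "j \<in> I" for j using fX that by (cases "j = i") (auto intro: less_imp_le)
  have "{y \<in> Cv. f y = 0} = {xh i}"
  proof (intro equalityI subsetI)
    fix y assume "y \<in> {y \<in> Cv. f y = 0}"
    then have y: "y \<in> Cv" "f y = 0" by auto
    obtain w where w: "\<And>j. j \<in> I \<Longrightarrow> 0 \<le> w j" "sum w I = 1" "y = (\<Sum>j\<in>I. w j *\<^sub>R xh j)"
      using convex_hull_family[OF fin y(1)[unfolded Cv_def]] by metis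
    have "(\<Sum>j\<in>I. w j * f (xh j)) = 0"
      using y(2) unfolding w(3) by (simp add: linear_sum[OF f(1)] linear_cmul[OF f(1)])
    then have "\<forall>j\<in>I. w j * f (xh j) = 0" using fin w(1) nn by (subst (asm) sum_nonneg_eq_0_iff) auto
    then have w0: "w j = 0" if "j \<in> I" "j \<noteq> i" for j using fX(2)[OF that] that by fastforce
    then have "sum w I = w i" using fin assms by (simp add: sum.remove[of I i])
    moreover have "y = w i *\<^sub>R xh i" using w0 fin assms unfolding w(3) by (simp add: sum.remove[of I i])
    ultimately show "y \<in> {xh i}" using w(2) by simp
  next
    fix y assume "y \<in> {xh i}"
    then show "y \<in> {y \<in> Cv. f y = 0}" using fX(1) assms by (auto simp: Cv_def hull_inc)
  qed
  then show ?thesis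
    using exposed_face[OF f(1), of Cv] nonneg_Cv[OF f(1) nn] unfolding face_of_singleton[symmetric]
    by (metis convex_convex_hull Cv_def)
qed

lemma inj_xh: "inj_on xh I"
proof (rule inj_onI, rule ccontr)
  fix i j assume ij: "i \<in> I" "j \<in> I" "xh i = xh j" "i \<noteq> j"
  obtain f :: "rvec \<Rightarrow> real" where f: "linear f" "f (x i) = 0" "0 < f (x j)"
    using exposed[OF ij(1)] ij(2,4) by metis
  then show False using sgn_xh[OF f(1) ij(1)] sgn_xh[OF f(1) ij(2)] ij(3) by auto
qed

definition vt :: "'i \<Rightarrow> rvec" where "vt i = nrm d (xh i)"

lemma homog_vt: "i \<in> I \<Longrightarrow> homog d (vt i) = xh i"
  using nrm_in_hemisphere xh_in by (simp add: vt_def)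

lemma vt_in: "i \<in> I \<Longrightarrow> vt i \<in> Pol"
  by (auto simp: Pol_def sph_of_def vt_def Cv_def hull_inc)

lemma vertices: "sph_vertices d Pol = vt ` I"
proof (intro equalityI subsetI)
  fix v assume v: "v \<in> sph_vertices d Pol"
  then have "homog d v extreme_point_of convex hull (xh ` I)" by (simp add: sph_vertices_def homog_Pol Cv_def)
  then obtain i where i: "i \<in> I" "homog d v = xh i" using extreme_point_of_convex_hull by blast
  have "v \<in> upper_hemisphere d" using v Pol_sub by (auto simp: sph_vertices_def)
  then have "v = vt i" using nrm_homog i by (metis vt_def)
  then show "v \<in> vt ` I" using i by blast
next
  fix v assume "v \<in> vt ` I"
  then show "v \<in> sph_vertices d Pol"
    using vt_in homog_vt extreme_xh by (auto simp: sph_vertices_def homog_Pol)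
qed

lemma card_vertices: "card (sph_vertices d Pol) = card I"
proof -
  have "inj_on vt I" using inj_xh homog_vt by (metis inj_on_def)
  then show ?thesis by (simp add: vertices card_image)
qed

lemma vertex_coords:
  assumes "\<And>i j. i \<in> I \<Longrightarrow> j \<le> d \<Longrightarrow> lk (x i) j \<in> F"
    and "\<And>a b. a \<in> F \<Longrightarrow> b \<in> F \<Longrightarrow> a / b \<in> F"
  shows "vertex_coords_in d Pol F"
  unfolding vertex_coords_in_def vertices
proof (intro ballI allI impI)
  fix v j assume "v \<in> vt ` I" "j \<le> d"
  then obtain i where i: "i \<in> I" "v = vt i" by blast
  have "lk (homog d v) j = lk (x i) j / lk (x i) d"
    unfolding i(2) homog_vt[OF i(1)] by (simp add: xh_def homog_def lookup_scaleR divide_inverse mult.commute)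
  then show "lk (homog d v) j \<in> F" using assms i(1) \<open>j \<le> d\<close> by simp
qed

lemma dim_Pol:
  assumes "coord_space (Suc d) \<subseteq> span (x ` I)"
  shows "dim Pol = Suc d"
proof -
  have "span Pol = coord_space (Suc d)"
  proof
    show "span Pol \<subseteq> coord_space (Suc d)"
      by (rule span_minimal[OF _ subspace_coord_space])
        (use Pol_sub in \<open>auto simp: upper_hemisphere_def unit_sphere_def\<close>)
    have "x i \<in> span Pol" if i: "i \<in> I" for i
    proof -
      have "x i = lk (x i) d *\<^sub>R xh i" using x_pos[OF i] by (simp add: xh_def homog_def)
      also have "xh i = inverse (lk (vt i) d) *\<^sub>R vt i" using homog_vt[OF i] by (simp add: homog_def)
      finally have "x i = lk (x i) d *\<^sub>R inverse (lk (vt i) d) *\<^sub>R vt i" .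
      then show ?thesis using vt_in[OF i] by (metis span_base span_scale)
    qed
    then have "span (x ` I) \<subseteq> span Pol" by (intro span_minimal subspace_span) auto
    then show "coord_space (Suc d) \<subseteq> span Pol" using assms by blast
  qed
  then show ?thesis by (metis dim_coord_space dim_span)
qed

text \<open>Incidence of a vertex with a face is an inclusion of faces, which \<phi> preserves. The
  face cut out by \<open>f\<close> thus goes to a face through exactly the matching vertices
  \<open>q i\<close>, and \<open>g\<close> exposes that face.\<close>

lemma realization_signs:
  assumes Q: "sph_polytope d Q" and iso: "face_lattice_iso d Pol Q \<phi>"
  obtains q where "\<And>i. i \<in> I \<Longrightarrow> q i \<in> sph_vertices d Q" "\<And>i. i \<in> I \<Longrightarrow> \<phi> {vt i} = {q i}"
    "homog d ` Q = convex hull ((\<lambda>i. homog d (q i)) ` I)"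
    "\<And>f :: rvec \<Rightarrow> real. linear f \<Longrightarrow> (\<And>i. i \<in> I \<Longrightarrow> 0 \<le> f (x i)) \<Longrightarrow>
      \<exists>g :: rvec \<Rightarrow> real. linear g \<and> (\<forall>i\<in>I. 0 \<le> g (homog d (q i)) \<and> (g (homog d (q i)) = 0 \<longleftrightarrow> f (x i) = 0))"
proof -
  have hs: "Q \<subseteq> upper_hemisphere d" using Q by (simp add: sph_polytope_def)
  have ord: "\<And>S T. S \<in> sph_faces d Pol \<Longrightarrow> T \<in> sph_faces d Pol \<Longrightarrow> S \<subseteq> T \<longleftrightarrow> \<phi> S \<subseteq> \<phi> T"
    and \<phi>in: "\<And>S. S \<in> sph_faces d Pol \<Longrightarrow> \<phi> S \<in> sph_faces d Q"
    using iso by (auto simp: face_lattice_iso_def bij_betw_def)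
  have "\<exists>w\<in>sph_vertices d Q. \<phi> {vt i} = {w}" if "i \<in> I" for i
    using face_lattice_iso_vertex(1)[OF sph_polytope_Pol Q iso, of "vt i"] that vertices by blast
  then obtain q where q: "\<And>i. i \<in> I \<Longrightarrow> q i \<in> sph_vertices d Q" "\<And>i. i \<in> I \<Longrightarrow> \<phi> {vt i} = {q i}" by metis
  have hullQ: "homog d ` Q = convex hull ((\<lambda>i. homog d (q i)) ` I)"
  proof
    obtain W where W: "finite W" "homog d ` Q = convex hull W" "\<And>w. w \<in> W \<Longrightarrow> w extreme_point_of homog d ` Q"
      using polytope_extreme_points Q sph_polytope_def by metis
    have "w \<in> (\<lambda>i. homog d (q i)) ` I" if "w \<in> W" for w
    proof -
      have "w \<in> homog d ` Q" using W(3)[OF that] by (simp add: extreme_point_of_def)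
      then obtain v where v: "v \<in> Q" "w = homog d v" by blast
      then have vQ: "v \<in> sph_vertices d Q" using W(3)[OF that] by (simp add: sph_vertices_def)
      obtain u where u: "u \<in> sph_vertices d Pol" "\<phi> {u} = {v}"
        using face_lattice_iso_vertex(2)[OF sph_polytope_Pol Q iso vQ] by blast
      obtain i where i: "i \<in> I" "u = vt i" using u(1) vertices by auto
      then have "q i = v" using q(2)[OF i(1)] u(2) by simp
      then show ?thesis using i(1) v(2) by (intro image_eqI[of _ _ i]) auto
    qed
    then show "homog d ` Q \<subseteq> convex hull ((\<lambda>i. homog d (q i)) ` I)" unfolding W(2) by (intro hull_mono) auto
    have "convex (homog d ` Q)" unfolding W(2) by (rule convex_convex_hull)
    then show "convex hull ((\<lambda>i. homog d (q i)) ` I) \<subseteq> homog d ` Q"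
      using q(1) by (intro hull_minimal) (auto simp: sph_vertices_def)
  qed
  show thesis
  proof (rule that[OF q hullQ])
    fix f :: "rvec \<Rightarrow> real" assume f: "linear f" "\<And>i. i \<in> I \<Longrightarrow> 0 \<le> f (x i)"
    have fX: "0 \<le> f (xh i)" "f (xh i) = 0 \<longleftrightarrow> f (x i) = 0" if "i \<in> I" for i
      using sgn_xh[OF f(1) that] f(2)[OF that] x_pos[OF that] by (auto simp: xh_def homog_def linear_cmul[OF f(1)])
    define S where "S = sph_of d {y \<in> Cv. f y = 0}"
    have fc: "{y \<in> Cv. f y = 0} face_of Cv"
      using exposed_face[OF f(1), of Cv] nonneg_Cv[OF f(1) fX(1)] by (simp add: Cv_def)
    have S: "S \<in> sph_faces d Pol"
      unfolding sph_faces_iff[OF Pol_sub] homog_Pol S_def by (rule exI[of _ "{y \<in> Cv. f y = 0}"]) (use fc in simp)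
    have pS: "vt i \<in> S \<longleftrightarrow> f (x i) = 0" if "i \<in> I" for i
    proof -
      have Xh: "xh i \<in> Cv" using that by (simp add: Cv_def hull_inc)
      have "vt i \<in> S \<longleftrightarrow> xh i \<in> {y \<in> Cv. f y = 0}"
      proof
        assume "vt i \<in> S"
        then obtain y where y: "y \<in> Cv" "f y = 0" "vt i = nrm d y" by (auto simp: S_def sph_of_def)
        then have "xh i = y" using homog_vt[OF that] nrm_in_hemisphere(2) Cv_sub by (metis subsetD)
        then show "xh i \<in> {y \<in> Cv. f y = 0}" using y by simp
      qed (auto simp: S_def sph_of_def vt_def)
      then show ?thesis using Xh fX(2)[OF that] by simp
    qed
    have face: "homog d ` \<phi> S face_of convex hull ((\<lambda>i. homog d (q i)) ` I)" and SQ: "\<phi> S \<subseteq> Q"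
      using \<phi>in[OF S] hullQ by (auto simp: sph_faces_def)
    have hom: "lk (homog d (q i)) d = 1" if "i \<in> I" for i
      using q(1)[OF that] hs homog_in_hplane by (auto simp: sph_vertices_def hplane_def)
    obtain g :: "rvec \<Rightarrow> real" where g: "linear g" "\<And>i. i \<in> I \<Longrightarrow> 0 \<le> g (homog d (q i))"
      "\<And>i. i \<in> I \<Longrightarrow> g (homog d (q i)) = 0 \<longleftrightarrow> homog d (q i) \<in> homog d ` \<phi> S"
      using face_functional[OF fin linear_lookup hom face] by blast
    have "homog d (q i) \<in> homog d ` \<phi> S \<longleftrightarrow> f (x i) = 0" if i: "i \<in> I" for i
    proof -
      have "q i \<in> Q" using q(1)[OF i] by (simp add: sph_vertices_def)
      then have "homog d (q i) \<in> homog d ` \<phi> S \<longleftrightarrow> q i \<in> \<phi> S"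
        using inj_on_image_mem_iff[OF inj_on_homog[of d], of "q i" "\<phi> S"] hs SQ by auto
      also have "\<dots> \<longleftrightarrow> \<phi> {vt i} \<subseteq> \<phi> S" using q(2)[OF i] by simp
      also have "\<dots> \<longleftrightarrow> {vt i} \<subseteq> S"
        using ord[OF sph_faces_singleton[OF Pol_sub, of "vt i"] S] vertices i by simp
      finally show ?thesis using pS[OF i] by simp
    qed
    then show "\<exists>g :: rvec \<Rightarrow> real. linear g \<and> (\<forall>i\<in>I. 0 \<le> g (homog d (q i)) \<and> (g (homog d (q i)) = 0 \<longleftrightarrow> f (x i) = 0))"
      using g by blast
  qed
qed

end

text \<open>Here \<open>rigid\<close> reduces projective uniqueness to linear algebra:
  \<open>y\<close> is any family of vectors with the transfer property. The factors \<open>c\<close>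
  are positive so that convex combinations go to convex combinations up to scale.\<close>

locale rigid_vertex_family = vertex_family +
  assumes rigid: "\<And>y. (\<And>i. i \<in> I \<Longrightarrow> y i \<in> coord_space (Suc d)) \<Longrightarrow>
    (\<And>f :: rvec \<Rightarrow> real. linear f \<Longrightarrow> (\<And>i. i \<in> I \<Longrightarrow> 0 \<le> f (x i)) \<Longrightarrow>
      \<exists>g :: rvec \<Rightarrow> real. linear g \<and> (\<forall>i\<in>I. 0 \<le> g (y i) \<and> (g (y i) = 0 \<longleftrightarrow> f (x i) = 0))) \<Longrightarrow>
    \<exists>A c. linear_automorphism (Suc d) A \<and> (\<forall>i\<in>I. 0 < c i \<and> A (x i) = c i *\<^sub>R y i)"
begin

lemma realization:
  assumes Q: "sph_polytope d Q" and iso: "face_lattice_iso d Pol Q \<phi>"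
  obtains q A c where "\<And>i. i \<in> I \<Longrightarrow> q i \<in> sph_vertices d Q" "\<And>i. i \<in> I \<Longrightarrow> \<phi> {vt i} = {q i}"
    "homog d ` Q = convex hull ((\<lambda>i. homog d (q i)) ` I)" "linear_automorphism (Suc d) A"
    "\<And>i. i \<in> I \<Longrightarrow> 0 < c i" "\<And>i. i \<in> I \<Longrightarrow> A (x i) = c i *\<^sub>R homog d (q i)"
proof -
  obtain q where q: "\<And>i. i \<in> I \<Longrightarrow> q i \<in> sph_vertices d Q" "\<And>i. i \<in> I \<Longrightarrow> \<phi> {vt i} = {q i}"
    "homog d ` Q = convex hull ((\<lambda>i. homog d (q i)) ` I)"
    "\<And>f :: rvec \<Rightarrow> real. linear f \<Longrightarrow> (\<And>i. i \<in> I \<Longrightarrow> 0 \<le> f (x i)) \<Longrightarrow>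
      \<exists>g :: rvec \<Rightarrow> real. linear g \<and> (\<forall>i\<in>I. 0 \<le> g (homog d (q i)) \<and> (g (homog d (q i)) = 0 \<longleftrightarrow> f (x i) = 0))"
    using realization_signs[OF Q iso] by blast
  have "homog d (q i) \<in> coord_space (Suc d)" if "i \<in> I" for i
    using q(1)[OF that] Q homog_in_hplane by (auto simp: sph_vertices_def sph_polytope_def hplane_def)
  from rigid[OF this q(4)] show thesis using that q(1-3) by blast
qed

lemma projectively_unique_Pol: "projectively_unique d Pol"
  unfolding projectively_unique_def
proof (intro allI impI, elim conjE)
  fix Q \<phi> assume Q: "sph_polytope d Q" and iso: "face_lattice_iso d Pol Q \<phi>"
  obtain q A c where q: "\<And>i. i \<in> I \<Longrightarrow> q i \<in> sph_vertices d Q" "\<And>i. i \<in> I \<Longrightarrow> \<phi> {vt i} = {q i}"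
    "homog d ` Q = convex hull ((\<lambda>i. homog d (q i)) ` I)" and A: "linear_automorphism (Suc d) A"
    and c: "\<And>i. i \<in> I \<Longrightarrow> 0 < c i" "\<And>i. i \<in> I \<Longrightarrow> A (x i) = c i *\<^sub>R homog d (q i)"
    using realization[OF Q iso] by metis
  have hs: "Q \<subseteq> upper_hemisphere d" using Q by (simp add: sph_polytope_def)
  have linA: "linear A" using A by (simp add: linear_automorphism_def)
  define Y where "Y i = homog d (q i)" for i
  define b where "b i = c i / lk (x i) d" for i
  have b: "0 < b i" "A (xh i) = b i *\<^sub>R Y i" if "i \<in> I" for i
    using c[OF that] x_pos[OF that] by (auto simp: b_def Y_def xh_def homog_def linear_cmul[OF linA] divide_inverse mult.commute)
  \<comment> \<open>The linear map multiplies different vertices by different factors; after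
    division by their weighted total \<open>t\<close> the changed weights are convex again.\<close>
  have rescale: "\<exists>y\<in>convex hull (v ` I). \<exists>t>0. (\<Sum>i\<in>I. (w i * s i) *\<^sub>R v i) = t *\<^sub>R y"
    if w: "\<And>i. i \<in> I \<Longrightarrow> 0 \<le> w i" "sum w I = 1" and s: "\<And>i. i \<in> I \<Longrightarrow> 0 < s i" for w s :: "'a \<Rightarrow> real" and v :: "'a \<Rightarrow> rvec"
  proof -
    define t where "t = (\<Sum>i\<in>I. w i * s i)"
    obtain k where k: "k \<in> I" "0 < w k"
      using w fin by (metis less_eq_real_def sum.neutral zero_neq_one)
    have t: "0 < t" unfolding t_def
      using k w(1) s fin by (intro sum_pos2[of I k]) (auto intro: mult_nonneg_nonneg less_imp_le)
    have "(\<Sum>i\<in>I. (w i * s i / t) *\<^sub>R v i) \<in> convex hull (v ` I)"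
      by (rule convex_sum[OF fin convex_convex_hull])
        (use t w(1) s in \<open>auto simp: sum_divide_distrib[symmetric] t_def[symmetric] hull_inc less_imp_le\<close>)
    moreover have "(\<Sum>i\<in>I. (w i * s i) *\<^sub>R v i) = t *\<^sub>R (\<Sum>i\<in>I. (w i * s i / t) *\<^sub>R v i)"
      using t by (simp add: scaleR_sum_right)
    ultimately show ?thesis using t by blast
  qed
  have posP: "0 < lk v d" if "v \<in> Pol" for v using that Pol_sub by (auto simp: upper_hemisphere_def)
  have posQ: "0 < lk v d" if "v \<in> Q" for v using that hs by (auto simp: upper_hemisphere_def)
  have hm: "v = lk v d *\<^sub>R homog d v" if "0 < lk v d" for v using that by (simp add: homog_def)
  have "\<exists>z\<in>Q. proj_maps A v z" if v: "v \<in> Pol" for v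
  proof -
    have "homog d v \<in> convex hull (xh ` I)" using v homog_Pol by (auto simp: Cv_def)
    then obtain w where w: "\<And>i. i \<in> I \<Longrightarrow> 0 \<le> w i" "sum w I = 1" "homog d v = (\<Sum>i\<in>I. w i *\<^sub>R xh i)"
      using convex_hull_family[OF fin] by metis
    have "A (homog d v) = (\<Sum>i\<in>I. (w i * b i) *\<^sub>R Y i)"
      unfolding w(3) using b(2) by (simp add: linear_sum[OF linA] linear_cmul[OF linA])
    then obtain y t where y: "y \<in> convex hull (Y ` I)" "0 < t" "A (homog d v) = t *\<^sub>R y"
      using rescale[of w b Y, OF w(1,2) b(1)] by auto
    obtain z where z: "z \<in> Q" "y = homog d z" using y(1) q(3) unfolding Y_def by auto
    have "A v = (lk v d * t * inverse (lk z d)) *\<^sub>R z"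
      using hm[OF posP[OF v]] y(3) z(2) by (metis linear_cmul[OF linA] homog_def scaleR_scaleR)
    then have "proj_maps A v z" by (rule proj_mapsI) (use posP[OF v] y(2) posQ[OF z(1)] in simp)
    then show ?thesis using z(1) by blast
  qed
  moreover have "\<exists>v\<in>Pol. proj_maps A v z" if z: "z \<in> Q" for z
  proof -
    have "homog d z \<in> convex hull (Y ` I)" using z q(3) unfolding Y_def by auto
    then obtain w where w: "\<And>i. i \<in> I \<Longrightarrow> 0 \<le> w i" "sum w I = 1" "homog d z = (\<Sum>i\<in>I. w i *\<^sub>R Y i)"
      using convex_hull_family[OF fin] by metis
    obtain y t where y: "y \<in> convex hull (xh ` I)" "0 < t" "(\<Sum>i\<in>I. (w i * inverse (b i)) *\<^sub>R xh i) = t *\<^sub>R y"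
      using rescale[of w "\<lambda>i. inverse (b i)" xh, OF w(1,2)] b(1) by auto
    have "t *\<^sub>R A y = A (\<Sum>i\<in>I. (w i * inverse (b i)) *\<^sub>R xh i)" using y(3) by (simp add: linear_cmul[OF linA])
    also have "\<dots> = (\<Sum>i\<in>I. (w i * inverse (b i)) *\<^sub>R (b i *\<^sub>R Y i))"
      using b(2) by (simp add: linear_sum[OF linA] linear_cmul[OF linA])
    also have "\<dots> = homog d z" unfolding w(3) using b(1) by (intro sum.cong) (auto simp: less_imp_neq[symmetric])
    finally have Ay: "A y = inverse t *\<^sub>R homog d z" using y(2) by (metis less_irrefl scaleR_scaleR left_inverse scaleR_one)
    obtain v where v: "v \<in> Pol" "y = homog d v" using y(1) homog_Pol by (auto simp: Cv_def)
    have "A v = lk v d *\<^sub>R A y" using hm[OF posP[OF v(1)]] v(2) by (metis linear_cmul[OF linA])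
    then have "A v = (lk v d * inverse t * inverse (lk z d)) *\<^sub>R z"
      unfolding Ay by (simp add: homog_def)
    then have "proj_maps A v z" by (rule proj_mapsI) (use posP[OF v(1)] y(2) posQ[OF z] in simp)
    then show ?thesis using v(1) by blast
  qed
  moreover have "\<exists>w. \<phi> {v} = {w} \<and> proj_maps A v w" if v: "v \<in> sph_vertices d Pol" for v
  proof -
    obtain i where i: "i \<in> I" "v = vt i" using v vertices by blast
    have qQ: "q i \<in> Q" using q(1)[OF i(1)] by (simp add: sph_vertices_def)
    have "A v = lk v d *\<^sub>R A (xh i)"
      using hm[OF posP[OF vt_in[OF i(1)]]] homog_vt[OF i(1)] i(2) by (metis linear_cmul[OF linA])
    then have "A v = (lk v d * b i * inverse (lk (q i) d)) *\<^sub>R q i"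
      using b(2)[OF i(1)] by (simp add: Y_def homog_def)
    then have "proj_maps A v (q i)"
      by (rule proj_mapsI) (use i b(1)[OF i(1)] posP[OF vt_in[OF i(1)]] posQ[OF qQ] in simp)
    then show ?thesis using q(2)[OF i(1)] i(2) by blast
  qed
  ultimately show "\<exists>A. linear_automorphism (Suc d) A \<and> proj_maps_onto A Pol Q \<and>
      (\<forall>v\<in>sph_vertices d Pol. \<exists>w. \<phi> {v} = {w} \<and> proj_maps A v w)"
    using A unfolding proj_maps_onto_def by blast
qed

end

section \<open>Lawrence extensions and pyramids\<close>

lemma triangular_span:
  assumes lin: "\<And>i. i < M \<Longrightarrow> linear (G i :: rvec \<Rightarrow> real)"
    and up: "\<And>i j. j < i \<Longrightarrow> i < M \<Longrightarrow> G i (z j) = 0"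
    and diag: "\<And>i. i < M \<Longrightarrow> G i (z i) \<noteq> 0"
    and z: "\<And>j. j < M \<Longrightarrow> z j \<in> coord_space M"
  shows "coord_space M \<subseteq> span (z ` {..<M})"
proof
  fix v assume v: "v \<in> coord_space M"
  have zs: "\<And>j. j < M \<Longrightarrow> z j \<in> span (z ` {..<M})" by (auto intro: span_base)
  obtain b where b: "\<And>i j. i < M \<Longrightarrow> j < M \<Longrightarrow> G i (b j) = (if i = j then 1 else 0)"
    "\<And>j. j < M \<Longrightarrow> b j \<in> span (z ` {..<M})"
    using triangular_dual_basis[of M G z "span (z ` {..<M})", OF lin up diag subspace_span zs] by metis
  have "span (z ` {..<M}) \<subseteq> coord_space M" using z by (intro span_minimal subspace_coord_space) auto
  then have "\<And>j. j < M \<Longrightarrow> b j \<in> coord_space M" using b(2) by blast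
  then have "v = (\<Sum>j<M. G j v *\<^sub>R b j)" by (intro dual_expansion[OF lin b(1) _ v])
  moreover have "(\<Sum>j<M. G j v *\<^sub>R b j) \<in> span (z ` {..<M})" using b(2) by (intro span_sum span_scale) auto
  ultimately show "v \<in> span (z ` {..<M})" by simp
qed

lemma triangular_inj:
  fixes M :: nat
  assumes lin: "\<And>i. i < M \<Longrightarrow> linear (G i :: 'a::real_vector \<Rightarrow> real)"
    and up: "\<And>i j. j < i \<Longrightarrow> i < M \<Longrightarrow> G i (z j) = 0"
    and diag: "\<And>i. i < M \<Longrightarrow> G i (z i) \<noteq> 0"
    and sum: "(\<Sum>j<M. u j *\<^sub>R z j) = 0" and k: "k < M"
  shows "u k = 0"
proof (rule ccontr)
  assume "u k \<noteq> 0"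
  define n where "n = Max {j. j < M \<and> u j \<noteq> 0}"
  have fin: "finite {j. j < M \<and> u j \<noteq> 0}" by simp
  have "n \<in> {j. j < M \<and> u j \<noteq> 0}" unfolding n_def by (rule Max_in[OF fin]) (use k \<open>u k \<noteq> 0\<close> in auto)
  then have n: "n < M" "u n \<noteq> 0" by auto
  have above: "u j = 0" if "n < j" "j < M" for j
  proof (rule ccontr)
    assume "u j \<noteq> 0"
    then have "j \<le> n" unfolding n_def by (intro Max_ge[OF fin]) (use that in simp)
    then show False using that by simp
  qed
  have "G n (\<Sum>j<M. u j *\<^sub>R z j) = (\<Sum>j<M. u j * G n (z j))"
    by (simp add: linear_sum[OF lin[OF n(1)]] linear_cmul[OF lin[OF n(1)]])
  also have "\<dots> = (\<Sum>j<M. if j = n then u n * G n (z n) else 0)"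
    using above up n(1) by (intro sum.cong) (auto simp: neq_iff)
  also have "\<dots> = u n * G n (z n)" using n(1) by simp
  finally show False using sum linear_0[OF lin[OF n(1)]] n diag by simp
qed

datatype 'l vert = Pt 'l | Db 'l bool | Ap nat

text \<open>
  The labels \<open>t\<close> make the coordinate forms triangular, so that they remain a basis in every realization.
  The form \<open>w\<close> yields a form that is positive on all vertices.
\<close>

locale lawrence =
  fixes m q s :: nat and p :: "'l \<Rightarrow> nat \<Rightarrow> real" and A R :: "'l set" and rho :: "'l \<Rightarrow> nat"
    and t :: "nat \<Rightarrow> 'l" and w :: "nat \<Rightarrow> real"
  assumes finA: "finite A" and finR: "finite R" and disj: "A \<inter> R = {}"
    and rho: "bij_betw rho R {..<q}" and s: "0 < s"
    and base_rigid: "diag_rigid m p A R"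
    and nonneg: "\<And>l j. l \<in> A \<Longrightarrow> j < m \<Longrightarrow> 0 \<le> p l j"
    and t_in: "\<And>j. j < m \<Longrightarrow> t j \<in> R" and t_diag: "\<And>j. j < m \<Longrightarrow> p (t j) j \<noteq> 0"
    and t_up: "\<And>j i. j < i \<Longrightarrow> i < m \<Longrightarrow> p (t j) i = 0"
    and w_pos: "\<And>l. l \<in> A \<Longrightarrow> 0 < dotp m w (p l)"
    and w_bound: "\<And>l. l \<in> R \<Longrightarrow> \<bar>dotp m w (p l)\<bar> < 2"
    and exp_A: "\<And>l. l \<in> A \<Longrightarrow> \<exists>f. dotp m f (p l) = 0 \<and> (\<forall>l'\<in>A. l' \<noteq> l \<longrightarrow> 0 < dotp m f (p l'))"
    and exp_R: "\<And>l b. l \<in> R \<Longrightarrow> \<exists>f. (\<forall>l'\<in>A. 0 < dotp m f (p l')) \<and> 0 < (if b then 1 else - 1) * dotp m f (p l)"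
begin

definition d :: nat where "d = m + q + s - 1"

lemma Suc_d: "Suc d = m + q + s" using s by (simp add: d_def)

definition I :: "'l vert set"
  where "I = Pt ` A \<union> (\<lambda>(l, b). Db l b) ` (R \<times> UNIV) \<union> Ap ` {..<s}"

fun x0 :: "'l vert \<Rightarrow> nat \<Rightarrow> real" where
  "x0 (Pt l) j = (if j < m then p l j else 0)"
| "x0 (Db l b) j = (if j < m then (if b then 1 else - 1) * p l j else if j = m + rho l then 1 else 0)"
| "x0 (Ap k) j = (if j = m + q + k then 1 else 0)"

text \<open>On the two vertices over a label \<open>l\<close> this form takes the values 2 plus or
  minus \<open>dotp m w (p l)\<close>, which \<open>w_bound\<close> keeps positive.\<close>

definition om :: "nat \<Rightarrow> real" where "om j = (if j < m then w j else if j < m + q then 2 else 1)"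

text \<open>
  The last coordinate, which belongs to an apex, is replaced by the positive form \<open>om\<close>, because points of the
  hemisphere have a positive last coordinate. \<open>U\<close> undoes this.
\<close>

definition x :: "'l vert \<Rightarrow> rvec"
  where "x i = cvec (Suc d) (\<lambda>j. if j < d then x0 i j else dotp (Suc d) om (x0 i))"

definition U :: "nat \<Rightarrow> rvec \<Rightarrow> real"
  where "U j v = (if j < d then lk v j
    else lk v d - (\<Sum>k<d. om k * lk v k))"

lemma om_d: "om d = 1" using s by (simp add: om_def d_def)

lemma linear_U: "linear (U j)"
proof (rule linearI)
  show "U j (a + b) = U j a + U j b" for a b
    by (simp add: U_def lookup_add algebra_simps sum.distrib)
  show "U j (c *\<^sub>R a) = c *\<^sub>R U j a" for c a
    by (simp add: U_def lookup_scaleR algebra_simps sum_distrib_left)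
qed

lemma U_x: assumes "j < Suc d" shows "U j (x i) = x0 i j"
proof (cases "j < d")
  case False
  then have "j = d" using assms by simp
  moreover have "(\<Sum>k<d. om k * lk (x i) k) = (\<Sum>k<d. om k * x0 i k)"
    by (intro sum.cong) (auto simp: x_def lookup_cvec)
  ultimately show ?thesis by (simp add: U_def x_def lookup_cvec dotp_def om_d)
qed (simp add: U_def x_def lookup_cvec)

lemma x_in: "x i \<in> coord_space (Suc d)"
  by (simp add: x_def cvec_in)

definition form :: "(nat \<Rightarrow> real) \<Rightarrow> rvec \<Rightarrow> real"
  where "form f v = (\<Sum>j<Suc d. f j * U j v)"

lemma linear_form: "linear (form f)"
  unfolding form_def
proof (rule linearI)
  show "(\<Sum>j<Suc d. f j * U j (a + b)) = (\<Sum>j<Suc d. f j * U j a) + (\<Sum>j<Suc d. f j * U j b)" for a b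
    unfolding linear_add[OF linear_U] distrib_left sum.distrib ..
  show "(\<Sum>j<Suc d. f j * U j (c *\<^sub>R a)) = c *\<^sub>R (\<Sum>j<Suc d. f j * U j a)" for c a
    unfolding linear_cmul[OF linear_U] real_scaleR_def sum_distrib_left by (intro sum.cong) auto
qed

lemma form_x: "form f (x i) = dotp (Suc d) f (x0 i)"
  unfolding form_def dotp_def by (rule sum.cong) (auto simp: U_x)

definition ext :: "(nat \<Rightarrow> real) \<Rightarrow> (nat \<Rightarrow> real) \<Rightarrow> (nat \<Rightarrow> real) \<Rightarrow> nat \<Rightarrow> real"
  where "ext f g h j = (if j < m then f j else if j < m + q then g (j - m) else h (j - m - q))"

lemma rho_less: "l \<in> R \<Longrightarrow> rho l < q"
  using rho by (auto simp: bij_betw_def)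

lemma rho_inj: "l \<in> R \<Longrightarrow> l' \<in> R \<Longrightarrow> rho l = rho l' \<longleftrightarrow> l = l'"
  using rho by (auto simp: bij_betw_def inj_on_def)

lemma sum_split: "(\<Sum>j<Suc d. F j) = (\<Sum>j<m. F j) + (\<Sum>j<q. F (m + j)) + (\<Sum>j<s. F (m + q + j))"
  for F :: "nat \<Rightarrow> 'z::comm_monoid_add"
proof -
  have 1: "(\<Sum>j<a + b. F' j) = (\<Sum>j<a. F' j) + (\<Sum>j<b. F' (a + j))" for a b and F' :: "nat \<Rightarrow> 'z"
    by (induction b) (auto simp: add.assoc)
  show ?thesis unfolding Suc_d 1 by (simp add: add.assoc)
qed

lemma dotp_x0:
  "dotp (Suc d) f (x0 (Pt l)) = dotp m f (p l)"
  "l \<in> R \<Longrightarrow> dotp (Suc d) f (x0 (Db l b)) = (if b then 1 else - 1) * dotp m f (p l) + f (m + rho l)"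
  "k < s \<Longrightarrow> dotp (Suc d) f (x0 (Ap k)) = f (m + q + k)"
proof -
  show "dotp (Suc d) f (x0 (Pt l)) = dotp m f (p l)"
    unfolding dotp_def sum_split by simp
  show "dotp (Suc d) f (x0 (Db l b)) = (if b then 1 else - 1) * dotp m f (p l) + f (m + rho l)" if "l \<in> R"
  proof -
    have "(\<Sum>j<q. f (m + j) * x0 (Db l b) (m + j)) = (\<Sum>j<q. if j = rho l then f (m + rho l) else 0)"
      by (intro sum.cong) auto
    moreover have "(\<Sum>j<s. f (m + q + j) * x0 (Db l b) (m + q + j)) = 0"
      using rho_less[OF that] by (intro sum.neutral) auto
    ultimately show ?thesis using rho_less[OF that]
      unfolding dotp_def sum_split by (cases b) (simp_all add: sum_negf)
  qed
  show "dotp (Suc d) f (x0 (Ap k)) = f (m + q + k)" if "k < s"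
  proof -
    have "(\<Sum>j<s. f (m + q + j) * x0 (Ap k) (m + q + j)) = (\<Sum>j<s. if j = k then f (m + q + k) else 0)"
      by (intro sum.cong) auto
    moreover have "(\<Sum>j<q. f (m + j) * x0 (Ap k) (m + j)) = 0" by (intro sum.neutral) auto
    moreover have "(\<Sum>j<m. f j * x0 (Ap k) j) = 0" by (intro sum.neutral) auto
    ultimately show ?thesis using that unfolding dotp_def sum_split by simp
  qed
qed

lemma dotp_ext: "dotp m (ext f g h) v = dotp m f v"
  unfolding dotp_def ext_def by (intro sum.cong) auto

lemma form_ext:
  "form (ext f g h) (x (Pt l)) = dotp m f (p l)"
  "l \<in> R \<Longrightarrow> form (ext f g h) (x (Db l b)) = (if b then 1 else - 1) * dotp m f (p l) + g (rho l)"
  "k < s \<Longrightarrow> form (ext f g h) (x (Ap k)) = h k"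
proof -
  show "form (ext f g h) (x (Pt l)) = dotp m f (p l)" by (simp only: form_x dotp_x0 dotp_ext)
  show "form (ext f g h) (x (Db l b)) = (if b then 1 else - 1) * dotp m f (p l) + g (rho l)" if "l \<in> R"
    using rho_less[OF that] by (simp only: form_x dotp_x0(2)[OF that] dotp_ext) (simp add: ext_def)
  show "form (ext f g h) (x (Ap k)) = h k" if "k < s"
    by (simp only: form_x dotp_x0(3)[OF that]) (simp add: ext_def)
qed

lemma I_cases:
  assumes "i \<in> I"
  obtains l where "l \<in> A" "i = Pt l" | l b where "l \<in> R" "i = Db l b" | k where "k < s" "i = Ap k"
  using assms by (auto simp: I_def)

lemma I_mem: "l \<in> A \<Longrightarrow> Pt l \<in> I" "l \<in> R \<Longrightarrow> Db l b \<in> I" "k < s \<Longrightarrow> Ap k \<in> I"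
  by (auto simp: I_def)

lemma fin_I: "finite I" using finA finR by (simp add: I_def)

lemma card_I: "card I = card A + 2 * q + s"
proof -
  have "card ((\<lambda>(l, b). Db l b) ` (R \<times> (UNIV :: bool set))) = card R * 2"
    by (subst card_image) (auto simp: inj_on_def card_cartesian_product)
  moreover have "card R = q" using rho by (simp add: bij_betw_same_card[OF rho])
  moreover have "card (Pt ` A) = card A" "card (Ap ` {..<s}) = s" by (auto simp: card_image inj_on_def)
  moreover have "card I = card (Pt ` A) + card ((\<lambda>(l, b). Db l b) ` (R \<times> (UNIV :: bool set))) + card (Ap ` {..<s} :: 'l vert set)"
  proof -
    have "finite (Pt ` A)" "finite ((\<lambda>(l, b). Db l b) ` (R \<times> (UNIV :: bool set)))" using finA finR by simp_all
    moreover have "Pt ` A \<inter> (\<lambda>(l, b). Db l b) ` (R \<times> UNIV) = {}" by auto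
    moreover have "(Pt ` A \<union> (\<lambda>(l, b). Db l b) ` (R \<times> UNIV)) \<inter> Ap ` {..<s} = {}" by auto
    ultimately show ?thesis unfolding I_def by (simp add: card_Un_disjoint)
  qed
  ultimately show ?thesis by simp
qed

lemma x_pos: assumes "i \<in> I" shows "0 < lk (x i) d"
proof -
  have e: "lk (x i) d = dotp (Suc d) om (x0 i)" by (simp add: x_def lookup_cvec)
  have om: "dotp m om v = dotp m w v" for v unfolding dotp_def om_def by (intro sum.cong) auto
  from assms show ?thesis unfolding e
  proof (cases rule: I_cases)
    case (1 l)
    then show "0 < dotp (Suc d) om (x0 i)" using w_pos by (simp add: dotp_x0 om)
  next
    case (2 l b)
    then show "0 < dotp (Suc d) om (x0 i)" using w_bound[of l] rho_less[of l]
      by (cases b) (auto simp: dotp_x0 om om_def)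
  next
    case (3 k)
    then show "0 < dotp (Suc d) om (x0 i)" by (simp add: dotp_x0) (simp add: om_def)
  qed
qed

definition rinv :: "nat \<Rightarrow> 'l" where "rinv k = inv_into R rho k"

lemma rinv: "k < q \<Longrightarrow> rinv k \<in> R" "k < q \<Longrightarrow> rho (rinv k) = k" "l \<in> R \<Longrightarrow> rinv (rho l) = l"
  using rho unfolding rinv_def bij_betw_def
  by (auto simp: inv_into_into f_inv_into_f inv_into_f_f)

text \<open>A form \<open>f\<close> on the base may be extended by any coefficient at a doubled
  label. The coefficient \<bar>f(l)\<bar> makes it vanish at one of the two vertices over
  \<open>l\<close> when \<open>f(l) \<noteq> 0\<close>, and adding 1 makes it positive at both. To
  expose \<open>Db l b\<close>, \<open>f\<close> must be positive on \<open>A\<close> and have at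
  \<open>l\<close> the sign opposite to \<open>b\<close>.\<close>

lemma exposed: assumes "i \<in> I"
  shows "\<exists>f :: rvec \<Rightarrow> real. linear f \<and> f (x i) = 0 \<and> (\<forall>j\<in>I. j \<noteq> i \<longrightarrow> 0 < f (x j))"
  using assms
proof (cases rule: I_cases)
  case (1 l)
  obtain f where f: "dotp m f (p l) = 0" "\<forall>l'\<in>A. l' \<noteq> l \<longrightarrow> 0 < dotp m f (p l')" using exp_A[OF 1(1)] by blast
  let ?g = "ext f (\<lambda>k. \<bar>dotp m f (p (rinv k))\<bar> + 1) (\<lambda>_. 1)"
  have "0 < form ?g (x j)" if "j \<in> I" "j \<noteq> i" for j
    using that(1)
  proof (cases rule: I_cases)
    case (2 l' b)
    then show ?thesis by (cases b) (auto simp: form_ext rinv)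
  qed (use that f 1 in \<open>auto simp: form_ext\<close>)
  moreover have "form ?g (x i) = 0" using 1 f by (simp add: form_ext)
  ultimately show ?thesis using linear_form by blast
next
  case (2 l b)
  obtain f where f: "\<forall>l'\<in>A. 0 < dotp m f (p l')" "0 < (if \<not> b then 1 else - 1) * dotp m f (p l)" using exp_R[OF 2(1), of "\<not> b"] by blast
  let ?g = "ext f (\<lambda>k. \<bar>dotp m f (p (rinv k))\<bar> + (if k = rho l then 0 else 1)) (\<lambda>_. 1)"
  have "0 < form ?g (x j)" if "j \<in> I" "j \<noteq> i" for j
    using that(1)
  proof (cases rule: I_cases)
    case (2 l' b')
    then show ?thesis using \<open>l \<in> R\<close> \<open>i = Db l b\<close> that(2) f(2) rho_inj[of l' l]
      by (cases b; cases b') (auto simp: form_ext rinv)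
  qed (use that f in \<open>auto simp: form_ext\<close>)
  moreover have "form ?g (x i) = 0" using 2 f(2) by (cases b) (simp_all add: form_ext rinv)
  ultimately show ?thesis using linear_form by blast
next
  case (3 k)
  let ?g = "ext w (\<lambda>k. 2) (\<lambda>j. if j = k then 0 else 1)"
  have "0 < form ?g (x j)" if "j \<in> I" "j \<noteq> i" for j
    using that(1)
  proof (cases rule: I_cases)
    case (2 l' b)
    then show ?thesis using w_bound[of l'] by (cases b) (auto simp: form_ext)
  qed (use that 3 w_pos in \<open>auto simp: form_ext\<close>)
  moreover have "form ?g (x i) = 0" using 3 by (simp add: form_ext)
  ultimately show ?thesis using linear_form by blast
qed

text \<open>
  The two vectors over a doubled label \<open>l\<close> span a plane that meets the common kernel of the forms \<open>\<gamma>\<close>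
  in the line of \<open>z l\<close>; this recovers the undoubled configuration.
\<close>

context
  fixes y :: "'l vert \<Rightarrow> rvec"
  assumes y_in: "\<And>i. i \<in> I \<Longrightarrow> y i \<in> coord_space (Suc d)"
    and transfer: "\<And>f :: rvec \<Rightarrow> real. linear f \<Longrightarrow> (\<And>i. i \<in> I \<Longrightarrow> 0 \<le> f (x i)) \<Longrightarrow>
      \<exists>g :: rvec \<Rightarrow> real. linear g \<and> (\<forall>i\<in>I. 0 \<le> g (y i) \<and> (g (y i) = 0 \<longleftrightarrow> f (x i) = 0))"
begin

text \<open>The coordinate form of a doubled label is nonnegative on all vertices and nonzero only
  at the two over that label, so it defines a face.\<close>

lemma gamma_exists:
  "\<exists>g :: rvec \<Rightarrow> real. linear g \<and> (\<forall>l\<in>A. g (y (Pt l)) = 0) \<and>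
    (\<forall>l\<in>R. \<forall>b. if rho l = k then 0 < g (y (Db l b)) else g (y (Db l b)) = 0) \<and> (\<forall>j<s. g (y (Ap j)) = 0)"
proof -
  let ?f = "form (ext (\<lambda>_. 0) (\<lambda>j. if j = k then 1 else 0) (\<lambda>_. 0))"
  have d0: "dotp m (\<lambda>_. 0) v = 0" for v by (simp add: dotp_def)
  have "0 \<le> ?f (x i)" if "i \<in> I" for i
    using that by (cases rule: I_cases) (auto simp: form_ext d0)
  then obtain g :: "rvec \<Rightarrow> real" where g: "linear g" "\<And>i. i \<in> I \<Longrightarrow> 0 \<le> g (y i)" "\<And>i. i \<in> I \<Longrightarrow> g (y i) = 0 \<longleftrightarrow> ?f (x i) = 0"
    using transfer[OF linear_form] by blast
  have "g (y (Pt l)) = 0" if "l \<in> A" for l using g(3)[OF I_mem(1)[OF that]] by (simp add: form_ext d0)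
  moreover have "if rho l = k then 0 < g (y (Db l b)) else g (y (Db l b)) = 0" if "l \<in> R" for l b
    using g(2,3)[OF I_mem(2)[OF that, of b]] that by (auto simp: form_ext d0)
  moreover have "g (y (Ap j)) = 0" if "j < s" for j using g(3)[OF I_mem(3)[OF that]] that by (simp add: form_ext)
  ultimately show ?thesis using g(1) by blast
qed

lemma eta_exists:
  assumes "k < s"
  shows "\<exists>g :: rvec \<Rightarrow> real. linear g \<and> (\<forall>l\<in>A. g (y (Pt l)) = 0) \<and>
    (\<forall>l\<in>R. \<forall>b. g (y (Db l b)) = 0) \<and> (\<forall>j<s. if j = k then 0 < g (y (Ap j)) else g (y (Ap j)) = 0)"
proof -
  let ?f = "form (ext (\<lambda>_. 0) (\<lambda>_. 0) (\<lambda>j. if j = k then 1 else 0))"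
  have d0: "dotp m (\<lambda>_. 0) v = 0" for v by (simp add: dotp_def)
  have "0 \<le> ?f (x i)" if "i \<in> I" for i
    using that by (cases rule: I_cases) (auto simp: form_ext d0)
  then obtain g :: "rvec \<Rightarrow> real" where g: "linear g" "\<And>i. i \<in> I \<Longrightarrow> 0 \<le> g (y i)" "\<And>i. i \<in> I \<Longrightarrow> g (y i) = 0 \<longleftrightarrow> ?f (x i) = 0"
    using transfer[OF linear_form] by blast
  have "g (y (Pt l)) = 0" if "l \<in> A" for l using g(3)[OF I_mem(1)[OF that]] by (simp add: form_ext d0)
  moreover have "g (y (Db l b)) = 0" if "l \<in> R" for l b
    using g(3)[OF I_mem(2)[OF that, of b]] that by (simp add: form_ext d0)
  moreover have "if j = k then 0 < g (y (Ap j)) else g (y (Ap j)) = 0" if "j < s" for j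
    using g(2,3)[OF I_mem(3)[OF that]] that by (auto simp: form_ext)
  ultimately show ?thesis using g(1) by blast
qed

definition \<gamma> :: "nat \<Rightarrow> rvec \<Rightarrow> real" where
  "\<gamma> k = (SOME g. linear g \<and> (\<forall>l\<in>A. g (y (Pt l)) = 0) \<and>
    (\<forall>l\<in>R. \<forall>b. if rho l = k then 0 < g (y (Db l b)) else g (y (Db l b)) = 0) \<and> (\<forall>j<s. g (y (Ap j)) = 0))"

definition \<eta> :: "nat \<Rightarrow> rvec \<Rightarrow> real" where
  "\<eta> k = (SOME g. linear g \<and> (\<forall>l\<in>A. g (y (Pt l)) = 0) \<and>
    (\<forall>l\<in>R. \<forall>b. g (y (Db l b)) = 0) \<and> (\<forall>j<s. if j = k then 0 < g (y (Ap j)) else g (y (Ap j)) = 0))"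

lemma \<gamma>: "linear (\<gamma> k)" "l \<in> A \<Longrightarrow> \<gamma> k (y (Pt l)) = 0" "l \<in> R \<Longrightarrow> rho l = k \<Longrightarrow> 0 < \<gamma> k (y (Db l b))"
  "l \<in> R \<Longrightarrow> rho l \<noteq> k \<Longrightarrow> \<gamma> k (y (Db l b)) = 0" "j < s \<Longrightarrow> \<gamma> k (y (Ap j)) = 0"
  using someI_ex[OF gamma_exists[of k]] unfolding \<gamma>_def[symmetric] by metis+

lemma \<eta>: assumes "k < s"
  shows "linear (\<eta> k)" "l \<in> A \<Longrightarrow> \<eta> k (y (Pt l)) = 0" "l \<in> R \<Longrightarrow> \<eta> k (y (Db l b)) = 0"
  "0 < \<eta> k (y (Ap k))" "j < s \<Longrightarrow> j \<noteq> k \<Longrightarrow> \<eta> k (y (Ap j)) = 0"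
  using someI_ex[OF eta_exists[OF assms]] assms unfolding \<eta>_def[symmetric] by metis+

definition z :: "'l \<Rightarrow> rvec" where
  "z l = (if l \<in> R then \<gamma> (rho l) (y (Db l False)) *\<^sub>R y (Db l True) - \<gamma> (rho l) (y (Db l True)) *\<^sub>R y (Db l False)
     else y (Pt l))"

lemma z_A: "l \<in> A \<Longrightarrow> z l = y (Pt l)" using disj by (auto simp: z_def)

lemma z_in: "l \<in> A \<union> R \<Longrightarrow> z l \<in> coord_space (Suc d)"
  using y_in I_mem by (auto simp: z_def intro!: subspace_diff[OF subspace_coord_space] subspace_scale[OF subspace_coord_space])

lemma \<gamma>_z: assumes "l \<in> A \<union> R" shows "\<gamma> k (z l) = 0"
proof (cases "l \<in> R")
  case True
  then show ?thesis
    by (cases "rho l = k") (simp_all add: z_def linear_diff[OF \<gamma>(1)] linear_cmul[OF \<gamma>(1)] \<gamma>(4))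
qed (use assms \<gamma>(2) in \<open>auto simp: z_A\<close>)

lemma \<eta>_z: assumes "l \<in> A \<union> R" "k < s" shows "\<eta> k (z l) = 0"
proof (cases "l \<in> R")
  case True
  then show ?thesis
    using \<eta>(3)[OF assms(2)] by (simp add: z_def linear_diff[OF \<eta>(1)[OF assms(2)]] linear_cmul[OF \<eta>(1)[OF assms(2)]])
qed (use assms \<eta>(2) in \<open>auto simp: z_A\<close>)

text \<open>With coefficient \<bar>f(l)\<bar> the form has the values \<bar>f(l)\<bar> + f(l) and
  \<bar>f(l)\<bar> - f(l) over \<open>l\<close>, so the sign of \<open>f(l)\<close> is visible in
  which of them vanish. The two vertices enter \<open>z l\<close> with coefficients of opposite
  sign, which turns this pattern into the sign of \<open>g (z l)\<close>.\<close>

lemma base_transfer: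
  assumes "\<And>l. l \<in> A \<Longrightarrow> 0 \<le> dotp m f (p l)"
  shows "\<exists>g :: rvec \<Rightarrow> real. linear g \<and> (\<forall>l\<in>A \<union> R. sgn (g (z l)) = sgn (dotp m f (p l)))"
proof -
  let ?f = "form (ext f (\<lambda>k. \<bar>dotp m f (p (rinv k))\<bar>) (\<lambda>_. 0))"
  have fD: "?f (x (Db l b)) = (if b then 1 else - 1) * dotp m f (p l) + \<bar>dotp m f (p l)\<bar>" if "l \<in> R" for l b
    using that by (simp add: form_ext rinv)
  have "0 \<le> ?f (x i)" if "i \<in> I" for i
    using that
  proof (cases rule: I_cases)
    case (2 l b)
    then show ?thesis by (cases b) (auto simp: fD)
  qed (use assms in \<open>auto simp: form_ext\<close>)
  then obtain g :: "rvec \<Rightarrow> real" where g: "linear g" "\<And>i. i \<in> I \<Longrightarrow> 0 \<le> g (y i)" "\<And>i. i \<in> I \<Longrightarrow> g (y i) = 0 \<longleftrightarrow> ?f (x i) = 0"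
    using transfer[OF linear_form] by blast
  have "sgn (g (z l)) = sgn (dotp m f (p l))" if "l \<in> A \<union> R" for l
  proof (cases "l \<in> R")
    case False
    then have l: "l \<in> A" using that by simp
    then show ?thesis using g(2,3)[OF I_mem(1)[OF l]] assms[OF l] by (auto simp: z_A form_ext sgn_if)
  next
    case True
    define e where "e = dotp m f (p l)"
    have gp: "0 < \<gamma> (rho l) (y (Db l b))" for b using \<gamma>(3)[OF True] by simp
    have gz: "g (z l) = \<gamma> (rho l) (y (Db l False)) * g (y (Db l True)) - \<gamma> (rho l) (y (Db l True)) * g (y (Db l False))"
      using True by (simp add: z_def linear_diff[OF g(1)] linear_cmul[OF g(1)])
    have nn: "0 \<le> g (y (Db l b))" and iff: "g (y (Db l b)) = 0 \<longleftrightarrow> (if b then 1 else - 1) * e + \<bar>e\<bar> = 0" for b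
      using g(2,3)[OF I_mem(2)[OF True, of b]] fD[OF True, of b] by (simp_all add: e_def)
    consider "e = 0" | "0 < e" | "e < 0" by linarith
    then show ?thesis
    proof cases
      case 1
      then have "g (y (Db l True)) = 0" "g (y (Db l False)) = 0" using iff by auto
      then show ?thesis using 1 gz by (simp add: e_def)
    next
      case 2
      then have "g (y (Db l True)) \<noteq> 0" "g (y (Db l False)) = 0" using iff[of True] iff[of False] by auto
      then have "0 < g (z l)" using gz gp[of False] nn[of True] by simp
      then show ?thesis using 2 by (simp add: e_def)
    next
      case 3
      then have "g (y (Db l True)) = 0" "g (y (Db l False)) \<noteq> 0" using iff[of True] iff[of False] by auto
      then have "g (z l) < 0" using gz gp[of True] nn[of False] by simp
      then show ?thesis using 3 by (simp add: e_def)
    qed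
  qed
  then show ?thesis using g(1) by blast
qed

lemma dotp_unit: "k < m \<Longrightarrow> dotp m (\<lambda>j. if j = k then 1 else 0) v = v k"
  by (simp add: dotp_def if_distrib[of "\<lambda>a. a * _"] cong: if_cong)

definition \<epsilon> :: "nat \<Rightarrow> rvec \<Rightarrow> real" where
  "\<epsilon> k = (SOME g. linear g \<and> (\<forall>l\<in>A \<union> R. sgn (g (z l)) = sgn (p l k)))"

lemma \<epsilon>: assumes "k < m" shows "linear (\<epsilon> k)" "l \<in> A \<union> R \<Longrightarrow> sgn (\<epsilon> k (z l)) = sgn (p l k)"
proof -
  have "\<exists>g :: rvec \<Rightarrow> real. linear g \<and> (\<forall>l\<in>A \<union> R. sgn (g (z l)) = sgn (p l k))"
    using base_transfer[of "\<lambda>j. if j = k then 1 else 0"] nonneg[OF _ assms] unfolding dotp_unit[OF assms] by blast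
  from someI_ex[OF this] show "linear (\<epsilon> k)" "l \<in> A \<union> R \<Longrightarrow> sgn (\<epsilon> k (z l)) = sgn (p l k)"
    unfolding \<epsilon>_def[symmetric] by blast+
qed

text \<open>Coordinates of the realization: images of the coordinate forms of the base, of the
  doubled labels and of the apexes. On the vectors \<open>tv\<close> they are triangular, in the
  base block by the choice of the labels \<open>t\<close>, hence a basis.\<close>

definition G :: "nat \<Rightarrow> rvec \<Rightarrow> real" where
  "G i = (if i < m then \<epsilon> i else if i < m + q then \<gamma> (i - m) else \<eta> (i - m - q))"

lemma linear_G: "i < Suc d \<Longrightarrow> linear (G i)"
  unfolding G_def Suc_d using \<epsilon>(1) \<gamma>(1) \<eta>(1) by auto

definition tv :: "nat \<Rightarrow> rvec" where
  "tv j = (if j < m then z (t j) else if j < m + q then y (Db (rinv (j - m)) True) else y (Ap (j - m - q)))"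

lemma index_diff: "j < Suc d \<Longrightarrow> \<not> j < m + q \<Longrightarrow> j - (m + q) < s" "\<not> j < m \<Longrightarrow> j < m + q \<Longrightarrow> j - m < q" for j
  unfolding Suc_d by linarith+

lemma tv_in: assumes "j < Suc d" shows "tv j \<in> coord_space (Suc d)"
  unfolding tv_def using assms z_in t_in y_in I_mem rinv index_diff by simp

lemma z_span: assumes "l \<in> R" shows "z l \<in> span (y ` I)"
proof -
  have "y (Db l e) \<in> span (y ` I)" for e using I_mem(2)[OF assms] by (intro span_base) auto
  then show ?thesis using assms by (simp add: z_def span_diff span_scale)
qed

lemma tv_span: assumes "j < Suc d" shows "tv j \<in> span (y ` I)"
  unfolding tv_def using assms z_span t_in I_mem rinv index_diff by (simp add: span_base)

lemma G_Db:
  assumes "k < q"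
  shows "m + k < i \<Longrightarrow> i < Suc d \<Longrightarrow> G i (y (Db (rinv k) e)) = 0" "0 < G (m + k) (y (Db (rinv k) e))"
proof -
  show "G i (y (Db (rinv k) e)) = 0" if "m + k < i" "i < Suc d"
  proof (cases "i < m + q")
    case True
    then show ?thesis using \<gamma>(4)[where l = "rinv k" and k = "i - m"] rinv(1,2)[OF assms] that by (simp add: G_def)
  next
    case False
    then show ?thesis using \<eta>(3)[of "i - m - q" "rinv k"] rinv(1)[OF assms] that index_diff(1)[of i] by (simp add: G_def)
  qed
  show "0 < G (m + k) (y (Db (rinv k) e))"
    using \<gamma>(3)[where l = "rinv k" and k = k] rinv(1,2)[OF assms] assms by (simp add: G_def)
qed

lemma G_Ap:
  assumes "k < s"
  shows "m + q + k < i \<Longrightarrow> i < Suc d \<Longrightarrow> G i (y (Ap k)) = 0" "0 < G (m + q + k) (y (Ap k))"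
  using \<eta>(5)[of "i - m - q" k] \<eta>(4)[OF assms] assms index_diff(1)[of i] by (auto simp: G_def)

lemma index_cases:
  assumes "j < Suc d"
  obtains "j < m" | k where "k < q" "j = m + k" | k where "k < s" "j = m + q + k"
  using that(1) that(2)[of "j - m"] that(3)[of "j - m - q"] assms Suc_d by (cases "j < m"; cases "j < m + q") auto

lemma G_tv_up: assumes "j < i" "i < Suc d" shows "G i (tv j) = 0"
proof -
  have "j < Suc d" using assms by simp
  then show ?thesis
  proof (cases rule: index_cases)
    case 1
    consider "i < m" | "m \<le> i" "i < m + q" | "m + q \<le> i" by linarith
    then show ?thesis
    proof cases
      assume "i < m"
      then have "sgn (\<epsilon> i (z (t j))) = 0" using \<epsilon>(2)[of i "t j"] t_in[of j] t_up[of j i] assms by simp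
      then show ?thesis using 1 \<open>i < m\<close> by (simp add: G_def tv_def sgn_0_0)
    qed (use 1 \<gamma>_z[of "t j"] \<eta>_z[of "t j" "i - m - q"] t_in[of j] assms(2) index_diff(1)[of i] in \<open>auto simp: G_def tv_def\<close>)
  qed (use assms G_Db(1) G_Ap(1) in \<open>auto simp: tv_def\<close>)
qed

lemma G_tv_diag: assumes "i < Suc d" shows "G i (tv i) \<noteq> 0"
  using assms
proof (cases rule: index_cases)
  case 1
  then have "sgn (\<epsilon> i (z (t i))) \<noteq> 0" using \<epsilon>(2)[of i "t i"] t_in[of i] t_diag[of i] by (simp add: sgn_0_0)
  then show ?thesis using 1 by (auto simp add: G_def tv_def)
next
  case (2 k)
  then show ?thesis using G_Db(2)[of k True] by (simp add: tv_def)
next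
  case (3 k)
  then show ?thesis using G_Ap(2)[of k] by (simp add: tv_def)
qed

lemma y_span: "coord_space (Suc d) \<subseteq> span (y ` I)"
proof -
  have "coord_space (Suc d) \<subseteq> span (tv ` {..<Suc d})"
    by (rule triangular_span[of "Suc d" G tv]) (auto intro: linear_G G_tv_up tv_in simp: G_tv_diag)
  also have "\<dots> \<subseteq> span (y ` I)"
    by (rule span_minimal[OF _ subspace_span]) (auto intro: tv_span)
  finally show ?thesis .
qed

text \<open>In the basis dual to \<open>G\<close> the vectors \<open>z l\<close> form a sign
  realization of the base, so \<open>diag_rigid\<close> gives them as rescaled base vectors. The map
  \<open>L\<close> sends the unit vectors of the undoubled coordinates to \<open>B j\<close>; that
  it is an automorphism follows from triangularity of \<open>G\<close> on \<open>B\<close> and from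
  \<open>y_span\<close>.\<close>

lemma y_rigid: "\<exists>B c. linear_automorphism (Suc d) B \<and> (\<forall>i\<in>I. 0 < c i \<and> B (x i) = c i *\<^sub>R y i)"
proof -
  obtain b where b: "\<And>i j. i < Suc d \<Longrightarrow> j < Suc d \<Longrightarrow> G i (b j) = (if i = j then 1 else 0)"
    and b_in: "\<And>j. j < Suc d \<Longrightarrow> b j \<in> coord_space (Suc d)"
    using triangular_dual_basis[of "Suc d" G tv "coord_space (Suc d)",
        OF linear_G G_tv_up G_tv_diag subspace_coord_space tv_in] by metis
  define Z where "Z l j = G j (z l)" for l j
  have z_exp: "z l = (\<Sum>j<m. Z l j *\<^sub>R b j)" if l: "l \<in> A \<union> R" for l
  proof -
    have "z l = (\<Sum>j<Suc d. G j (z l) *\<^sub>R b j)"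
      by (rule dual_expansion[of "Suc d" G b, OF linear_G b b_in z_in[OF l]])
    also have "\<dots> = (\<Sum>j<m. Z l j *\<^sub>R b j)"
      unfolding sum_split Z_def using \<gamma>_z[OF l] \<eta>_z[OF l] by (simp add: G_def)
    finally show ?thesis .
  qed
  have "sign_realization m p A R Z"
    unfolding sign_realization_def
  proof (intro allI impI)
    fix f assume "\<forall>l\<in>A. 0 \<le> dotp m f (p l)"
    then obtain g :: "rvec \<Rightarrow> real" where g: "linear g" "\<forall>l\<in>A \<union> R. sgn (g (z l)) = sgn (dotp m f (p l))"
      using base_transfer by blast
    have "dotp m (\<lambda>j. g (b j)) (Z l) = g (z l)" if "l \<in> A \<union> R" for l
      unfolding z_exp[OF that] dotp_def by (simp add: linear_sum[OF g(1)] linear_cmul[OF g(1)] mult.commute)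
    then show "\<exists>g. \<forall>l\<in>A \<union> R. sgn (dotp m g (Z l)) = sgn (dotp m f (p l))" using g(2) by (intro exI[of _ "\<lambda>j. g (b j)"]) auto
  qed
  moreover have "\<forall>l\<in>A \<union> R. \<forall>j<m. sgn (Z l j) = sgn (p l j)" using \<epsilon>(2) by (simp add: Z_def G_def)
  ultimately obtain D c where D: "\<And>j. j < m \<Longrightarrow> 0 < D j" and c: "\<And>l. l \<in> A \<union> R \<Longrightarrow> 0 < c l"
    and Z: "\<And>l j. l \<in> A \<union> R \<Longrightarrow> j < m \<Longrightarrow> Z l j = c l * D j * p l j"
    using base_rigid unfolding diag_rigid_def by metis
  \<comment> \<open>Complements \<open>z l\<close>: \<open>N l + z l\<close> and
    \<open>N l - z l\<close> are positive multiples of the two vectors over \<open>l\<close>, so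
    \<open>N l\<close> has to be the image of the unit vector of the label, up to the factor
    \<open>c l\<close>.\<close>
  define N where "N l = \<gamma> (rho l) (y (Db l False)) *\<^sub>R y (Db l True) + \<gamma> (rho l) (y (Db l True)) *\<^sub>R y (Db l False)" for l
  define B where "B j = (if j < m then D j *\<^sub>R b j else if j < m + q then (1 / c (rinv (j - m))) *\<^sub>R N (rinv (j - m))
      else y (Ap (j - m - q)))" for j
  define L where "L v = (\<Sum>j<Suc d. U j v *\<^sub>R B j)" for v
  have linL: "linear L"
  proof (rule linearI)
    show "L (u + v) = L u + L v" for u v
      unfolding L_def linear_add[OF linear_U] scaleR_left.add sum.distrib ..
    show "L (r *\<^sub>R v) = r *\<^sub>R L v" for r v
      unfolding L_def linear_cmul[OF linear_U] scaleR_sum_right by (intro sum.cong) auto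
  qed
  have Lx: "L (x i) = (\<Sum>j<Suc d. x0 i j *\<^sub>R B j)" for i
    unfolding L_def by (intro sum.cong) (auto simp: U_x)
  have base: "(\<Sum>j<m. p l j *\<^sub>R B j) = (1 / c l) *\<^sub>R z l" if l: "l \<in> A \<union> R" for l
  proof -
    have "(1 / c l) *\<^sub>R z l = (\<Sum>j<m. (1 / c l * Z l j) *\<^sub>R b j)" unfolding z_exp[OF l] by (simp add: scaleR_sum_right)
    also have "\<dots> = (\<Sum>j<m. p l j *\<^sub>R B j)"
      using c[OF l] Z[OF l] by (intro sum.cong) (auto simp: B_def field_simps)
    finally show ?thesis by simp
  qed
  define c' where "c' i = (case i of Pt l \<Rightarrow> 1 / c l | Db l e \<Rightarrow> 2 * \<gamma> (rho l) (y (Db l (\<not> e))) / c l | Ap k \<Rightarrow> 1)" for i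
  have LI: "0 < c' i \<and> L (x i) = c' i *\<^sub>R y i" if "i \<in> I" for i
    using that
  proof (cases rule: I_cases)
    case (1 l)
    then have "L (x i) = (\<Sum>j<m. p l j *\<^sub>R B j)" unfolding Lx sum_split by simp
    then show ?thesis using 1 base[of l] c[of l] by (simp add: c'_def z_A)
  next
    case (2 l e)
    have "(\<Sum>j<m. x0 i j *\<^sub>R B j) = (if e then 1 else - 1) *\<^sub>R (\<Sum>j<m. p l j *\<^sub>R B j)"
      using 2 by (auto simp: scaleR_sum_right sum_negf)
    moreover have "(\<Sum>j<q. x0 i (m + j) *\<^sub>R B (m + j)) = (\<Sum>j<q. if j = rho l then B (m + rho l) else 0)"
      using 2 by (intro sum.cong) auto
    moreover have "(\<Sum>j<s. x0 i (m + q + j) *\<^sub>R B (m + q + j)) = 0"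
      using 2 rho_less[of l] by (intro sum.neutral) auto
    ultimately have "L (x i) = (if e then 1 else - 1) *\<^sub>R ((1 / c l) *\<^sub>R z l) + (1 / c l) *\<^sub>R N l"
      unfolding Lx sum_split using 2 rho_less[of l] base[of l] by (simp add: B_def rinv)
    also have "\<dots> = (1 / c l) *\<^sub>R ((if e then 1 else - 1) *\<^sub>R z l + N l)" by (simp add: scaleR_add_right)
    also have "(if e then 1 else - 1) *\<^sub>R z l + N l = (2 * \<gamma> (rho l) (y (Db l (\<not> e)))) *\<^sub>R y i"
      using 2 by (cases e) (simp_all add: z_def N_def algebra_simps scaleR_2[symmetric])
    finally show ?thesis using 2 c[of l] \<gamma>(3)[OF 2(1)] by (simp add: c'_def)
  next
    case (3 k)
    have "(\<Sum>j<s. x0 i (m + q + j) *\<^sub>R B (m + q + j)) = (\<Sum>j<s. if j = k then B (m + q + k) else 0)"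
      using 3 by (intro sum.cong) auto
    moreover have "(\<Sum>j<m. x0 i j *\<^sub>R B j) = 0" "(\<Sum>j<q. x0 i (m + j) *\<^sub>R B (m + j)) = 0"
      using 3 by (auto intro!: sum.neutral)
    ultimately have "L (x i) = y (Ap k)" unfolding Lx sum_split using 3 by (simp add: B_def)
    then show ?thesis using 3 by (simp add: c'_def)
  qed
  have B_in: "B j \<in> coord_space (Suc d)" if "j < Suc d" for j
    using that b_in y_in I_mem rinv index_diff unfolding B_def N_def
    by (simp add: subspace_add[OF subspace_coord_space] subspace_scale[OF subspace_coord_space])
  have B_up: "G i (B j) = 0" if ji: "j < i" "i < Suc d" for i j
  proof -
    have "j < Suc d" using ji by simp
    then show ?thesis
    proof (cases rule: index_cases)
      case 1
      then show ?thesis using ji b[of i j] by (simp add: B_def linear_cmul[OF linear_G])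
    next
      case (2 k)
      then show ?thesis using ji G_Db(1)[OF 2(1), of i]
        by (simp add: B_def N_def linear_cmul[OF linear_G] linear_add[OF linear_G])
    next
      case (3 k)
      then show ?thesis using ji G_Ap(1)[OF 3(1), of i] by (simp add: B_def)
    qed
  qed
  have B_diag: "G i (B i) \<noteq> 0" if i: "i < Suc d" for i
    using i
  proof (cases rule: index_cases)
    case 1
    then show ?thesis using i b[of i i] D[of i] by (simp add: B_def linear_cmul[OF linear_G])
  next
    case (2 k)
    define l where "l = rinv k"
    have l: "l \<in> R" "rho l = k" using 2 rinv(1,2)[of k] by (auto simp: l_def)
    have "G i (B i) = (1 / c l) * (\<gamma> k (y (Db l False)) * G i (y (Db l True)) + \<gamma> k (y (Db l True)) * G i (y (Db l False)))"
      using 2 i l by (simp add: B_def N_def linear_cmul[OF linear_G] linear_add[OF linear_G] l_def[symmetric])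
    moreover have "0 < \<dots>"
      using \<gamma>(3)[OF l(1,2)] c[of l] l(1) G_Db(2)[OF 2(1)] 2(2) by (simp add: l_def add_pos_pos)
    ultimately show ?thesis by linarith
  next
    case (3 k)
    then show ?thesis using G_Ap(2)[of k] by (simp add: B_def)
  qed
  have "bij_betw L (coord_space (Suc d)) (coord_space (Suc d))"
    unfolding bij_betw_def
  proof
    show "inj_on L (coord_space (Suc d))"
      unfolding linear_injective_on_subspace_0[OF linL subspace_coord_space]
    proof (intro ballI impI)
      fix v assume v: "v \<in> coord_space (Suc d)" "L v = 0"
      have U0: "U j v = 0" if "j < Suc d" for j
        by (rule triangular_inj[of "Suc d" G B "\<lambda>j. U j v", OF linear_G B_up B_diag _ that]) (use v(2) in \<open>auto simp: L_def\<close>)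
      then have lk: "lk v j = 0" if "j < d" for j using that U0[of j] by (simp add: U_def)
      then have "lk v d = 0" using U0[of d] by (simp add: U_def)
      then show "v = 0" using lk v(1) unfolding coord_space_iff
        by (intro poly_mapping_eqI) (metis Suc_leI lookup_zero not_less_less_Suc_eq linorder_not_le)
    qed
    show "L ` coord_space (Suc d) = coord_space (Suc d)"
    proof
      show "L ` coord_space (Suc d) \<subseteq> coord_space (Suc d)"
        unfolding L_def using B_in by (auto intro!: subspace_sum[OF subspace_coord_space] subspace_scale[OF subspace_coord_space]
            simp del: sum.lessThan_Suc)
      have "y i \<in> L ` coord_space (Suc d)" if "i \<in> I" for i
      proof -
        have "y i = L ((1 / c' i) *\<^sub>R x i)" using LI[OF that] by (simp add: linear_cmul[OF linL])
        then show ?thesis using x_in subspace_scale[OF subspace_coord_space] by blast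
      qed
      then have "span (y ` I) \<subseteq> L ` coord_space (Suc d)"
        by (intro span_minimal linear_subspace_image[OF linL subspace_coord_space]) auto
      then show "coord_space (Suc d) \<subseteq> L ` coord_space (Suc d)" using y_span by blast
    qed
  qed
  then show ?thesis using linL LI unfolding linear_automorphism_def by blast
qed

end

sublocale rigid_vertex_family d I x
proof
  fix y :: "'l vert \<Rightarrow> rvec"
  assume 1: "\<And>i. i \<in> I \<Longrightarrow> y i \<in> coord_space (Suc d)"
    and 2: "\<And>f :: rvec \<Rightarrow> real. linear f \<Longrightarrow> (\<And>i. i \<in> I \<Longrightarrow> 0 \<le> f (x i)) \<Longrightarrow>
      \<exists>g :: rvec \<Rightarrow> real. linear g \<and> (\<forall>i\<in>I. 0 \<le> g (y i) \<and> (g (y i) = 0 \<longleftrightarrow> f (x i) = 0))"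
  show "\<exists>A c. linear_automorphism (Suc d) A \<and> (\<forall>i\<in>I. 0 < c i \<and> A (x i) = c i *\<^sub>R y i)"
  proof (rule y_rigid)
    show "\<And>i. i \<in> I \<Longrightarrow> y i \<in> coord_space (Suc d)" by fact
    show "\<And>f :: rvec \<Rightarrow> real. linear f \<Longrightarrow> (\<And>i. i \<in> I \<Longrightarrow> 0 \<le> f (x i)) \<Longrightarrow>
      \<exists>g :: rvec \<Rightarrow> real. linear g \<and> (\<forall>i\<in>I. 0 \<le> g (y i) \<and> (g (y i) = 0 \<longleftrightarrow> f (x i) = 0))" by fact
  qed
qed (use fin_I x_in x_pos exposed in simp_all)

lemma x_span: "coord_space (Suc d) \<subseteq> span (x ` I)"
  by (rule y_span) (use x_in in auto)

end

section \<open>Fields of definition\<close>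

text \<open>Gaussian elimination of a coordinate in which \<open>y k\<close> is nonzero never leaves
  \<open>G\<close>.\<close>

lemma coefficients_in_subfield:
  fixes y :: "'i \<Rightarrow> rvec"
  assumes G: "real_subfield G" and fin: "finite S"
    and y: "\<And>i j. i \<in> S \<Longrightarrow> lk (y i) j \<in> G"
    and ind: "\<And>c. (\<Sum>i\<in>S. c i *\<^sub>R y i) = 0 \<Longrightarrow> \<forall>i\<in>S. c i = 0"
    and v: "\<And>j. lk (\<Sum>i\<in>S. a i *\<^sub>R y i) j \<in> G"
  shows "\<forall>i\<in>S. a i \<in> G"
  using fin y ind v
proof (induction S arbitrary: y rule: finite_induct)
  case (insert k S)
  interpret real_subfield G by fact
  have "y k \<noteq> 0"
  proof
    assume "y k = 0"
    then have "(\<Sum>i\<in>insert k S. (if i = k then 1 else 0) *\<^sub>R y i) = 0" by (intro sum.neutral) auto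
    from insert.prems(2)[OF this] show False by simp
  qed
  then obtain j where j: "lk (y k) j \<noteq> 0"
    by (metis lookup_zero poly_mapping_eqI)
  define r where "r i = lk (y i) j / lk (y k) j" for i
  define y' where "y' i = y i - r i *\<^sub>R y k" for i
  define v where "v = (\<Sum>i\<in>insert k S. a i *\<^sub>R y i)"
  have vG: "lk v i \<in> G" for i using insert.prems(3) by (simp add: v_def)
  have rG: "r i \<in> G" if "i \<in> insert k S" for i
    unfolding r_def using insert.prems(1) that by (intro div) auto
  have vj: "lk v j = a k * lk (y k) j + (\<Sum>i\<in>S. a i * lk (y i) j)"
    using insert.hyps by (simp add: v_def lookup_add lookup_sum lookup_scaleR)
  have shift: "(\<Sum>i\<in>S. c i *\<^sub>R y' i) = (\<Sum>i\<in>S. c i *\<^sub>R y i) - (\<Sum>i\<in>S. c i * r i) *\<^sub>R y k" for c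
    by (simp add: y'_def scaleR_diff_right sum_subtractf scaleR_left.sum)
  have aS: "\<forall>i\<in>S. a i \<in> G"
  proof (rule insert.IH)
    fix i l assume "i \<in> S"
    then show "lk (y' i) l \<in> G"
      using insert.prems(1)[of i l] insert.prems(1)[of k l] rG[of i]
      by (auto simp: y'_def lookup_minus lookup_scaleR intro!: diff mult)
  next
    fix c assume c: "(\<Sum>i\<in>S. c i *\<^sub>R y' i) = 0"
    define c' where "c' = c(k := - (\<Sum>i\<in>S. c i * r i))"
    have "(\<Sum>i\<in>S. c' i *\<^sub>R y i) = (\<Sum>i\<in>S. c i *\<^sub>R y i)"
      using insert.hyps by (intro sum.cong) (auto simp: c'_def)
    then have "(\<Sum>i\<in>insert k S. c' i *\<^sub>R y i) = 0"
      using insert.hyps c unfolding shift by (simp add: c'_def)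
    from insert.prems(2)[OF this] have c0: "\<forall>i\<in>insert k S. c' i = 0" .
    show "\<forall>i\<in>S. c i = 0"
    proof
      fix i assume "i \<in> S"
      then have "c' i = c i" "c' i = 0" using c0 insert.hyps by (auto simp: c'_def)
      then show "c i = 0" by simp
    qed
  next
    fix l
    have "(\<Sum>i\<in>S. a i * r i) = (\<Sum>i\<in>S. a i * lk (y i) j) / lk (y k) j"
      by (simp add: r_def sum_divide_distrib)
    also have "\<dots> = lk v j / lk (y k) j - a k"
      unfolding vj using j by (simp add: field_simps)
    finally have e: "(\<Sum>i\<in>S. a i * r i) = lk v j / lk (y k) j - a k" .
    have "v = a k *\<^sub>R y k + (\<Sum>i\<in>S. a i *\<^sub>R y i)" using insert.hyps by (simp add: v_def)
    then have "(\<Sum>i\<in>S. a i *\<^sub>R y' i) = v - (lk v j / lk (y k) j) *\<^sub>R y k"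
      unfolding shift e by (simp add: algebra_simps)
    then show "lk (\<Sum>i\<in>S. a i *\<^sub>R y' i) l \<in> G"
      using vG insert.prems(1)[of k] by (auto simp: lookup_minus lookup_scaleR intro!: diff mult div)
  qed
  have "(\<Sum>i\<in>S. a i * lk (y i) j) \<in> G"
    using aS insert.prems(1) by (intro sum mult) auto
  then have "(lk v j - (\<Sum>i\<in>S. a i * lk (y i) j)) / lk (y k) j \<in> G"
    using vG insert.prems(1)[of k] by (intro div diff) auto
  moreover have "(lk v j - (\<Sum>i\<in>S. a i * lk (y i) j)) / lk (y k) j = a k"
    unfolding vj using j by simp
  ultimately show ?case using aS by simp
qed simp

context lawrence
begin

lemma form_inj_sum:
  assumes "(\<Sum>i\<in>S. c i *\<^sub>R x i) = 0"
  shows "(\<Sum>i\<in>S. c i * form f (x i)) = 0"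
proof -
  have "form f (\<Sum>i\<in>S. c i *\<^sub>R x i) = 0" unfolding assms by (rule linear_0[OF linear_form])
  then show ?thesis by (simp add: linear_sum[OF linear_form] linear_cmul[OF linear_form])
qed

text \<open>The two vertices over a label differ by twice its base vector, so \<open>rel\<close>
  becomes a linear relation between six vertices, five of which are independent. Its image under
  \<open>B\<close> expresses one \<open>y\<close> by five others with coefficients in
  \<open>G\<close>, and these coefficients are, up to sign, 1 or \<theta> times the factors
  \<open>c\<close>, with a common denominator. The coordinates \<open>j0\<close> and
  \<open>j1\<close> separate \<open>l0\<close> from \<open>l1\<close>.\<close>

lemma field_ratio:
  fixes G :: "real set" and y :: "'l vert \<Rightarrow> rvec"
  assumes G: "real_subfield G" and B: "linear_automorphism (Suc d) B"
    and c: "\<And>i. i \<in> I \<Longrightarrow> 0 < c i" and Bx: "\<And>i. i \<in> I \<Longrightarrow> B (x i) = c i *\<^sub>R y i"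
    and y: "\<And>i j. i \<in> I \<Longrightarrow> lk (y i) j \<in> G"
    and l: "l0 \<in> R" "l1 \<in> R" "l2 \<in> R" "l0 \<noteq> l1" "l0 \<noteq> l2" "l1 \<noteq> l2"
    and rel: "\<And>j. j < m \<Longrightarrow> p l2 j = p l0 j + \<theta> * p l1 j"
    and j0: "j0 < m" "p l0 j0 \<noteq> 0" "p l1 j0 = 0" and j1: "j1 < m" "p l1 j1 \<noteq> 0" "p l0 j1 = 0"
  shows "\<theta> * c (Db l1 True) / c (Db l0 True) \<in> G"
proof -
  interpret real_subfield G by fact
  define S where "S = {Db l2 False, Db l0 True, Db l0 False, Db l1 True, Db l1 False}"
  have S: "finite S" "S \<subseteq> I" using l I_mem(2) by (auto simp: S_def)
  have sumS: "sum f S = f (Db l2 False) + f (Db l0 True) + f (Db l0 False) + f (Db l1 True) + f (Db l1 False)"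
    for f :: "'l vert \<Rightarrow> 'c::comm_monoid_add"
    using l by (simp add: S_def add.assoc)
  have linB: "linear B" and injB: "inj_on B (coord_space (Suc d))"
    using B by (auto simp: linear_automorphism_def bij_betw_def)
  have d0: "dotp m (\<lambda>_. 0) u = 0" for u by (simp add: dotp_def)
  have indx: "\<forall>i\<in>S. e i = 0" if e: "(\<Sum>i\<in>S. e i *\<^sub>R x i) = 0" for e
  proof -
    have r: "rho l0 \<noteq> rho l1" "rho l0 \<noteq> rho l2" "rho l1 \<noteq> rho l2" using l rho_inj by auto
    have "e (Db l2 False) = 0"
      using form_inj_sum[OF e, of "ext (\<lambda>_. 0) (\<lambda>k. if k = rho l2 then 1 else 0) (\<lambda>_. 0)"] r l
      by (simp add: sumS form_ext d0)
    moreover have "e (Db l0 True) + e (Db l0 False) = 0"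
      using form_inj_sum[OF e, of "ext (\<lambda>_. 0) (\<lambda>k. if k = rho l0 then 1 else 0) (\<lambda>_. 0)"] r l
      by (simp add: sumS form_ext d0)
    moreover have "e (Db l1 True) + e (Db l1 False) = 0"
      using form_inj_sum[OF e, of "ext (\<lambda>_. 0) (\<lambda>k. if k = rho l1 then 1 else 0) (\<lambda>_. 0)"] r l
      by (simp add: sumS form_ext d0)
    moreover have u: "dotp m (\<lambda>j. if j = k then 1 else 0) (p l') = p l' k" if "k < m" for k l'
      using that by (simp add: dotp_def if_distrib[of "\<lambda>a. a * _"] cong: if_cong)
    have "(e (Db l0 True) - e (Db l0 False)) * p l0 j0 = 0"
      using form_inj_sum[OF e, of "ext (\<lambda>j. if j = j0 then 1 else 0) (\<lambda>_. 0) (\<lambda>_. 0)"] l j0 \<open>e (Db l2 False) = 0\<close>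
      by (simp add: sumS form_ext u algebra_simps)
    moreover have "(e (Db l1 True) - e (Db l1 False)) * p l1 j1 = 0"
      using form_inj_sum[OF e, of "ext (\<lambda>j. if j = j1 then 1 else 0) (\<lambda>_. 0) (\<lambda>_. 0)"] l j1 \<open>e (Db l2 False) = 0\<close>
      by (simp add: sumS form_ext u algebra_simps)
    ultimately show ?thesis using j0(2) j1(2) by (auto simp: S_def)
  qed
  have indy: "\<forall>i\<in>S. e i = 0" if e: "(\<Sum>i\<in>S. e i *\<^sub>R y i) = 0" for e
  proof -
    have "B (\<Sum>i\<in>S. (e i / c i) *\<^sub>R x i) = (\<Sum>i\<in>S. (e i / c i) *\<^sub>R (c i *\<^sub>R y i))"
      using S(2) Bx by (auto simp: linear_sum[OF linB] linear_cmul[OF linB] intro!: sum.cong)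
    also have "\<dots> = (\<Sum>i\<in>S. e i *\<^sub>R y i)" using S(2) c by (intro sum.cong) (auto simp: less_imp_neq[symmetric])
    finally have "B (\<Sum>i\<in>S. (e i / c i) *\<^sub>R x i) = B 0" using e linear_0[OF linB] by simp
    moreover have "(\<Sum>i\<in>S. (e i / c i) *\<^sub>R x i) \<in> coord_space (Suc d)"
      by (intro subspace_sum[OF subspace_coord_space] subspace_scale[OF subspace_coord_space]) (auto simp: x_in)
    ultimately have "(\<Sum>i\<in>S. (e i / c i) *\<^sub>R x i) = 0"
      using injB subspace_0[OF subspace_coord_space] by (metis inj_onD)
    from indx[OF this] show ?thesis using S(2) c by (metis divide_eq_0_iff less_irrefl subsetD)
  qed
  have x2: "x (Db l2 True) = x (Db l2 False) + (x (Db l0 True) - x (Db l0 False)) + \<theta> *\<^sub>R (x (Db l1 True) - x (Db l1 False))"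
  proof (rule poly_mapping_eqI)
    fix j
    have om2: "dotp m om (p l2) = dotp m om (p l0) + \<theta> * dotp m om (p l1)"
      unfolding dotp_def sum_distrib_left sum.distrib[symmetric] by (intro sum.cong) (auto simp: rel algebra_simps)
    show "lk (x (Db l2 True)) j =
      lk (x (Db l2 False) + (x (Db l0 True) - x (Db l0 False)) + \<theta> *\<^sub>R (x (Db l1 True) - x (Db l1 False))) j"
      using l by (simp add: x_def lookup_add lookup_minus lookup_scaleR lookup_cvec dotp_x0 om2) (auto simp: rel algebra_simps)
  qed
  define a where "a i = (if i = Db l2 False then c i else if i = Db l0 True then c i else if i = Db l0 False then - c i
    else if i = Db l1 True then \<theta> * c i else - \<theta> * c i) / c (Db l2 True)" for i
  have c2: "0 < c (Db l2 True)" using c I_mem(2)[OF l(3)] by blast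
  have "c (Db l2 True) *\<^sub>R y (Db l2 True) = (\<Sum>i\<in>S. (a i * c (Db l2 True)) *\<^sub>R y i)"
  proof -
    have "B (x (Db l2 True)) = c (Db l2 True) *\<^sub>R y (Db l2 True)" using Bx I_mem(2)[OF l(3)] by blast
    then have "c (Db l2 True) *\<^sub>R y (Db l2 True) = B (x (Db l2 False)) + (B (x (Db l0 True)) - B (x (Db l0 False)))
        + \<theta> *\<^sub>R (B (x (Db l1 True)) - B (x (Db l1 False)))"
      unfolding x2 by (simp add: linear_add[OF linB] linear_diff[OF linB] linear_cmul[OF linB])
    then show ?thesis using l c2 Bx[OF I_mem(2)] by (simp add: sumS a_def algebra_simps)
  qed
  then have "(1 / c (Db l2 True)) *\<^sub>R (c (Db l2 True) *\<^sub>R y (Db l2 True)) = (\<Sum>i\<in>S. a i *\<^sub>R y i)"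
    using c2 by (simp add: scaleR_sum_right)
  then have ysum: "(\<Sum>i\<in>S. a i *\<^sub>R y i) = y (Db l2 True)" using c2 by simp
  have aG: "\<forall>i\<in>S. a i \<in> G"
    by (rule coefficients_in_subfield[OF G S(1) _ indy]) (use y S(2) I_mem(2)[OF l(3)] in \<open>auto simp: ysum\<close>)
  have "a (Db l1 True) / a (Db l0 True) \<in> G" using aG by (intro div) (auto simp: S_def)
  moreover have "a (Db l1 True) / a (Db l0 True) = \<theta> * c (Db l1 True) / c (Db l0 True)"
    using l c2 by (simp add: a_def)
  ultimately show ?thesis by simp
qed

end

section \<open>The family of polytopes\<close>

text \<open>The sum of the two edge forms through vertex \<open>k\<close>, with \<open>p''\<close>
  as the edge between the last two vertices; it vanishes at no other vertex.\<close>

definition avert :: "nat \<Rightarrow> nat \<Rightarrow> real list"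
  where "avert K k = (let e = (if k + 2 \<le> K then evl (Suc k) else [0, 0, 1]); e' = (if k = K then evl 0 else evl k)
    in [e ! 0 + e' ! 0, e ! 1 + e' ! 1, e ! 2 + e' ! 2])"

lemma avert_pvert:
  assumes "3 \<le> K" "k \<le> K" "k' \<le> K"
  defines "v \<equiv> avert K k ! 0 * pvert K k' ! 0 + avert K k ! 1 * pvert K k' ! 1 + avert K k ! 2 * pvert K k' ! 2"
  shows "k' = k \<Longrightarrow> v = 0" "k' \<noteq> k \<Longrightarrow> 0 < v"
proof -
  have P: "0 \<le> pvert K k' ! 2" using pvert_nonneg(3)[of K k'] assms by simp
  define e e' where "e = (if k + 2 \<le> K then evl (Suc k) else [0, 0, 1])" and "e' = (if k = K then evl 0 else evl k)"
  have av: "avert K k = [e ! 0 + e' ! 0, e ! 1 + e' ! 1, e ! 2 + e' ! 2]"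
    by (simp only: avert_def e_def e'_def Let_def)
  have ve: "v = (e ! 0 * pvert K k' ! 0 + e ! 1 * pvert K k' ! 1 + e ! 2 * pvert K k' ! 2)
      + (e' ! 0 * pvert K k' ! 0 + e' ! 1 * pvert K k' ! 1 + e' ! 2 * pvert K k' ! 2)"
    unfolding v_def av nth3 by (simp add: distrib_right)
  have "(k' = k \<longrightarrow> v = 0) \<and> (k' \<noteq> k \<longrightarrow> 0 < v)"
  proof -
    consider "k + 2 \<le> K" | "k + 1 = K" | "k = K" using assms(2) by linarith
    then show ?thesis
    proof cases
      case 1
      then have "e = evl (Suc k)" "e' = evl k" by (auto simp: e_def e'_def)
      then have v: "v = evp K (Suc k) k' + evp K k k'" unfolding ve evp_def by simp
      have "0 \<le> evp K (Suc k) k'" "0 \<le> evp K k k'" using 1 assms by (auto intro!: evp_nonneg)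
      moreover have "evp K (Suc k) k' = 0 \<longleftrightarrow> k' = Suc k \<or> k' = k" "evp K k k' = 0 \<longleftrightarrow> k' = k \<or> k' = lo K k"
        using evp_zero[of "Suc k" K k'] evp_zero[of k K k'] 1 assms by (auto simp: lo_def)
      moreover have "lo K k \<noteq> Suc k" using 1 assms(1) by (auto simp: lo_def)
      ultimately show ?thesis unfolding v by fastforce
    next
      case 2
      then have "e = [0, 0, 1]" "e' = evl k" by (auto simp: e_def e'_def)
      then have v: "v = pvert K k' ! 2 + evp K k k'" unfolding ve evp_def by (simp add: nth3)
      have "0 \<le> evp K k k'" using 2 assms by (auto intro!: evp_nonneg)
      moreover have "evp K k k' = 0 \<longleftrightarrow> k' = k \<or> k' + 2 = K"
        using evp_zero[of k K k'] 2 assms by (auto simp: lo_def)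
      moreover have "pvert K k ! 2 = 0" "k' + 2 = K \<Longrightarrow> pvert K k' ! 2 = 1" using 2 by (auto simp: pvert_def nth3)
      ultimately show ?thesis using P unfolding v by (cases "k' = k"; cases "k' + 2 = K") (auto intro: add_nonneg_pos)
    next
      case 3
      then have "e = [0, 0, 1]" "e' = evl 0" by (auto simp: e_def e'_def)
      then have v: "v = pvert K k' ! 2 + evp K 0 k'" unfolding ve evp_def by (simp add: nth3)
      have "0 \<le> evp K 0 k'" using 3 assms by (auto intro!: evp_nonneg)
      moreover have "evp K 0 k' = 0 \<longleftrightarrow> k' = 0 \<or> k' = k"
        using evp_zero[of 0 K k'] 3 assms by (auto simp: lo_def)
      moreover have "pvert K k ! 2 = 0" "k' = 0 \<Longrightarrow> pvert K k' ! 2 = 1" using 3 assms(1) by (auto simp: pvert_def nth3)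
      ultimately show ?thesis using P 3 assms(1) unfolding v by (cases "k' = k"; cases "k' = 0") (auto intro: add_nonneg_pos)
    qed
  qed
  then show "k' = k \<Longrightarrow> v = 0" "k' \<noteq> k \<Longrightarrow> 0 < v" by auto
qed

lemma pvert_sum_pos: "3 \<le> K \<Longrightarrow> 0 < pvert K k ! 0 + pvert K k ! 1 + pvert K k ! 2"
proof -
  assume K: "3 \<le> K"
  have "0 \<le> real k * (real k - 1)" by (cases k) auto
  then show ?thesis using K by (auto simp: pvert_def nth3 intro: add_nonneg_pos)
qed

text \<open>The vectors of these labels are triangular: those of \<open>LR\<close> and
  \<open>LQ\<close> have their second nonzero entry in \<open>W\<close>, at a smaller index.\<close>

definition tlab :: "nat \<Rightarrow> lab"
  where "tlab j = (if j = 0 then LW 0 0 else if j = 1 then LE 0 else if j = 2 then LE 1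
    else if j < 6 then LR (j - 3) else LQ (j - 6))"

lemma lawrence_bvec:
  assumes K: "3 \<le> K" and T: "finite T" "hom_rigid T" "2 \<in> T" and s: "0 < s"
    and rho: "bij_betw rho (doubL T) {..<q}"
  shows "lawrence 9 q s (\<lambda>l. (!) (bvec K l)) (polyL K) (doubL T) rho tlab (\<lambda>j. if j < 3 then 0 else 1)"
proof
  have T01: "0 \<in> T" "1 \<in> T" using T by (auto simp: hom_rigid_def)
  have K2: "2 \<le> K" using K by simp
  show "finite (polyL K)" by (simp add: polyL_def)
  show "finite (doubL T)" using T by (simp add: doubL_def)
  show "polyL K \<inter> doubL T = {}" by (auto simp: polyL_def doubL_def)
  show "bij_betw rho (doubL T) {..<q}" "0 < s" by fact+
  show "diag_rigid 9 (\<lambda>l. (!) (bvec K l)) (polyL K) (doubL T)" by (rule diag_rigid_bvec[OF K T(2,3)])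
  have nine: "j < 9 \<Longrightarrow> j = 0 \<or> j = 1 \<or> j = 2 \<or> j = 3 \<or> j = 4 \<or> j = 5 \<or> j = 6 \<or> j = 7 \<or> j = 8" for j :: nat
    by linarith
  show "0 \<le> bvec K l ! j" if "l \<in> polyL K" "j < 9" for l j
    using that(1) nine[OF that(2)] pvert_nonneg[OF K2]
    by (auto simp: polyL_def nth_LA nth9 simp del: bvec.simps(1,2))
  show "tlab j \<in> doubL T" if "j < 9" for j
    using nine[OF that] T01 by (auto simp: tlab_def doubL_def)
  show "bvec K (tlab j) ! j \<noteq> 0" if "j < 9" for j
    using nine[OF that] by (auto simp: tlab_def nth9)
  show "bvec K (tlab j) ! i = 0" if "j < i" "i < 9" for j i
  proof -
    have "j < 9" using that by simp
    from nine[OF this] nine[OF that(2)] that(1) show ?thesis by (elim disjE) (auto simp: tlab_def nth9)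
  qed
  show "0 < dotp 9 (\<lambda>j. if j < 3 then 0 else 1) ((!) (bvec K l))" if "l \<in> polyL K" for l
    using that pvert_sum_pos[OF K] by (auto simp: polyL_def dotp9 nth_LA nth9 simp del: bvec.simps(1,2))
  show "\<bar>dotp 9 (\<lambda>j. if j < 3 then 0 else 1) ((!) (bvec K l))\<bar> < 2" if "l \<in> doubL T" for l
    using that by (cases rule: doubL_cases) (auto simp: dotp9 nth9)
  show "\<exists>f. dotp 9 f ((!) (bvec K l)) = 0 \<and> (\<forall>l'\<in>polyL K. l' \<noteq> l \<longrightarrow> 0 < dotp 9 f ((!) (bvec K l')))" if "l \<in> polyL K" for l
  proof -
    consider k where "k \<le> K" "l = LA k" | k where "k \<le> K" "l = LB k" using \<open>l \<in> polyL K\<close> by (auto simp: polyL_def)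
    then show ?thesis
    proof cases
      case 1
      let ?f = "(!) [0,0,0,avert K k ! 0,avert K k ! 1,avert K k ! 2,1,1,1]"
      have "dotp 9 ?f ((!) (bvec K l)) = 0" using 1 avert_pvert(1)[OF K 1(1) 1(1)]
        by (simp add: dotp9 nth_LA nth9 del: bvec.simps(1,2))
      moreover have "0 < dotp 9 ?f ((!) (bvec K l'))" if "l' \<in> polyL K" "l' \<noteq> l" for l'
      proof -
        from that(1) consider (a) k' where "k' \<le> K" "l' = LA k'" | (b) k' where "k' \<le> K" "l' = LB k'" by (auto simp: polyL_def)
        then show ?thesis
        proof cases
          case a
          then have "k' \<noteq> k" using that(2) 1(2) by auto
          from avert_pvert(2)[OF K 1(1) a(1) this] show ?thesis using a(2) by (simp add: dotp9 nth_LA nth9 del: bvec.simps(1,2))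
        next
          case b
          then show ?thesis using pvert_sum_pos[OF K, of k'] by (simp add: dotp9 nth_LA nth9 del: bvec.simps(1,2))
        qed
      qed
      ultimately show ?thesis by blast
    next
      case 2
      let ?f = "(!) [0,0,0,1,1,1,avert K k ! 0,avert K k ! 1,avert K k ! 2]"
      have "dotp 9 ?f ((!) (bvec K l)) = 0" using 2 avert_pvert(1)[OF K 2(1) 2(1)]
        by (simp add: dotp9 nth_LA nth9 del: bvec.simps(1,2))
      moreover have "0 < dotp 9 ?f ((!) (bvec K l'))" if "l' \<in> polyL K" "l' \<noteq> l" for l'
      proof -
        from that(1) consider (a) k' where "k' \<le> K" "l' = LB k'" | (b) k' where "k' \<le> K" "l' = LA k'" by (auto simp: polyL_def)
        then show ?thesis
        proof cases
          case a
          then have "k' \<noteq> k" using that(2) 2(2) by auto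
          from avert_pvert(2)[OF K 2(1) a(1) this] show ?thesis using a(2) by (simp add: dotp9 nth_LA nth9 del: bvec.simps(1,2))
        next
          case b
          then show ?thesis using pvert_sum_pos[OF K, of k'] by (simp add: dotp9 nth_LA nth9 del: bvec.simps(1,2))
        qed
      qed
      ultimately show ?thesis by blast
    qed
  qed
  show "\<exists>f. (\<forall>l'\<in>polyL K. 0 < dotp 9 f ((!) (bvec K l'))) \<and> 0 < (if b then 1 else - 1) * dotp 9 f ((!) (bvec K l))"
    if "l \<in> doubL T" for l b
  proof -
    \<comment> \<open>Every doubled vector has a nonzero \<open>W\<close> part. Four times the inner
      product with that part outweighs the entries on \<open>U\<close> and \<open>U'\<close>, whose
      sum is at most 1, and does not affect the polygons.\<close>
    let ?e = "if b then 4 else - 4 :: real"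
    let ?f = "\<lambda>j. if j < 3 then ?e * bvec K l ! j else 1"
    have "0 < dotp 9 ?f ((!) (bvec K l'))" if "l' \<in> polyL K" for l'
      using that pvert_sum_pos[OF K] by (auto simp: polyL_def dotp9 nth_LA nth9 simp del: bvec.simps(1,2))
    moreover have "0 < (if b then 1 else - 1) * dotp 9 ?f ((!) (bvec K l))"
      using that
    proof (cases rule: doubL_cases)
      case (1 a e)
      have "0 < 4 + (4 * (a * a) + 4 * (e * e))" by (intro add_pos_nonneg) auto
      then show ?thesis using 1 by (cases b) (auto simp: dotp9 nth9 algebra_simps)
    qed (cases b; auto simp: dotp9 nth9)+
    ultimately show ?thesis by blast
  qed
qed

theorem theoremA27:
  fixes F :: "real set"
  assumes "subfield F real_ring"
    and "ring.finite_dimension real_ring \<rat> F"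
  shows "\<exists>D::int. \<forall>d::nat. int d \<ge> D \<longrightarrow>
    (\<exists>P :: nat \<Rightarrow> rvec set. \<forall>n\<ge>1.
       sph_d_polytope d (P n) \<and>
       projectively_unique d (P n) \<and>
       int (card (sph_vertices d (P n))) = 12 * (int n + 1) + int d + D - 9 \<and>
       vertex_coords_in d (P n) F \<and>
       (\<forall>G. subfield G real_ring \<and> G \<subset> F \<longrightarrow> \<not> realizable_over d (P n) G))"
proof -
  interpret F: real_subfield F by (rule subfield_real_subfield[OF assms(1)])
  obtain T where T: "finite T" "T \<subseteq> F" "hom_rigid T" "2 \<in> T" "\<And>G. real_subfield G \<Longrightarrow> T \<subseteq> G \<Longrightarrow> F \<subseteq> G"
    using exists_hom_rigid[OF assms] by metis
  have T01: "0 \<in> T" "1 \<in> T" using T(3) by (auto simp: hom_rigid_def)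
  define q where "q = card (doubL T)"
  have "finite (doubL T)" using T(1) by (simp add: doubL_def)
  then obtain rho where rho: "bij_betw rho (doubL T) {..<q}"
    using ex_bij_betw_finite_nat unfolding q_def atLeast0LessThan by blast
  have one: "\<exists>P. sph_d_polytope d P \<and> projectively_unique d P \<and>
       int (card (sph_vertices d P)) = 12 * (int n + 1) + int d + (int q + 13) - 9 \<and>
       vertex_coords_in d P F \<and> (\<forall>G. subfield G real_ring \<and> G \<subset> F \<longrightarrow> \<not> realizable_over d P G)"
    if d: "int d \<ge> int q + 13" for d n
  proof -
    \<comment> \<open>The polytope has dimension \<open>8 + q + s\<close> and \<open>2 * (K + 1) + 2 * q + s\<close> vertices.\<close>
    define s where "s = d - 8 - q"
    have s: "0 < s" "9 + q + s - 1 = d" using d by (auto simp: s_def)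
    \<comment> \<open>With \<open>s = d - 8 - q\<close> there are
      \<open>2 * (K + 1) + q + d - 8\<close> vertices; this \<open>K\<close> makes the number equal
      to \<open>12 * (n + 1) + d + D - 9\<close> for \<open>D = q + 13\<close>.\<close>
    define K where "K = 6 * n + 11"
    have K: "3 \<le> K" by (simp add: K_def)
    interpret L: lawrence 9 q s "\<lambda>l. (!) (bvec K l)" "polyL K" "doubL T" rho tlab "\<lambda>j. if j < 3 then 0 else 1"
      by (rule lawrence_bvec[OF K T(1,3,4) s(1) rho])
    have Ld: "L.d = d" using s(2) by (simp add: L.d_def)
    have "sph_d_polytope d L.Pol"
      using L.sph_polytope_Pol L.dim_Pol[OF L.x_span] by (simp add: sph_d_polytope_def Ld)
    moreover have "projectively_unique d L.Pol" using L.projectively_unique_Pol by (simp add: Ld)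
    moreover have "int (card (sph_vertices d L.Pol)) = 12 * (int n + 1) + int d + (int q + 13) - 9"
    proof -
      have "card (polyL K) = 2 * (K + 1)"
      proof -
        have "card (polyL K) = card (LA ` {..K}) + card (LB ` {..K})"
          unfolding polyL_def by (rule card_Un_disjoint) auto
        then show ?thesis by (simp add: card_image inj_on_def)
      qed
      then show ?thesis using L.card_vertices L.card_I s d unfolding Ld K_def by simp
    qed
    moreover have "vertex_coords_in d L.Pol F"
    proof -
      have nine: "j < 9 \<Longrightarrow> j = 0 \<or> j = 1 \<or> j = 2 \<or> j = 3 \<or> j = 4 \<or> j = 5 \<or> j = 6 \<or> j = 7 \<or> j = 8" for j :: nat
        by linarith
      have F2: "2 \<in> F" "1 \<in> F" "0 \<in> F" "- 1 \<in> F" "- 2 \<in> F"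
        using F.of_int[of 2] F.of_int[of "- 2"] F.of_int[of "- 1"] F.one F.zero by simp_all
      have pF: "pvert K k ! 0 \<in> F" "pvert K k ! 1 \<in> F" "pvert K k ! 2 \<in> F" for k
        using F2 by (auto simp: pvert_def nth3 intro!: F.div F.mult F.add F.diff F.of_nat)
      have bF: "bvec K l ! j \<in> F" if "l \<in> polyL K \<union> doubL T" "j < 9" for l j
      proof (cases "l \<in> polyL K")
        case True
        then show ?thesis using nine[OF that(2)] pF F2 by (auto simp: polyL_def nth_LA nth9 simp del: bvec.simps(1,2))
      next
        case False
        then have "l \<in> doubL T" using that(1) by simp
        then show ?thesis using nine[OF that(2)] F2 T(2) by (cases rule: doubL_cases) (auto simp: nth9)
      qed
      have x0F: "L.x0 i j \<in> F" if "i \<in> L.I" for i j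
        using that by (cases rule: L.I_cases) (use bF F2 F.minus in auto)
      have omF: "L.om j \<in> F" for j using F2 by (simp add: L.om_def)
      have xF: "lk (L.x i) j \<in> F" if "i \<in> L.I" for i j
        using x0F[OF that] omF F2 by (auto simp: L.x_def lookup_cvec dotp_def intro!: F.sum F.mult F.add)
      have "vertex_coords_in L.d L.Pol F" by (rule L.vertex_coords) (use xF F.div in auto)
      then show ?thesis by (simp add: Ld)
    qed
    moreover have "\<not> realizable_over d L.Pol G" if G: "subfield G real_ring" "G \<subset> F" for G
    proof
      interpret G: real_subfield G by (rule subfield_real_subfield[OF G(1)])
      assume "realizable_over d L.Pol G"
      then obtain Q \<phi> where Q: "sph_polytope d Q" "face_lattice_iso d L.Pol Q \<phi>" "vertex_coords_in d Q G"
        by (auto simp: realizable_over_def combinatorially_equivalent_def)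
      have Q': "sph_polytope L.d Q" "face_lattice_iso L.d L.Pol Q \<phi>" using Q(1,2) by (simp_all add: Ld)
      obtain u B c where u': "\<And>i. i \<in> L.I \<Longrightarrow> u i \<in> sph_vertices L.d Q"
        and B: "linear_automorphism (Suc L.d) B" and c: "\<And>i. i \<in> L.I \<Longrightarrow> 0 < c i"
        and Bx': "\<And>i. i \<in> L.I \<Longrightarrow> B (L.x i) = c i *\<^sub>R homog L.d (u i)"
        using L.realization[OF Q'] by metis
      note u = u'[unfolded Ld] and Bx = Bx'[unfolded Ld]
      have yG: "lk (homog d (u i)) j \<in> G" if "i \<in> L.I" for i j
      proof (cases "j \<le> d")
        case True
        then show ?thesis using Q(3) u[OF that] by (simp add: vertex_coords_in_def)
      next
        case False
        have "homog d (u i) \<in> coord_space (Suc d)"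
          using u[OF that] Q(1) homog_in_hplane by (auto simp: sph_vertices_def sph_polytope_def hplane_def)
        then show ?thesis using False G.zero by (simp add: coord_space_iff)
      qed
      \<comment> \<open>In \<open>W\<close> the labels \<open>LW 0 0\<close>, \<open>LE 0\<close>,
        \<open>LW \<theta> 0\<close> are \<open>[1,0,0]\<close>, \<open>[0,1,0]\<close>,
        \<open>[1,\<theta>,0]\<close>, so \<theta> is the coefficient of a linear relation between
        vectors of the configuration.\<close>
      have ratio: "\<theta> * c (Db (LE 0) True) / c (Db (LW 0 0) True) \<in> G" if \<theta>: "\<theta> \<in> T" "\<theta> \<noteq> 0" for \<theta>
      proof (rule L.field_ratio[of G B c "\<lambda>i. homog d (u i)" "LW 0 0" "LE 0" "LW \<theta> 0" \<theta> 0 1])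
        show "real_subfield G" by (rule G.real_subfield_axioms)
        show "linear_automorphism (Suc L.d) B" by (rule B)
        show "LW 0 0 \<in> doubL T" "LE 0 \<in> doubL T" "LW \<theta> 0 \<in> doubL T" using T01 \<theta> by (auto simp: doubL_def)
        fix j :: nat assume "j < 9"
        then have "j = 0 \<or> j = 1 \<or> j = 2 \<or> j = 3 \<or> j = 4 \<or> j = 5 \<or> j = 6 \<or> j = 7 \<or> j = 8" by linarith
        then show "bvec K (LW \<theta> 0) ! j = bvec K (LW 0 0) ! j + \<theta> * bvec K (LE 0) ! j" by (auto simp: nth9)
      qed (use c Bx yG \<theta> in auto)
      have pos: "0 < c (Db (LE 0) True)" "0 < c (Db (LW 0 0) True)"
      proof -
        have "LE 0 \<in> doubL T" "LW 0 0 \<in> doubL T" using T01 by (auto simp: doubL_def)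
        then show "0 < c (Db (LE 0) True)" "0 < c (Db (LW 0 0) True)" using c L.I_mem(2) by blast+
      qed
      have "\<theta> \<in> G" if "\<theta> \<in> T" for \<theta>
      proof (cases "\<theta> = 0")
        case False
        \<comment> \<open>The quotient of scale factors does not involve \<theta>, so dividing by
          the case of 1 leaves \<theta>.\<close>
        have "(\<theta> * c (Db (LE 0) True) / c (Db (LW 0 0) True)) / (1 * c (Db (LE 0) True) / c (Db (LW 0 0) True)) \<in> G"
          by (rule G.div[OF ratio[OF that False] ratio[OF T01(2) one_neq_zero]])
        then show ?thesis using pos by simp
      qed (use G.zero in simp)
      then have "F \<subseteq> G" using T(5)[OF G.real_subfield_axioms] by blast
      then show False using G(2) by blast
    qed
    ultimately show ?thesis by blast
  qed
  show ?thesis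
  proof (intro exI[of _ "int q + 13"] allI impI)
    fix d :: nat assume "int d \<ge> int q + 13"
    then show "\<exists>P :: nat \<Rightarrow> rvec set. \<forall>n\<ge>1.
       sph_d_polytope d (P n) \<and> projectively_unique d (P n) \<and>
       int (card (sph_vertices d (P n))) = 12 * (int n + 1) + int d + (int q + 13) - 9 \<and>
       vertex_coords_in d (P n) F \<and>
       (\<forall>G. subfield G real_ring \<and> G \<subset> F \<longrightarrow> \<not> realizable_over d (P n) G)"
      using one[of d] by metis
  qed
qed

end
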